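(* Let $t\in[0,T)$ and $X^t\in H$, with $\bar X^t:=\int_{\mathbb R^n}X^t_x\,dm(x)$. For a control $V(\cdot)\in L^2(t,T;U)$, let $X(\cdot)$ be the solution of $$\frac{d}{ds}X_x(s)=F(s)X_x(s)+\bar F(s)\bar X(s)+G(s)V_x(s)+f(s),\qquad X_x(t)=X^t_x,\quad x\in\mathbb R^n,$$ where $\bar X(s)=\int X_x(s)\,dm(x)$. Consider the payoff $$J_{Xt}(V(\cdot))=\int_t^T\Big[\tfrac12(\mathcal M(s)X(s),X(s))_H+\tfrac12(N(s)V(s),V(s))_U+\alpha(s)\cdot\bar X(s)+\beta(s)\cdot\bar V(s)\Big]ds+\tfrac12(\mathcal M_TX(T),X(T))_H+\alpha_T\cdot\bar X(T),$$ with $\bar V(s)=\int V_x(s)\,dm(x)$. Let $P$ and $\Sigma$ be the (unique, symmetric positive semidefinite) solutions on $[t,T]$ of $$\dot P+PF+F^*P-PGN^{-1}G^*P+M+\bar M=0,\quad P(T)=M_T+\bar M_T,$$ $$\dot \Sigma+\Sigma(F+\bar F)+(F+\bar F)^*\Sigma-\Sigma GN^{-1}G^*\Sigma+M+\bar M+\bar M_S=0,\quad \Sigma(T)=M_T+\bar M_T+\bar M_S(T),$$ set $\Gamma:=\Sigma-P$, and let $\lambda:[t,T]\to\mathbb R^n$ solve $$\dot\lambda+(F^*+\bar F^*-\Sigma GN^{-1}G^* )\lambda+\alpha+\Sigma(f-GN^{-1}\beta)=0,\quad \lambda(T)=\alpha_T.$$ Let $\hat{\bar X}$ and $\hat X_x$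 solve $$\dot{\hat{\bar X}}=(F+\bar F-GN^{-1}G^*\Sigma)\hat{\bar X}-GN^{-1}(G^*\lambda+\beta)+f,\quad \hat{\bar X}(t)=\bar X^t,$$ $$\dot{\hat X}_x=(F-GN^{-1}G^*P)\hat X_x+(\bar F-GN^{-1}G^*\Gamma)\hat{\bar X}-GN^{-1}(G^*\lambda+\beta)+f,\quad \hat X_x(t)=X^t_x.$$ Then the control $$\hat V_x(s)=-N^{-1}(s)G^*(s)\big(P(s)\hat X_x(s)+\Gamma(s)\hat{\bar X}(s)\big)-N^{-1}(s)\big(G^*(s)\lambda(s)+\beta(s)\big)$$ is the unique minimizer of $J_{Xt}$ over $L^2(t,T;U)$, and $$\inf_{V(\cdot)}J_{Xt}(V(\cdot))=\tfrac12\int_{\mathbb R^n}P(t)X^t_x\cdot X^t_x\,dm(x)+\tfrac12\Gamma(t)\bar X^t\cdot\bar X^t+\lambda(t)\cdot\bar X^t+C_t,$$ where $C_t=\int_t^Tf(s)\cdot\lambda(s)\,ds-\tfrac12\int_t^TN^{-1}(s)(G^*(s)\lambda(s)+\beta(s))\cdot(G^*(s)\lambda(s)+\beta(s))\,ds$.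
   Context: Let $m$ be a probability measure on $\mathbb R^n$, $H=L^2_m(\mathbb R^n;\mathbb R^n)$ and $U=L^2_m(\mathbb R^n;\mathbb R^d)$ with $(X,Y)_H=\int X_x\cdot Y_x\,dm(x)$, $(V,W)_U=\int V_x\cdot W_x\,dm(x)$; for $X\in H$, $\bar X=\int X_x\,dm(x)$. Data: $F,\bar F,M,\bar M,S\in L^\infty(0,T;\mathbb R^{n\times n})$ with $M,\bar M$ symmetric; $G\in L^\infty(0,T;\mathbb R^{n\times d})$; $N$ symmetric positive definite with $N,N^{-1}\in L^\infty(0,T;\mathbb R^{d\times d})$; $M_T,\bar M_T$ symmetric $n\times n$ matrices; $f\in L^2(0,T;\mathbb R^n)$, $\alpha\in L^\infty(0,T;\mathbb R^n)$, $\beta\in L^\infty(0,T;\mathbb R^d)$, $\alpha_T\in\mathbb R^n$. Define $\bar M_S(s)=S^*(s)\bar M(s)S(s)-S^*(s)\bar M(s)-\bar M(s)S(s)$ and $\bar M_S(T)=S^*(T)\bar M_TS(T)-S^*(T)\bar M_T-\bar M_TS(T)$. Operators on $H$: $(\mathcal M(s)X)_x=(M(s)+\bar M(s))X_x+\bar M_S(s)\bar X$, $(\mathcal M_TX)_x=(M_T+\bar M_T)X_x+\bar M_S(T)\bar X$. Standing assumption: $M(s)+\bar M(s)$, $M(s)+\bar M(s)+\bar M_S(s)$ (for all $s$), $M_T+\bar M_T$ and $M_T+\bar M_T+\bar M_S(T)$ are positive semidefinite. *)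

theory Defs
  imports "HOL-Probability.Probability"
begin

definition sym_mat :: "real^'n^'n \<Rightarrow> bool" where
  "sym_mat A \<longleftrightarrow> transpose A = A"

definition psd_mat :: "real^'n^'n \<Rightarrow> bool" where
  "psd_mat A \<longleftrightarrow> (\<forall>v. 0 \<le> (A *v v) \<bullet> v)"

definition pd_mat :: "real^'n^'n \<Rightarrow> bool" where
  "pd_mat A \<longleftrightarrow> (\<forall>v. v \<noteq> 0 \<longrightarrow> 0 < (A *v v) \<bullet> v)"

definition MbarS :: "real^'n^'n \<Rightarrow> real^'n^'n \<Rightarrow> real^'n^'n" where
  "MbarS S Mb = transpose S ** Mb ** S - transpose S ** Mb - Mb ** S"

definition Linf_on :: "real set \<Rightarrow> (real \<Rightarrow> 'a::euclidean_space) \<Rightarrow> bool" where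
  "Linf_on I g \<longleftrightarrow> g \<in> borel_measurable borel \<and> bounded (g ` I)"

definition L2_on :: "real set \<Rightarrow> (real \<Rightarrow> 'a::euclidean_space) \<Rightarrow> bool" where
  "L2_on I g \<longleftrightarrow> g \<in> borel_measurable borel \<and> set_integrable lborel I (\<lambda>s. (norm (g s))\<^sup>2)"

definition inL2 :: "'x measure \<Rightarrow> ('x \<Rightarrow> 'a::euclidean_space) \<Rightarrow> bool" where
  "inL2 m X \<longleftrightarrow> X \<in> borel_measurable m \<and> integrable m (\<lambda>x. (norm (X x))\<^sup>2)"

definition mean :: "'x measure \<Rightarrow> ('x \<Rightarrow> 'a::euclidean_space) \<Rightarrow> 'a" where
  "mean m X = integral\<^sup>L m X"

definition innerL2 :: "'x measure \<Rightarrow> ('x \<Rightarrow> 'a::euclidean_space) \<Rightarrow> ('x \<Rightarrow> 'a) \<Rightarrow> real" where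
  "innerL2 m X Y = (\<integral>x. X x \<bullet> Y x \<partial>m)"

text \<open>operator (calM X)_x = A X_x + B Xbar (with A = M + Mbar, B = Mbar_S)\<close>
definition Mop :: "'x measure \<Rightarrow> real^'n^'n \<Rightarrow> real^'n^'n \<Rightarrow> ('x \<Rightarrow> real^'n) \<Rightarrow> ('x \<Rightarrow> real^'n)" where
  "Mop m A B X = (\<lambda>x. A *v X x + B *v mean m X)"

text \<open>An element of L^2(t,T;U) is represented by a jointly measurable function
  (s,x) \<mapsto> V_x(s) on [t,T] \<times> R^n which is square integrable for ds \<otimes> dm.\<close>
definition adm :: "(real^'n) measure \<Rightarrow> real \<Rightarrow> real \<Rightarrow> (real \<Rightarrow> real^'n \<Rightarrow> real^'d) set" where
  "adm m t T = {V. (\<lambda>(s,x). V s x) \<in> borel_measurable (restrict_space lborel {t..T} \<Otimes>\<^sub>M m)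
        \<and> integrable (restrict_space lborel {t..T} \<Otimes>\<^sub>M m) (\<lambda>(s,x). (norm (V s x))\<^sup>2)}"

definition fwd_sol :: "real \<Rightarrow> real \<Rightarrow> 'a::euclidean_space \<Rightarrow> (real \<Rightarrow> 'a \<Rightarrow> 'a) \<Rightarrow> (real \<Rightarrow> 'a) \<Rightarrow> bool" where
  "fwd_sol t T y0 g y \<longleftrightarrow> set_integrable lborel {t..T} (\<lambda>r. g r (y r)) \<and>
     (\<forall>s\<in>{t..T}. y s = y0 + set_lebesgue_integral lborel {t..s} (\<lambda>r. g r (y r)))"

text \<open>backward problem y' + g(r,y) = 0, y(T) = yT\<close>
definition bwd_sol :: "real \<Rightarrow> real \<Rightarrow> 'a::euclidean_space \<Rightarrow> (real \<Rightarrow> 'a \<Rightarrow> 'a) \<Rightarrow> (real \<Rightarrow> 'a) \<Rightarrow> bool" where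
  "bwd_sol t T yT g y \<longleftrightarrow> set_integrable lborel {t..T} (\<lambda>r. g r (y r)) \<and>
     (\<forall>s\<in>{t..T}. y s = yT + set_lebesgue_integral lborel {s..T} (\<lambda>r. g r (y r)))"

definition is_state ::
  "(real^'n) measure \<Rightarrow> (real \<Rightarrow> real^'n^'n) \<Rightarrow> (real \<Rightarrow> real^'n^'n) \<Rightarrow> (real \<Rightarrow> real^'d^'n)
   \<Rightarrow> (real \<Rightarrow> real^'n) \<Rightarrow> real \<Rightarrow> real \<Rightarrow> (real^'n \<Rightarrow> real^'n)
   \<Rightarrow> (real \<Rightarrow> real^'n \<Rightarrow> real^'d) \<Rightarrow> (real \<Rightarrow> real^'n \<Rightarrow> real^'n) \<Rightarrow> bool" where
  "is_state m F Fb G f t T Xt V X \<longleftrightarrow>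
     (\<forall>s\<in>{t..T}. inL2 m (X s)) \<and>
     (AE x in m. fwd_sol t T (Xt x)
        (\<lambda>r y. F r *v y + Fb r *v mean m (X r) + G r *v V r x + f r) (\<lambda>r. X r x))"

definition cost ::
  "(real^'n) measure \<Rightarrow> (real \<Rightarrow> real^'n^'n) \<Rightarrow> (real \<Rightarrow> real^'n^'n) \<Rightarrow> (real \<Rightarrow> real^'n^'n)
   \<Rightarrow> (real \<Rightarrow> real^'d^'d) \<Rightarrow> (real \<Rightarrow> real^'n) \<Rightarrow> (real \<Rightarrow> real^'d)
   \<Rightarrow> real^'n^'n \<Rightarrow> real^'n^'n \<Rightarrow> real^'n \<Rightarrow> real \<Rightarrow> real
   \<Rightarrow> (real \<Rightarrow> real^'n \<Rightarrow> real^'n) \<Rightarrow> (real \<Rightarrow> real^'n \<Rightarrow> real^'d) \<Rightarrow> real" where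
  "cost m M Mb S N \<alpha> \<beta> MT MbT \<alpha>T t T X V =
     set_lebesgue_integral lborel {t..T} (\<lambda>s.
         1/2 * innerL2 m (Mop m (M s + Mb s) (MbarS (S s) (Mb s)) (X s)) (X s)
       + 1/2 * innerL2 m (\<lambda>x. N s *v V s x) (V s)
       + \<alpha> s \<bullet> mean m (X s) + \<beta> s \<bullet> mean m (V s))
     + 1/2 * innerL2 m (Mop m (MT + MbT) (MbarS (S T) MbT) (X T)) (X T)
     + \<alpha>T \<bullet> mean m (X T)"

text \<open>The payoff J_{Xt}(V): cost evaluated along the (a.e. unique) state of V.\<close>
definition Jpay ::
  "(real^'n) measure \<Rightarrow> (real \<Rightarrow> real^'n^'n) \<Rightarrow> (real \<Rightarrow> real^'n^'n) \<Rightarrow> (real \<Rightarrow> real^'d^'n)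
   \<Rightarrow> (real \<Rightarrow> real^'n) \<Rightarrow> (real \<Rightarrow> real^'n^'n) \<Rightarrow> (real \<Rightarrow> real^'n^'n) \<Rightarrow> (real \<Rightarrow> real^'n^'n)
   \<Rightarrow> (real \<Rightarrow> real^'d^'d) \<Rightarrow> (real \<Rightarrow> real^'n) \<Rightarrow> (real \<Rightarrow> real^'d)
   \<Rightarrow> real^'n^'n \<Rightarrow> real^'n^'n \<Rightarrow> real^'n \<Rightarrow> real \<Rightarrow> real \<Rightarrow> (real^'n \<Rightarrow> real^'n)
   \<Rightarrow> (real \<Rightarrow> real^'n \<Rightarrow> real^'d) \<Rightarrow> real" where
  "Jpay m F Fb G f M Mb S N \<alpha> \<beta> MT MbT \<alpha>T t T Xt V =
     cost m M Mb S N \<alpha> \<beta> MT MbT \<alpha>T t T (SOME X. is_state m F Fb G f t T Xt V X) V"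

end

theory Submission
  imports Defs
begin

text \<open>
  Split the state and the control into their means over m and the fluctuations around them. The
  cost then separates: the mean solves a deterministic linear-quadratic problem with drift
  \<open>F + Fb\<close> and weight \<open>M + Mb + MbarS\<close>, whose Riccati solution is \<open>\<Sigma>\<close>, while for almost every x
  the fluctuation solves a homogeneous linear-quadratic problem with drift F and weight \<open>M + Mb\<close>,
  whose Riccati solution is P. Completing the square along a trajectory in each of the two
  problems gives cost = value + nonnegative quadratic form in the deviation of the control from
  the feedback law. The form vanishes exactly along the feedback, and the closed-loop equations
  determine the state, so the minimiser is unique.

  The symmetry of P and \<open>\<Sigma>\<close> needed for this follows from uniqueness for the linear (Sylvester)
  equation satisfied by \<open>P - P\<^sup>T\<close>. All existence and uniqueness statements for linear equations
  with bounded measurable coefficients are reduced to a fundamental matrix and variation of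
  constants.
\<close>

section \<open>Absolutely continuous functions\<close>

text \<open>The data are only measurable in time, so every differential equation is read as an
  integral equation, and the calculus it needs, above all the product rule, has to come from Fubini
  on a triangle. A second obstacle is measurability of the state: it is only required to be square
  integrable in x at each time and to solve its equation for almost every x. Nothing is said
  directly about joint measurability in time and x or about the time dependence of the mean.
  Variation of constants supplies a jointly measurable, square integrable version Y of any state,
  and the quadratic form of the fluctuation is written with Y. Since the payoff selects a state by
  choice, each statement about the cost is made for an arbitrary state of the control. In the
  uniqueness proof the deviation is measured along the state of the competing control, so its
  vanishing does not yet identify that control; it turns the equation of that state into the closed
  loop, and there linear uniqueness applies.\<close>

abbreviation (input) leb_on :: "real \<Rightarrow> real \<Rightarrow> real measure" where
  "leb_on t T \<equiv> restrict_space lborel {t..T}"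

lemma space_leb_on [simp]: "space (leb_on t T) = {t..T}"
  by (simp add: space_restrict_space)

lemma finite_measure_leb_on: "finite_measure (leb_on t T)"
  by (rule finite_measureI)
    (use emeasure_lborel_cbox_finite[of t T] in \<open>auto simp: emeasure_restrict_space cbox_interval\<close>)

lemma leb_on_borel_measurableI:
  "g \<in> borel_measurable borel \<Longrightarrow> g \<in> borel_measurable (leb_on t T)"
  by (rule measurable_restrict_space1) simp

lemma measurable_ident_leb_on [measurable]: "(\<lambda>x. x) \<in> borel_measurable (leb_on t T)"
  by (rule leb_on_borel_measurableI) simp

text \<open>Intervals that share the endpoint s, and the two triangles below that share the
  diagonal, overlap only in null sets; both facts come from here.\<close>

lemma AE_leb_on_neq: "AE r in leb_on t T. r \<noteq> s"
  using AE_lborel_singleton[of s] by (auto simp: AE_restrict_space_iff elim: eventually_mono)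

lemma set_integrable_leb_on_iff:
  fixes g :: "real \<Rightarrow> 'a::euclidean_space"
  shows "set_integrable lborel {t..T} g \<longleftrightarrow> integrable (leb_on t T) g"
  by (simp add: set_integrable_def integrable_restrict_space)

lemma set_integral_leb_on:
  fixes g :: "real \<Rightarrow> 'a::euclidean_space"
  assumes "t \<le> a" "b \<le> T"
  shows "set_lebesgue_integral lborel {a..b} g = (\<integral>r. indicator {a..b} r *\<^sub>R g r \<partial>leb_on t T)"
proof -
  have "indicator {t..T} r *\<^sub>R indicator {a..b} r *\<^sub>R g r = indicator {a..b} r *\<^sub>R g r" for r
    using assms by (auto split: split_indicator)
  then show ?thesis
    by (simp add: set_lebesgue_integral_def integral_restrict_space del: scaleR_scaleR)
qed

lemma set_integral_leb_on_whole:
  fixes g :: "real \<Rightarrow> 'a::euclidean_space"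
  shows "set_lebesgue_integral lborel {t..T} g = (\<integral>r. g r \<partial>leb_on t T)"
  by (simp add: set_lebesgue_integral_def integral_restrict_space)

lemma integrable_indicator_leb_on:
  fixes g :: "real \<Rightarrow> 'a::euclidean_space"
  assumes "integrable (leb_on t T) g"
  shows "integrable (leb_on t T) (\<lambda>r. indicator {a..b} r *\<^sub>R g r)"
  by (rule Bochner_Integration.integrable_bound[OF assms])
    (use assms in \<open>auto split: split_indicator\<close>)

lemma integral_leb_on_sub:
  fixes g :: "real \<Rightarrow> 'a::euclidean_space"
  assumes "s \<le> T"
  shows "(\<integral>r. indicator {t..s} r *\<^sub>R g r \<partial>leb_on t T) = (\<integral>r. g r \<partial>leb_on t s)"
  using assms by (simp add: set_integral_leb_on[symmetric] set_integral_leb_on_whole)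

lemma integrable_leb_on_sub:
  fixes g :: "real \<Rightarrow> 'a::euclidean_space"
  assumes "integrable (leb_on t T) g" "s \<le> T"
  shows "integrable (leb_on t s) g"
proof -
  have "{t..s} \<subseteq> {t..T}" using assms by auto
  then show ?thesis
    using assms set_integrable_subset[of lborel "{t..T}" g "{t..s}"]
    by (simp add: set_integrable_leb_on_iff)
qed

lemma integral_leb_on_point:
  fixes g :: "real \<Rightarrow> 'a::euclidean_space"
  shows "(\<integral>r. indicator {s..s} r *\<^sub>R g r \<partial>leb_on t T) = 0"
  by (rule integral_eq_zero_AE, rule eventually_mono[OF AE_leb_on_neq[of s t T]]) simp

lemma integral_leb_on_split:
  fixes g :: "real \<Rightarrow> 'a::euclidean_space"
  assumes g: "integrable (leb_on t T) g" and s: "s \<in> {t..T}"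
  shows "(\<integral>r. indicator {t..s} r *\<^sub>R g r \<partial>leb_on t T) + (\<integral>r. indicator {s..T} r *\<^sub>R g r \<partial>leb_on t T)
    = (\<integral>r. g r \<partial>leb_on t T)"
proof -
  have "(\<integral>r. indicator {t..s} r *\<^sub>R g r \<partial>leb_on t T) + (\<integral>r. indicator {s..T} r *\<^sub>R g r \<partial>leb_on t T)
    = (\<integral>r. indicator {t..s} r *\<^sub>R g r + indicator {s..T} r *\<^sub>R g r \<partial>leb_on t T)"
    by (rule Bochner_Integration.integral_add[symmetric]; rule integrable_indicator_leb_on[OF g])
  also have "\<dots> = (\<integral>r. g r \<partial>leb_on t T)"
  proof (rule integral_cong_AE)
    show "AE r in leb_on t T. indicator {t..s} r *\<^sub>R g r + indicator {s..T} r *\<^sub>R g r = g r"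
    proof (rule AE_mp[OF AE_leb_on_neq[of s t T]], rule AE_I2, rule impI)
      fix r assume "r \<in> space (leb_on t T)" "r \<noteq> s"
      then show "indicator {t..s} r *\<^sub>R g r + indicator {s..T} r *\<^sub>R g r = g r"
        using s by (auto split: split_indicator)
    qed
  qed (use g integrable_indicator_leb_on[OF g] in auto)
  finally show ?thesis .
qed

text \<open>Absolute continuity on [t, T] with almost-everywhere derivative g, in integrated form.\<close>
definition ac_on :: "real \<Rightarrow> real \<Rightarrow> (real \<Rightarrow> 'a::euclidean_space) \<Rightarrow> (real \<Rightarrow> 'a) \<Rightarrow> bool" where
  "ac_on t T y g \<longleftrightarrow> integrable (leb_on t T) g \<and>
     (\<forall>s\<in>{t..T}. y s = y t + (\<integral>r. indicator {t..s} r *\<^sub>R g r \<partial>leb_on t T))"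

lemma ac_onI:
  "integrable (leb_on t T) g \<Longrightarrow>
    (\<And>s. s \<in> {t..T} \<Longrightarrow> y s = y t + (\<integral>r. indicator {t..s} r *\<^sub>R g r \<partial>leb_on t T)) \<Longrightarrow> ac_on t T y g"
  unfolding ac_on_def by blast

lemma ac_on_integrable: "ac_on t T y g \<Longrightarrow> integrable (leb_on t T) g"
  unfolding ac_on_def by blast

lemma ac_on_eq:
  "ac_on t T y g \<Longrightarrow> s \<in> {t..T} \<Longrightarrow> y s = y t + (\<integral>r. indicator {t..s} r *\<^sub>R g r \<partial>leb_on t T)"
  unfolding ac_on_def by blast

text \<open>Set integrals over \<open>{t..s}\<close> become integrals of an indicator against one
  fixed finite measure. The initial value is the case s = t, where the integral runs over a single
  point.\<close>

lemma fwd_sol_iff_ac_on: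
  assumes "t \<le> T"
  shows "fwd_sol t T y0 g y \<longleftrightarrow> ac_on t T y (\<lambda>r. g r (y r)) \<and> y t = y0"
proof -
  have *: "set_lebesgue_integral lborel {t..s} h = (\<integral>r. indicator {t..s} r *\<^sub>R h r \<partial>leb_on t T)"
    if "s \<in> {t..T}" for s and h :: "real \<Rightarrow> 'a"
    using that by (intro set_integral_leb_on) auto
  show ?thesis
  proof
    assume L: "fwd_sol t T y0 g y"
    then have "y t = y0"
      using assms unfolding fwd_sol_def by (auto simp: * integral_leb_on_point[simplified])
    with L show "ac_on t T y (\<lambda>r. g r (y r)) \<and> y t = y0"
      unfolding fwd_sol_def ac_on_def using * set_integrable_leb_on_iff by metis
  next
    assume "ac_on t T y (\<lambda>r. g r (y r)) \<and> y t = y0"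
    then show "fwd_sol t T y0 g y"
      unfolding fwd_sol_def ac_on_def using * set_integrable_leb_on_iff by metis
  qed
qed

text \<open>The integral over \<open>{s..T}\<close> is the total minus the integral over
  \<open>{t..s}\<close>, and the total is \<open>y t - yT\<close>. The final value problem thus
  becomes a forward statement with reversed sign, together with the value at T.\<close>

lemma bwd_sol_imp_ac_on:
  assumes "t \<le> T" and y: "bwd_sol t T yT g y"
  shows "ac_on t T y (\<lambda>r. - g r (y r))" "y T = yT"
proof -
  let ?h = "\<lambda>r. g r (y r)"
  have i: "integrable (leb_on t T) ?h"
    using y by (simp add: bwd_sol_def set_integrable_leb_on_iff)
  have e: "y s = yT + (\<integral>r. indicator {s..T} r *\<^sub>R ?h r \<partial>leb_on t T)" if "s \<in> {t..T}" for s
    using y that by (auto simp: bwd_sol_def set_integral_leb_on[where t=t and T=T])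
  show "y T = yT"
    using e[of T] assms by (simp add: integral_leb_on_point[simplified])
  have *: "y s = y t - (\<integral>r. indicator {t..s} r *\<^sub>R ?h r \<partial>leb_on t T)" if s: "s \<in> {t..T}" for s
  proof -
    have "y t = yT + (\<integral>r. ?h r \<partial>leb_on t T)"
      using e[of t] \<open>t \<le> T\<close> by (simp add: integral_leb_on_sub)
    then show ?thesis using e[OF s] integral_leb_on_split[OF i s] by (simp add: algebra_simps)
  qed
  show "ac_on t T y (\<lambda>r. - g r (y r))"
    by (rule ac_onI) (use i in simp, drule *, simp)
qed

lemma ac_on_integral: "ac_on t T y g \<Longrightarrow> t \<le> T \<Longrightarrow> (\<integral>r. g r \<partial>leb_on t T) = y T - y t"
  using ac_on_eq[of t T y g T] by (simp add: integral_leb_on_sub)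

lemma ac_on_subinterval: "ac_on t T y g \<Longrightarrow> s \<le> T \<Longrightarrow> ac_on t s y g"
    by (rule ac_onI, blast intro: ac_on_integrable integrable_leb_on_sub)
    (subst ac_on_eq[of t T y g], auto simp: integral_leb_on_sub)

lemma ac_on_primitive:
  "integrable (leb_on t T) g \<Longrightarrow> t \<le> T \<Longrightarrow> ac_on t T (\<lambda>s. \<integral>r. indicator {t..s} r *\<^sub>R g r \<partial>leb_on t T) g"
  by (simp add: ac_on_def integral_leb_on_point[simplified])

text \<open>Feedback laws will hold only for almost every time, so the right side of an equation
  must be exchangeable up to a null set. Measurability of \<open>g'\<close> is asked for separately
  because the measure is not complete.\<close>

lemma ac_on_cong_AE:
  assumes "ac_on t T y g" and g': "g' \<in> borel_measurable (leb_on t T)"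
    and "AE r in leb_on t T. g r = g' r"
  shows "ac_on t T y g'"
proof -
  have g: "g \<in> borel_measurable (leb_on t T)" using ac_on_integrable[OF assms(1)] by auto
  have "(\<integral>r. indicator {t..s} r *\<^sub>R g r \<partial>leb_on t T) = (\<integral>r. indicator {t..s} r *\<^sub>R g' r \<partial>leb_on t T)" for s
    using assms(3) by (intro integral_cong_AE) (use g g' in auto)
  moreover have "integrable (leb_on t T) g'"
    using ac_on_integrable[OF assms(1)] integrable_cong_AE[OF g g' assms(3)] by auto
  ultimately show ?thesis using ac_on_eq[OF assms(1)] by (intro ac_onI) metis+
qed

lemma ac_on_cong:
  assumes "ac_on t T y g" "\<And>r. r \<in> {t..T} \<Longrightarrow> g r = g' r" "\<And>r. r \<in> {t..T} \<Longrightarrow> y r = y' r"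
  shows "ac_on t T y' g'"
proof -
  have "integrable (leb_on t T) g \<longleftrightarrow> integrable (leb_on t T) g'"
    by (rule Bochner_Integration.integrable_cong) (use assms in auto)
  moreover have "(\<integral>r. indicator {t..s} r *\<^sub>R g r \<partial>leb_on t T) = (\<integral>r. indicator {t..s} r *\<^sub>R g' r \<partial>leb_on t T)" for s
    by (rule Bochner_Integration.integral_cong) (use assms in auto)
  moreover have "y t = y' t" if "s \<in> {t..T}" for s using assms(3)[of t] that by auto
  ultimately show ?thesis using ac_on_integrable[OF assms(1)] ac_on_eq[OF assms(1)] assms(3)
    by (intro ac_onI) metis+
qed

lemma ac_on_const: "ac_on t T (\<lambda>_. c) (\<lambda>_. 0)"
  by (simp add: ac_on_def)

lemma ac_on_add:
  "ac_on t T y g \<Longrightarrow> ac_on t T z h \<Longrightarrow> ac_on t T (\<lambda>s. y s + z s) (\<lambda>s. g s + h s)"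
  by (rule ac_onI, simp add: ac_on_integrable, frule (1) ac_on_eq, frule (1) ac_on_eq[of t T z])
    (simp add: scaleR_add_right integrable_indicator_leb_on ac_on_integrable)

lemma ac_on_bounded_linear:
  assumes "bounded_linear L" "ac_on t T y g"
  shows "ac_on t T (\<lambda>s. L (y s)) (\<lambda>s. L (g s))"
proof -
  interpret bounded_linear L by fact
  have g: "integrable (leb_on t T) g" using ac_on_integrable[OF assms(2)] .
  have "L (\<integral>r. indicator {t..s} r *\<^sub>R g r \<partial>leb_on t T) = (\<integral>r. indicator {t..s} r *\<^sub>R L (g r) \<partial>leb_on t T)" for s
    using integral_bounded_linear[OF assms(1) integrable_indicator_leb_on[OF g]]
    by (simp add: scaleR)
  moreover have "y s = y t + (\<integral>r. indicator {t..s} r *\<^sub>R g r \<partial>leb_on t T)" if "s \<in> {t..T}" for s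
    using ac_on_eq[OF assms(2) that] .
  then have "L (y s) = L (y t) + L (\<integral>r. indicator {t..s} r *\<^sub>R g r \<partial>leb_on t T)" if "s \<in> {t..T}" for s
    using that by (metis add)
  ultimately show ?thesis
    using integrable_bounded_linear[OF assms(1) g] by (intro ac_onI) metis+
qed

lemma ac_on_diff:
  "ac_on t T y g \<Longrightarrow> ac_on t T z h \<Longrightarrow> ac_on t T (\<lambda>s. y s - z s) (\<lambda>s. g s - h s)"
  using ac_on_add[of t T y g "\<lambda>s. - z s" "\<lambda>s. - h s"]
    ac_on_bounded_linear[OF bounded_linear_minus[OF bounded_linear_ident], of t T z h] by simp

lemma ac_on_zero_deriv: "ac_on t T y (\<lambda>_. 0) \<Longrightarrow> s \<in> {t..T} \<Longrightarrow> y s = y t"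
  using ac_on_eq[of t T y "\<lambda>_. 0" s] by simp

text \<open>Continuity is taken over from the indefinite gauge integral, which agrees with the
  Lebesgue integral for integrable functions. It makes every solution bounded and measurable, hence
  usable as a coefficient in further equations.\<close>

lemma ac_on_continuous:
  assumes "ac_on t T y g"
  shows "continuous_on {t..T} y"
proof -
  have i: "set_integrable lborel {t..T} g"
    using ac_on_integrable[OF assms] by (simp add: set_integrable_leb_on_iff)
  have "continuous_on {t..T} (\<lambda>s. y t + integral {t..s} g)"
    by (intro continuous_intros indefinite_integral_continuous_1 set_borel_integral_eq_integral i)
  moreover have "y s = y t + integral {t..s} g" if "s \<in> {t..T}" for s
  proof -
    have "{t..s} \<subseteq> {t..T}" using that by auto
    then have "set_integrable lborel {t..s} g" by (auto intro: set_integrable_subset[OF i])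
    then show ?thesis
      using ac_on_eq[OF assms that] that set_borel_integral_eq_integral(2)[of "{t..s}" g]
      by (auto simp: set_integral_leb_on[symmetric])
  qed
  ultimately show ?thesis using continuous_on_cong[OF refl, of "{t..T}" y] by metis
qed

lemma continuous_on_measurable_leb_on:
  "continuous_on {t..T} (y :: real \<Rightarrow> 'a::euclidean_space) \<Longrightarrow> y \<in> borel_measurable (leb_on t T)"
  using borel_measurable_continuous_on_restrict[of "{t..T}" y]
    measurable_cong_sets[OF sets_restrict_space_cong[OF sets_lborel] refl, of "{t..T}" borel] by blast

lemma continuous_on_bound:
  assumes "continuous_on {t..T} (y :: real \<Rightarrow> 'a::euclidean_space)"
  obtains C where "0 \<le> C" "\<And>s. s \<in> {t..T} \<Longrightarrow> norm (y s) \<le> C"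
proof -
  have "bounded (y ` {t..T})"
    using assms by (intro compact_imp_bounded compact_continuous_image) auto
  then obtain C where "C > 0" "\<forall>x\<in>y ` {t..T}. norm x \<le> C" using bounded_pos by metis
  then show ?thesis by (intro that[of C]) auto
qed

lemmas ac_on_measurable = continuous_on_measurable_leb_on[OF ac_on_continuous]

section \<open>Bilinear maps of integrable functions and the product rule\<close>

lemma borel_measurable_bilinear:
  fixes B :: "'a::euclidean_space \<Rightarrow> 'b::euclidean_space \<Rightarrow> 'c::euclidean_space"
  assumes "bounded_bilinear B" "f \<in> borel_measurable \<mu>" "g \<in> borel_measurable \<mu>"
  shows "(\<lambda>x. B (f x) (g x)) \<in> borel_measurable \<mu>"
  by (rule borel_measurable_continuous_Pair[OF assms(2,3)])
     (intro bounded_bilinear.continuous_on[OF assms(1)] continuous_intros)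

lemma integrable_bilinear_bounded:
  fixes B :: "'a::euclidean_space \<Rightarrow> 'b::euclidean_space \<Rightarrow> 'c::euclidean_space"
  assumes B: "bounded_bilinear B" and g: "integrable \<mu> g" and z: "z \<in> borel_measurable \<mu>"
    and C: "\<And>x. x \<in> space \<mu> \<Longrightarrow> norm (z x) \<le> C"
  shows "integrable \<mu> (\<lambda>x. B (g x) (z x))"
proof -
  obtain K where K: "K > 0" "\<And>a b. norm (B a b) \<le> norm a * norm b * K"
    using bounded_bilinear.pos_bounded[OF B] by blast
  show ?thesis
  proof (rule Bochner_Integration.integrable_bound)
    show "integrable \<mu> (\<lambda>x. norm (g x) * (C * K))" using g by simp
    show "(\<lambda>x. B (g x) (z x)) \<in> borel_measurable \<mu>"
      using g z by (intro borel_measurable_bilinear[OF B]) auto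
    show "AE x in \<mu>. norm (B (g x) (z x)) \<le> norm (norm (g x) * (C * K))"
    proof (rule AE_I2)
      fix x assume "x \<in> space \<mu>"
      then have "norm (z x) \<le> C" using C by auto
      have "norm (B (g x) (z x)) \<le> norm (g x) * norm (z x) * K" by (rule K)
      also have "\<dots> \<le> norm (g x) * C * K"
        using K \<open>norm (z x) \<le> C\<close> by (intro mult_right_mono mult_left_mono) auto
      also have "\<dots> \<le> norm (norm (g x) * (C * K))" by (simp add: mult.assoc)
      finally show "norm (B (g x) (z x)) \<le> norm (norm (g x) * (C * K))" .
    qed
  qed
qed

lemma integrable_bilinear_bounded':
  fixes B :: "'a::euclidean_space \<Rightarrow> 'b::euclidean_space \<Rightarrow> 'c::euclidean_space"
  assumes "bounded_bilinear B" "integrable \<mu> g" "z \<in> borel_measurable \<mu>"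
    "\<And>x. x \<in> space \<mu> \<Longrightarrow> norm (z x) \<le> C"
  shows "integrable \<mu> (\<lambda>x. B (z x) (g x))"
  using integrable_bilinear_bounded[OF bounded_bilinear.flip[OF assms(1)] assms(2-4)] by simp

lemma integrable_pair_bilinear:
  fixes B :: "'a::euclidean_space \<Rightarrow> 'b::euclidean_space \<Rightarrow> 'c::euclidean_space"
  assumes B: "bounded_bilinear B" and g: "integrable \<mu> g" and h: "integrable \<nu> h"
    and fin: "finite_measure \<mu>" "finite_measure \<nu>"
  shows "integrable (\<mu> \<Otimes>\<^sub>M \<nu>) (\<lambda>(r, q). B (g r) (h q))"
proof -
  interpret a: finite_measure \<mu> by fact
  interpret b: finite_measure \<nu> by fact
  interpret pair_sigma_finite \<mu> \<nu> ..
  have [measurable]: "g \<in> borel_measurable \<mu>" "h \<in> borel_measurable \<nu>" using g h by auto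
  obtain K where K: "K > 0" "\<And>a b. norm (B a b) \<le> norm a * norm b * K"
    using bounded_bilinear.pos_bounded[OF B] by blast
  have "integrable (\<mu> \<Otimes>\<^sub>M \<nu>) (\<lambda>x. norm (g (fst x)) * norm (h (snd x)))"
    by (rule Fubini_integrable) (use g h in \<open>auto simp: abs_mult\<close>)
  then have "integrable (\<mu> \<Otimes>\<^sub>M \<nu>) (\<lambda>x. norm (g (fst x)) * norm (h (snd x)) * K)" by simp
  then show ?thesis
  proof (rule Bochner_Integration.integrable_bound)
    show "(\<lambda>(r, q). B (g r) (h q)) \<in> borel_measurable (\<mu> \<Otimes>\<^sub>M \<nu>)"
      unfolding case_prod_beta by (intro borel_measurable_bilinear[OF B]) measurable
    show "AE x in \<mu> \<Otimes>\<^sub>M \<nu>. norm (case x of (r, q) \<Rightarrow> B (g r) (h q)) \<le> norm (norm (g (fst x)) * norm (h (snd x)) * K)"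
      using K by (intro AE_I2) (auto simp: abs_mult)
  qed
qed

text \<open>Integration by parts for primitives that vanish at t. The right side is the integral of
  \<open>B (g r) (h q)\<close> over a square, which the diagonal cuts into the triangles q \<le> r
  and r \<le> q; the two terms on the left are the integrals over these triangles.\<close>

lemma integral_triangle_bilinear:
  fixes B :: "'a::euclidean_space \<Rightarrow> 'b::euclidean_space \<Rightarrow> 'c::euclidean_space"
  assumes B: "bounded_bilinear B" and g: "integrable (leb_on t T) g" and h: "integrable (leb_on t T) h"
  defines "\<mu> \<equiv> leb_on t T"
  shows "(\<integral>r. B (g r) (\<integral>q. indicator {t..r} q *\<^sub>R h q \<partial>\<mu>) \<partial>\<mu>)
    + (\<integral>q. B (\<integral>r. indicator {t..q} r *\<^sub>R g r \<partial>\<mu>) (h q) \<partial>\<mu>) = B (\<integral>r. g r \<partial>\<mu>) (\<integral>q. h q \<partial>\<mu>)"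
proof -
  interpret finite_measure \<mu> unfolding \<mu>_def by (rule finite_measure_leb_on)
  interpret pair_sigma_finite \<mu> \<mu> ..
  interpret B: bounded_bilinear B by fact
  have g': "integrable \<mu> g" and h': "integrable \<mu> h" using g h by (auto simp: \<mu>_def)
  have [measurable]: "(\<lambda>x. x) \<in> borel_measurable \<mu>" by (simp add: \<mu>_def)
  have ig: "integrable \<mu> (\<lambda>r. indicator {t..q} r *\<^sub>R g r)" for q
    using integrable_indicator_leb_on[OF g] by (simp add: \<mu>_def)
  have ih: "integrable \<mu> (\<lambda>r. indicator {t..q} r *\<^sub>R h r)" for q
    using integrable_indicator_leb_on[OF h] by (simp add: \<mu>_def)
  have i0: "integrable (\<mu> \<Otimes>\<^sub>M \<mu>) (\<lambda>(r, q). B (g r) (h q))"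
    using integrable_pair_bilinear[OF B g' h'] finite_measure_axioms by simp
  then have [measurable]: "(\<lambda>(r, q). B (g r) (h q)) \<in> borel_measurable (\<mu> \<Otimes>\<^sub>M \<mu>)" by auto
  have m1: "(\<lambda>(r, q). indicator {t..r} q :: real) \<in> borel_measurable (\<mu> \<Otimes>\<^sub>M \<mu>)"
    unfolding indicator_def atLeastAtMost_iff by measurable
  have m2: "(\<lambda>(r, q). indicator {t..q} r :: real) \<in> borel_measurable (\<mu> \<Otimes>\<^sub>M \<mu>)"
    unfolding indicator_def atLeastAtMost_iff by measurable
  have i1: "integrable (\<mu> \<Otimes>\<^sub>M \<mu>) (\<lambda>(r, q). indicator {t..r} q *\<^sub>R B (g r) (h q))"
  proof (rule Bochner_Integration.integrable_bound[OF i0])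
    show "(\<lambda>(r, q). indicator {t..r} q *\<^sub>R B (g r) (h q)) \<in> borel_measurable (\<mu> \<Otimes>\<^sub>M \<mu>)"
      using borel_measurable_scaleR[OF m1 borel_measurable_integrable[OF i0]] by (simp add: case_prod_beta)
  qed (auto split: split_indicator)
  have i2: "integrable (\<mu> \<Otimes>\<^sub>M \<mu>) (\<lambda>(r, q). indicator {t..q} r *\<^sub>R B (g r) (h q))"
  proof (rule Bochner_Integration.integrable_bound[OF i0])
    show "(\<lambda>(r, q). indicator {t..q} r *\<^sub>R B (g r) (h q)) \<in> borel_measurable (\<mu> \<Otimes>\<^sub>M \<mu>)"
      using borel_measurable_scaleR[OF m2 borel_measurable_integrable[OF i0]] by (simp add: case_prod_beta)
  qed (auto split: split_indicator)
  have e1: "(\<integral>r. B (g r) (\<integral>q. indicator {t..r} q *\<^sub>R h q \<partial>\<mu>) \<partial>\<mu>)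
      = (\<integral>r. \<integral>q. indicator {t..r} q *\<^sub>R B (g r) (h q) \<partial>\<mu> \<partial>\<mu>)"
    by (simp add: integral_bounded_linear[OF B.bounded_linear_right ih, symmetric] B.scaleR_right)
  have e2: "(\<integral>q. B (\<integral>r. indicator {t..q} r *\<^sub>R g r \<partial>\<mu>) (h q) \<partial>\<mu>)
      = (\<integral>q. \<integral>r. indicator {t..q} r *\<^sub>R B (g r) (h q) \<partial>\<mu> \<partial>\<mu>)"
    by (simp add: integral_bounded_linear[OF B.bounded_linear_left ig, symmetric] B.scaleR_left)
  \<comment> \<open>Fubini brings the second triangle into the same order of integration as the
    first, so that both can be added over the product measure.\<close>
  also have "\<dots> = (\<integral>r. \<integral>q. indicator {t..q} r *\<^sub>R B (g r) (h q) \<partial>\<mu> \<partial>\<mu>)"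
    by (rule Fubini_integral[OF i2])
  finally have "(\<integral>r. B (g r) (\<integral>q. indicator {t..r} q *\<^sub>R h q \<partial>\<mu>) \<partial>\<mu>)
    + (\<integral>q. B (\<integral>r. indicator {t..q} r *\<^sub>R g r \<partial>\<mu>) (h q) \<partial>\<mu>)
    = (\<integral>x. (\<lambda>(r, q). indicator {t..r} q *\<^sub>R B (g r) (h q)) x + (\<lambda>(r, q). indicator {t..q} r *\<^sub>R B (g r) (h q)) x \<partial>(\<mu> \<Otimes>\<^sub>M \<mu>))"
    using integral_fst[OF i1] integral_fst[OF i2] i1 i2 e1
    by (subst Bochner_Integration.integral_add) auto
  also have "\<dots> = (\<integral>x. (\<lambda>(r, q). B (g r) (h q)) x \<partial>(\<mu> \<Otimes>\<^sub>M \<mu>))"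
  proof (rule integral_cong_AE)
    \<comment> \<open>The indicators of the triangles add up to 1 off the diagonal and to 2 on it,
      so the diagonal has to be null.\<close>
    have "AE x in \<mu> \<Otimes>\<^sub>M \<mu>. fst x \<noteq> snd x"
    proof (rule AE_pair_measure)
      show "AE x in \<mu>. AE y in \<mu>. fst (x, y) \<noteq> snd (x, y)"
        unfolding \<mu>_def by (intro AE_I2 eventually_mono[OF AE_leb_on_neq]) auto
    qed measurable
    then show "AE x in \<mu> \<Otimes>\<^sub>M \<mu>. (\<lambda>(r, q). indicator {t..r} q *\<^sub>R B (g r) (h q)) x + (\<lambda>(r, q). indicator {t..q} r *\<^sub>R B (g r) (h q)) x
       = (\<lambda>(r, q). B (g r) (h q)) x"
      using AE_space by eventually_elim (auto simp: space_pair_measure \<mu>_def split: split_indicator)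
  qed (use i0 i1 i2 in auto)
  also have "\<dots> = (\<integral>r. \<integral>q. B (g r) (h q) \<partial>\<mu> \<partial>\<mu>)"
    using integral_fst[OF i0] by simp
  also have "\<dots> = (\<integral>r. B (g r) (\<integral>q. h q \<partial>\<mu>) \<partial>\<mu>)"
    by (simp add: integral_bounded_linear[OF B.bounded_linear_right h'])
  also have "\<dots> = B (\<integral>r. g r \<partial>\<mu>) (\<integral>q. h q \<partial>\<mu>)"
    by (simp add: integral_bounded_linear[OF B.bounded_linear_left g'])
  finally show ?thesis .
qed

text \<open>Write y and z as initial value plus primitive. The derivative then splits into terms
  with one frozen factor, which integrate directly, and terms with a primitive as one factor, which
  the triangle identity sums to the product of the two total integrals.\<close>

lemma ac_on_bilinear:
  fixes B :: "'a::euclidean_space \<Rightarrow> 'b::euclidean_space \<Rightarrow> 'c::euclidean_space"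
  assumes B: "bounded_bilinear B" and y: "ac_on t T y g" and z: "ac_on t T z h"
  shows "ac_on t T (\<lambda>s. B (y s) (z s)) (\<lambda>s. B (g s) (z s) + B (y s) (h s))"
proof -
  interpret B: bounded_bilinear B by fact
  \<comment> \<open>Only the increment over a whole interval is computed; a general s is the right
    end of the shorter interval \<open>{t..s}\<close>, to which both functions restrict.\<close>
  have main: "integrable (leb_on t s) (\<lambda>r. B (g r) (z r)) \<and> integrable (leb_on t s) (\<lambda>r. B (y r) (h r)) \<and>
      B (y s) (z s) = B (y t) (z t) + (\<integral>r. B (g r) (z r) + B (y r) (h r) \<partial>leb_on t s)"
    if "t \<le> s" and y: "ac_on t s y g" and z: "ac_on t s z h" for s
  proof -
    let ?\<mu> = "leb_on t s"
    let ?I = "\<lambda>f r. \<integral>q. indicator {t..r} q *\<^sub>R f q \<partial>?\<mu>"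
    obtain Cy where Cy: "\<And>s'. s' \<in> {t..s} \<Longrightarrow> norm (y s') \<le> Cy"
      using continuous_on_bound[OF ac_on_continuous[OF y]] by metis
    obtain Cz where Cz: "\<And>s'. s' \<in> {t..s} \<Longrightarrow> norm (z s') \<le> Cz"
      using continuous_on_bound[OF ac_on_continuous[OF z]] by metis
    have g: "integrable ?\<mu> g" and h: "integrable ?\<mu> h" using ac_on_integrable[OF y] ac_on_integrable[OF z] by auto
    have 1: "integrable ?\<mu> (\<lambda>r. B (g r) (z r))"
      by (rule integrable_bilinear_bounded[OF B g ac_on_measurable[OF z]]) (use Cz in auto)
    have 2: "integrable ?\<mu> (\<lambda>r. B (y r) (h r))"
      by (rule integrable_bilinear_bounded'[OF B h ac_on_measurable[OF y]]) (use Cy in auto)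
    have ys: "?I g r = y r - y t" and zs: "?I h r = z r - z t" if "r \<in> {t..s}" for r
      using ac_on_eq[OF y that] ac_on_eq[OF z that] by auto
    have c1: "integrable ?\<mu> (\<lambda>r. B (g r) (z t))" and c2: "integrable ?\<mu> (\<lambda>r. B (y t) (h r))"
      by (intro integrable_bounded_linear[OF B.bounded_linear_left] integrable_bounded_linear[OF B.bounded_linear_right] g h)+
    have 3: "integrable ?\<mu> (\<lambda>r. B (g r) (?I h r))"
    proof -
      have "integrable ?\<mu> (\<lambda>r. B (g r) (z r) - B (g r) (z t))" using 1 c1 by simp
      also have "?this \<longleftrightarrow> ?thesis"
        by (rule Bochner_Integration.integrable_cong) (simp_all add: zs B.diff_right)
      finally show ?thesis .
    qed
    have 4: "integrable ?\<mu> (\<lambda>r. B (?I g r) (h r))"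
    proof -
      have "integrable ?\<mu> (\<lambda>r. B (y r) (h r) - B (y t) (h r))" using 2 c2 by simp
      also have "?this \<longleftrightarrow> ?thesis"
        by (rule Bochner_Integration.integrable_cong) (simp_all add: ys B.diff_left)
      finally show ?thesis .
    qed
    have "(\<integral>r. B (g r) (z r) + B (y r) (h r) \<partial>?\<mu>)
      = (\<integral>r. (B (g r) (z t) + B (y t) (h r)) + (B (g r) (?I h r) + B (?I g r) (h r)) \<partial>?\<mu>)"
      by (rule Bochner_Integration.integral_cong) (simp_all add: ys zs B.diff_left B.diff_right)
    also have "\<dots> = B (\<integral>r. g r \<partial>?\<mu>) (z t) + B (y t) (\<integral>r. h r \<partial>?\<mu>) + B (\<integral>r. g r \<partial>?\<mu>) (\<integral>r. h r \<partial>?\<mu>)"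
      using 3 4 c1 c2 integral_bounded_linear[OF B.bounded_linear_left g] integral_bounded_linear[OF B.bounded_linear_right h]
        integral_triangle_bilinear[OF B g h] by simp
    also have "\<dots> = B (y s) (z s) - B (y t) (z t)"
      unfolding ac_on_integral[OF y \<open>t \<le> s\<close>] ac_on_integral[OF z \<open>t \<le> s\<close>]
      by (simp add: B.diff_left B.diff_right)
    finally show ?thesis using 1 2 by simp
  qed
  show ?thesis
  proof (cases "t \<le> T")
    case True
    show ?thesis
    proof (rule ac_onI)
      show "integrable (leb_on t T) (\<lambda>s. B (g s) (z s) + B (y s) (h s))"
        using main[OF True y z] by simp
      fix s assume "s \<in> {t..T}"
      then show "B (y s) (z s) = B (y t) (z t)
          + (\<integral>r. indicator {t..s} r *\<^sub>R (B (g r) (z r) + B (y r) (h r)) \<partial>leb_on t T)"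
        using main[OF _ ac_on_subinterval[OF y] ac_on_subinterval[OF z], of s]
        by (subst integral_leb_on_sub) auto
    qed
  next
    case False
    \<comment> \<open>For T < t the interval is empty: every function is integrable over it, and
      there is no time at which the equation has to hold.\<close>
    have "integrable (leb_on t T) (\<lambda>s. B (g s) (z s) + B (y s) (h s)) \<longleftrightarrow> integrable (leb_on t T) (\<lambda>_. 0 :: 'c)"
      by (rule Bochner_Integration.integrable_cong) (use False in auto)
    then show ?thesis
      using False by (intro ac_onI) auto
  qed
qed

section \<open>Linear differential equations with bounded measurable coefficients\<close>

lemma bounded_bilinear_matrix_vector_mult:
  "bounded_bilinear ((*v) :: real^'n^'m \<Rightarrow> real^'n \<Rightarrow> real^'m)"
  unfolding bilinear_conv_bounded_bilinear[symmetric] bilinear_def linear_iff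
  by (auto simp: matrix_vector_mult_add_rdistrib matrix_vector_right_distrib
      scaleR_matrix_vector_assoc matrix_vector_mult_scaleR)

lemma bounded_bilinear_matrix_mult:
  "bounded_bilinear ((**) :: real^'n^'m \<Rightarrow> real^'k^'n \<Rightarrow> real^'k^'m)"
  unfolding bilinear_conv_bounded_bilinear[symmetric] bilinear_def linear_iff
  by (auto simp: vec_eq_iff matrix_matrix_mult_def sum.distrib algebra_simps sum_distrib_left)

lemma bounded_linear_transpose: "bounded_linear (transpose :: real^'n^'m \<Rightarrow> real^'m^'n)"
  unfolding linear_conv_bounded_linear[symmetric] linear_iff by (auto simp: vec_eq_iff transpose_def)

lemmas matrix_mult_linear_simps =
  bounded_bilinear.add_left[OF bounded_bilinear_matrix_mult]
  bounded_bilinear.add_right[OF bounded_bilinear_matrix_mult]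
  bounded_bilinear.diff_left[OF bounded_bilinear_matrix_mult]
  bounded_bilinear.diff_right[OF bounded_bilinear_matrix_mult]
  bounded_bilinear.minus_left[OF bounded_bilinear_matrix_mult]
  bounded_bilinear.minus_right[OF bounded_bilinear_matrix_mult]
  bounded_bilinear.zero_left[OF bounded_bilinear_matrix_mult]
  bounded_bilinear.zero_right[OF bounded_bilinear_matrix_mult]

lemmas matrix_vector_linear_simps =
  bounded_bilinear.add_left[OF bounded_bilinear_matrix_vector_mult]
  bounded_bilinear.add_right[OF bounded_bilinear_matrix_vector_mult]
  bounded_bilinear.diff_left[OF bounded_bilinear_matrix_vector_mult]
  bounded_bilinear.diff_right[OF bounded_bilinear_matrix_vector_mult]
  bounded_bilinear.minus_left[OF bounded_bilinear_matrix_vector_mult]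
  bounded_bilinear.minus_right[OF bounded_bilinear_matrix_vector_mult]
  bounded_bilinear.zero_left[OF bounded_bilinear_matrix_vector_mult]
  bounded_bilinear.zero_right[OF bounded_bilinear_matrix_vector_mult]

lemmas transpose_linear_simps =
  linear_add[OF bounded_linear.linear[OF bounded_linear_transpose]]
  linear_diff[OF bounded_linear.linear[OF bounded_linear_transpose]]
  linear_neg[OF bounded_linear.linear[OF bounded_linear_transpose]]

section \<open>Fundamental matrices and variation of constants\<close>

text \<open>The weight in the estimate of the series below: integrating it returns it divided by k,
  up to a constant.\<close>

lemma ac_on_exp:
  assumes "k > 0" "t \<le> T"
  shows "ac_on t T (\<lambda>s. exp (k * (s - t)) / k) (\<lambda>s. exp (k * (s - t)))"
proof -
  have 1: "has_bochner_integral lborel (\<lambda>x. indicator {t..s} x *\<^sub>R exp (k * (x - t)))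
      (exp (k * (s - t)) / k - exp (k * (t - t)) / k)" if "t \<le> s" for s
  proof (rule has_bochner_integral_FTC_Icc[OF that])
    have "((\<lambda>s. exp (k * (s - t)) / k) has_real_derivative exp (k * (x - t))) (at x within {t..s})" for x
      using assms(1) by (auto intro!: derivative_eq_intros)
    then show "((\<lambda>s. exp (k * (s - t)) / k) has_vector_derivative exp (k * (x - t))) (at x within {t..s})" for x
      by (simp add: has_real_derivative_iff_has_vector_derivative)
  qed (intro continuous_intros)
  show ?thesis
  proof (rule ac_onI)
    show "integrable (leb_on t T) (\<lambda>s. exp (k * (s - t)))"
      using 1[OF \<open>t \<le> T\<close>]
      by (auto simp: integrable_restrict_space has_bochner_integral_iff)
    fix s assume "s \<in> {t..T}"
    then show "exp (k * (s - t)) / k = exp (k * (t - t)) / k + (\<integral>r. indicator {t..s} r *\<^sub>R exp (k * (r - t)) \<partial>leb_on t T)"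
      using 1[of s] by (subst set_integral_leb_on[symmetric]) (auto simp: has_bochner_integral_iff set_lebesgue_integral_def)
  qed
qed

text \<open>The solution is the sum of the iterated integrals of A (Peano-Baker series). Measured
  against the weight exp (2 k (s - t)), with k a bound for left multiplication by A, each iteration
  gains the factor k / (2 k) = 1/2. The series therefore converges geometrically on the whole
  interval, however long, and no short intervals have to be patched together.\<close>

lemma fundamental_matrix_exists:
  fixes A :: "real \<Rightarrow> real^'n^'n"
  assumes tT: "t \<le> T" and A: "A \<in> borel_measurable (leb_on t T)"
    and C: "\<And>s. s \<in> {t..T} \<Longrightarrow> norm (A s) \<le> C"
  obtains \<Phi> where "ac_on t T \<Phi> (\<lambda>r. A r ** \<Phi> r)" "\<Phi> t = mat 1"
proof -
  let ?\<mu> = "leb_on t T"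
  interpret finite_measure ?\<mu> by (rule finite_measure_leb_on)
  obtain K where K: "K > 0" "\<And>(a :: real^'n^'n) (b :: real^'n^'n). norm (a ** b) \<le> norm a * norm b * K"
    using bounded_bilinear.pos_bounded[OF bounded_bilinear_matrix_mult] by blast
  \<comment> \<open>K is the constant of the bilinear matrix product; the maximum with 1 keeps k
    positive for the divisions by 2 k.\<close>
  define k where "k = max 1 (C * K)"
  have k: "k > 0" by (simp add: k_def)
  have nA: "norm (A s ** W) \<le> k * norm W" if "s \<in> {t..T}" for s and W :: "real^'n^'n"
  proof -
    have "norm (A s ** W) \<le> norm (A s) * norm W * K" by (rule K)
    also have "\<dots> \<le> C * norm W * K" using C[OF that] K by (intro mult_right_mono) auto
    also have "\<dots> = (C * K) * norm W" by simp
    also have "\<dots> \<le> k * norm W" by (intro mult_right_mono) (auto simp: k_def)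
    finally show ?thesis .
  qed
  define U :: "nat \<Rightarrow> real \<Rightarrow> real^'n^'n" where
    "U = rec_nat (\<lambda>_. mat 1) (\<lambda>_ u s. \<integral>r. indicator {t..s} r *\<^sub>R (A r ** u r) \<partial>?\<mu>)"
  have U0: "U 0 = (\<lambda>_. mat 1)"
    and US: "U (Suc j) = (\<lambda>s. \<integral>r. indicator {t..s} r *\<^sub>R (A r ** U j r) \<partial>?\<mu>)" for j
    by (simp_all add: U_def)
  define c where "c = norm (mat 1 :: real^'n^'n)"
  \<comment> \<open>The largest value of the weight on the interval. It turns the weighted bounds
    into uniform geometric ones, which justify exchanging sum and integral.\<close>
  define E where "E = exp (2 * k * (T - t))"
  \<comment> \<open>Integrability is carried through the induction along with the bound, because the
    next iterate is estimated by integrating \<open>A r ** U j r\<close>.\<close>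
  have "continuous_on {t..T} (U j) \<and> (\<forall>s\<in>{t..T}. norm (U j s) \<le> c * (1/2)^j * exp (2 * k * (s - t)))
      \<and> integrable ?\<mu> (\<lambda>r. A r ** U j r)" for j
  proof (induction j)
    case 0
    have "integrable ?\<mu> (\<lambda>r. A r ** mat 1)"
      by (rule integrable_const_bound[of _ C]) (use A C in auto)
    moreover have "1 \<le> exp (2 * k * (s - t))" if "t \<le> s" for s using k that by simp
    then have "c \<le> c * exp (2 * k * (s - t))" if "t \<le> s" for s
      using mult_left_mono[of 1 "exp (2 * k * (s - t))" c] that by (auto simp: c_def)
    ultimately show ?case by (auto simp: U0 c_def)
  next
    case (Suc j)
    then have i: "integrable ?\<mu> (\<lambda>r. A r ** U j r)" by simp
    have ac: "ac_on t T (U (Suc j)) (\<lambda>r. A r ** U j r)"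
      unfolding US by (rule ac_on_primitive[OF i tT])
    note cont = ac_on_continuous[OF ac]
    obtain D where D: "\<And>s. s \<in> {t..T} \<Longrightarrow> norm (U (Suc j) s) \<le> D"
      using continuous_on_bound[OF cont] by metis
    have "integrable ?\<mu> (\<lambda>r. A r ** U (Suc j) r)"
    proof (rule integrable_bilinear_bounded[OF bounded_bilinear_matrix_mult _ ac_on_measurable[OF ac]])
      show "integrable ?\<mu> A" by (rule integrable_const_bound[of _ C]) (use A C in auto)
    qed (use D in auto)
    moreover have "norm (U (Suc j) s) \<le> c * (1/2)^(Suc j) * exp (2 * k * (s - t))" if s: "s \<in> {t..T}" for s
    proof -
      let ?e = "\<lambda>r. exp (2 * k * (r - t))"
      have ae: "ac_on t T (\<lambda>s. ?e s / (2 * k)) ?e" using ac_on_exp[of "2 * k" t T] k tT by simp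
      have "norm (U (Suc j) s) \<le> (\<integral>r. norm (indicator {t..s} r *\<^sub>R (A r ** U j r)) \<partial>?\<mu>)"
        unfolding US by (rule integral_norm_bound)
      also have "\<dots> \<le> (\<integral>r. (k * (c * (1/2)^j)) * (indicator {t..s} r *\<^sub>R ?e r) \<partial>?\<mu>)"
      proof (rule integral_mono)
        show "integrable ?\<mu> (\<lambda>r. norm (indicator {t..s} r *\<^sub>R (A r ** U j r)))"
          using integrable_indicator_leb_on[OF i] by (rule integrable_norm)
        show "integrable ?\<mu> (\<lambda>r. (k * (c * (1/2)^j)) * (indicator {t..s} r *\<^sub>R ?e r))"
          by (intro integrable_mult_right integrable_indicator_leb_on ac_on_integrable[OF ae])
        fix r assume r: "r \<in> space ?\<mu>"
        have "norm (A r ** U j r) \<le> k * norm (U j r)" using nA r by simp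
        also have "\<dots> \<le> k * (c * (1/2)^j * ?e r)" using Suc k r by (intro mult_left_mono) auto
        finally show "norm (indicator {t..s} r *\<^sub>R (A r ** U j r)) \<le> (k * (c * (1/2)^j)) * (indicator {t..s} r *\<^sub>R ?e r)"
          by (auto split: split_indicator simp: mult_ac)
      qed
      also have "\<dots> = (k * (c * (1/2)^j)) * (\<integral>r. indicator {t..s} r *\<^sub>R ?e r \<partial>?\<mu>)" by simp
      also have "(\<integral>r. indicator {t..s} r *\<^sub>R ?e r \<partial>?\<mu>) = ?e s / (2 * k) - 1 / (2 * k)"
        using ac_on_eq[OF ae s] by simp
      also have "(k * (c * (1/2)^j)) * \<dots> \<le> (k * (c * (1/2)^j)) * (?e s / (2 * k))"
        using k by (intro mult_left_mono) (auto simp: c_def)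
      also have "\<dots> = c * (1/2)^(Suc j) * ?e s" using k by (simp add: field_simps)
      finally show ?thesis .
    qed
    ultimately show ?case using cont by blast
  qed
  then have Ub: "\<And>s. s \<in> {t..T} \<Longrightarrow> norm (U j s) \<le> c * (1/2)^j * exp (2 * k * (s - t))"
    and Ui: "integrable ?\<mu> (\<lambda>r. A r ** U j r)" for j by auto
  have Ub': "norm (U j s) \<le> c * E * (1/2)^j" if "s \<in> {t..T}" for j s
  proof -
    have "exp (2 * k * (s - t)) \<le> E" unfolding E_def using that k by simp
    then have "c * (1/2)^j * exp (2 * k * (s - t)) \<le> c * (1/2)^j * E"
      by (intro mult_left_mono) (auto simp: c_def)
    with Ub[OF that, of j] show ?thesis by (simp add: mult_ac)
  qed
  have sg: "summable (\<lambda>j. a * (1/2 :: real)^j)" for a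
    by (intro summable_mult summable_geometric) simp
  have sumU: "summable (\<lambda>j. U j s)" if "s \<in> {t..T}" for s
    by (rule summable_comparison_test'[OF sg]) (use Ub'[OF that] in auto)
  define \<Phi> where "\<Phi> s = (\<Sum>j. U j s)" for s
  let ?f = "\<lambda>s j r. indicator {t..s} r *\<^sub>R (A r ** U j r)"
  have fb: "norm (?f s j r) \<le> k * (c * E) * (1/2)^j" if "r \<in> {t..T}" for s j r
  proof -
    have "norm (?f s j r) \<le> norm (A r ** U j r)" by (auto split: split_indicator)
    also have "\<dots> \<le> k * (c * E * (1/2)^j)"
      using nA[OF that, of "U j r"] mult_left_mono[OF Ub'[OF that, of j], of k] k by linarith
    finally show ?thesis by (simp add: mult_ac)
  qed
  have fi: "integrable ?\<mu> (?f s j)" for s j by (rule integrable_indicator_leb_on[OF Ui])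
  have fs1: "AE r in ?\<mu>. summable (\<lambda>j. norm (?f s j r))" for s
    by (rule AE_I2, rule summable_comparison_test'[OF sg[of "k * (c * E)"]]) (use fb in auto)
  have fs2: "summable (\<lambda>j. \<integral>r. norm (?f s j r) \<partial>?\<mu>)" for s
  proof (rule summable_comparison_test'[OF sg[of "k * (c * E) * measure ?\<mu> {t..T}"]])
    fix j
    have "(\<integral>r. norm (?f s j r) \<partial>?\<mu>) \<le> (\<integral>r. k * (c * E) * (1/2)^j \<partial>?\<mu>)"
      by (rule integral_mono[OF integrable_norm[OF fi]]) (use fb in auto)
    then show "norm (\<integral>r. norm (?f s j r) \<partial>?\<mu>) \<le> k * (c * E) * measure ?\<mu> {t..T} * (1/2)^j"
      by (simp add: mult_ac)
  qed
  have A\<Phi>: "(\<Sum>j. ?f s j r) = indicator {t..s} r *\<^sub>R (A r ** \<Phi> r)" if "r \<in> {t..T}" for s r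
  proof -
    have "(\<Sum>j. ?f s j r) = indicator {t..s} r *\<^sub>R (A r ** (\<Sum>j. U j r))"
      using bounded_linear.suminf[OF bounded_linear_compose[OF bounded_linear_scaleR_right
            bounded_bilinear.bounded_linear_right[OF bounded_bilinear_matrix_mult]] sumU[OF that]] by metis
    then show ?thesis by (simp add: \<Phi>_def)
  qed
  have int: "integrable ?\<mu> (\<lambda>r. indicator {t..s} r *\<^sub>R (A r ** \<Phi> r))" for s
    using integrable_suminf[OF fi fs1 fs2, of s]
    by (subst Bochner_Integration.integrable_cong[OF refl A\<Phi>[symmetric]]) auto
  have val: "(\<integral>r. indicator {t..s} r *\<^sub>R (A r ** \<Phi> r) \<partial>?\<mu>) = (\<Sum>j. U (Suc j) s)" for s
    using integral_suminf[OF fi fs1 fs2, of s]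
    by (subst Bochner_Integration.integral_cong[OF refl A\<Phi>[symmetric]]) (auto simp: US)
  have \<Phi>s: "\<Phi> s = mat 1 + (\<Sum>j. U (Suc j) s)" if "s \<in> {t..T}" for s
    using suminf_split_head[OF sumU[OF that]] by (simp add: \<Phi>_def U0)
  have \<Phi>t: "\<Phi> t = mat 1"
    using \<Phi>s[of t] tT by (simp add: val[symmetric] integral_leb_on_point[simplified])
  show ?thesis
  proof (rule that[of \<Phi>], rule ac_onI)
    show "\<Phi> t = mat 1" by (rule \<Phi>t)
    show "integrable ?\<mu> (\<lambda>r. A r ** \<Phi> r)"
      using int[of T] by (subst (asm) Bochner_Integration.integrable_cong[OF refl, of _ _ "\<lambda>r. A r ** \<Phi> r"]) auto
    fix s assume "s \<in> {t..T}"
    then show "\<Phi> s = \<Phi> t + (\<integral>r. indicator {t..s} r *\<^sub>R (A r ** \<Phi> r) \<partial>?\<mu>)"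
      unfolding \<Phi>t val by (rule \<Phi>s)
  qed
qed

text \<open>\<Psi> is the inverse of \<Phi>, recorded together with an equation of its own, so that
  the product rule replaces differentiation of a matrix inverse.\<close>

definition fundamental_pair ::
  "real \<Rightarrow> real \<Rightarrow> (real \<Rightarrow> real^'n^'n) \<Rightarrow> (real \<Rightarrow> real^'n^'n) \<Rightarrow> (real \<Rightarrow> real^'n^'n) \<Rightarrow> bool" where
  "fundamental_pair t T A \<Phi> \<Psi> \<longleftrightarrow> ac_on t T \<Phi> (\<lambda>r. A r ** \<Phi> r) \<and> ac_on t T \<Psi> (\<lambda>r. - (\<Psi> r ** A r)) \<and>
     \<Phi> t = mat 1 \<and> \<Psi> t = mat 1 \<and> (\<forall>s\<in>{t..T}. \<Psi> s ** \<Phi> s = mat 1 \<and> \<Phi> s ** \<Psi> s = mat 1)"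

text \<open>The inverse is constructed as a solution: it is the transpose of the fundamental matrix
  of \<open>- transpose A\<close>. The product of \<Psi> and \<Phi> has derivative zero, and for
  square matrices a left inverse is also a right inverse.\<close>

lemma fundamental_pair_exists:
  fixes A :: "real \<Rightarrow> real^'n^'n"
  assumes tT: "t \<le> T" and A: "A \<in> borel_measurable (leb_on t T)"
    and C: "\<And>s. s \<in> {t..T} \<Longrightarrow> norm (A s) \<le> C"
  obtains \<Phi> \<Psi> where "fundamental_pair t T A \<Phi> \<Psi>"
proof -
  obtain \<Phi> where \<Phi>: "ac_on t T \<Phi> (\<lambda>r. A r ** \<Phi> r)" "\<Phi> t = mat 1"
    using fundamental_matrix_exists[OF assms] by blast
  let ?A = "\<lambda>r. - transpose (A r)"
  have bl: "bounded_linear (\<lambda>B :: real^'n^'n. - transpose B)"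
    by (rule bounded_linear_minus[OF bounded_linear_transpose])
  obtain K where K: "\<And>B :: real^'n^'n. norm (- transpose B) \<le> norm B * K" "K > 0"
    using bounded_linear.pos_bounded[OF bl] by blast
  have mA: "?A \<in> borel_measurable (leb_on t T)"
    using A bounded_linear.continuous_on[OF bl continuous_on_id]
    by (rule borel_measurable_continuous_on[rotated])
  have nA: "norm (?A s) \<le> C * K" if "s \<in> {t..T}" for s
    using K(1)[of "A s"] mult_right_mono[OF C[OF that], of K] K(2) by linarith
  obtain \<Theta> where \<Theta>: "ac_on t T \<Theta> (\<lambda>r. ?A r ** \<Theta> r)" "\<Theta> t = mat 1"
    using fundamental_matrix_exists[OF tT mA nA] by blast
  let ?\<Psi> = "\<lambda>r. transpose (\<Theta> r)"
  have \<Psi>: "ac_on t T ?\<Psi> (\<lambda>r. - (?\<Psi> r ** A r))"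
    using ac_on_bounded_linear[OF bounded_linear_transpose \<Theta>(1)]
    by (simp add: matrix_transpose_mul transpose_linear_simps matrix_mult_linear_simps)
  have "ac_on t T (\<lambda>s. ?\<Psi> s ** \<Phi> s) (\<lambda>_. 0)"
    using ac_on_bilinear[OF bounded_bilinear_matrix_mult \<Psi> \<Phi>(1)]
    by (simp add: matrix_mult_linear_simps matrix_mul_assoc)
  then have "?\<Psi> s ** \<Phi> s = mat 1" if "s \<in> {t..T}" for s
    using ac_on_zero_deriv[OF _ that, of "\<lambda>s. ?\<Psi> s ** \<Phi> s"] \<Phi>(2) \<Theta>(2) by simp
  then have "fundamental_pair t T A \<Phi> ?\<Psi>"
    using \<Phi> \<Psi> \<Theta>(2) matrix_left_right_inverse[of "?\<Psi> _" "\<Phi> _"] unfolding fundamental_pair_def by auto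
  then show ?thesis by (rule that)
qed

lemma fundamental_pair_integrable:
  assumes "fundamental_pair t T A \<Phi> \<Psi>" "integrable (leb_on t T) h"
  shows "integrable (leb_on t T) (\<lambda>r. \<Psi> r *v h r)"
proof -
  have ac: "ac_on t T \<Psi> (\<lambda>r. - (\<Psi> r ** A r))" using assms(1) by (simp add: fundamental_pair_def)
  obtain C where "\<And>s. s \<in> {t..T} \<Longrightarrow> norm (\<Psi> s) \<le> C"
    using continuous_on_bound[OF ac_on_continuous[OF ac]] by metis
  then show ?thesis
    using assms(2) by (intro integrable_bilinear_bounded'[OF bounded_bilinear_matrix_vector_mult _ ac_on_measurable[OF ac]]) auto
qed

text \<open>Multiplication by \<Psi> removes the drift: the derivative of \<Psi> y is \<Psi> h. As
  the formula involves only the initial value and h, it also serves as the uniqueness theorem, in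
  place of a Gronwall estimate.\<close>

lemma variation_of_constants:
  assumes fp: "fundamental_pair t T A \<Phi> \<Psi>" and y: "ac_on t T y (\<lambda>r. A r *v y r + h r)" and s: "s \<in> {t..T}"
  shows "y s = \<Phi> s *v (y t + (\<integral>r. indicator {t..s} r *\<^sub>R (\<Psi> r *v h r) \<partial>leb_on t T))"
proof -
  have "ac_on t T (\<lambda>s. \<Psi> s *v y s) (\<lambda>s. - (\<Psi> s ** A s) *v y s + \<Psi> s *v (A s *v y s + h s))"
    using fp y by (intro ac_on_bilinear[OF bounded_bilinear_matrix_vector_mult]) (auto simp: fundamental_pair_def)
  then have "ac_on t T (\<lambda>s. \<Psi> s *v y s) (\<lambda>s. \<Psi> s *v h s)"
    by (simp add: matrix_vector_linear_simps matrix_vector_mul_assoc)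
  from ac_on_eq[OF this s] have "\<Psi> s *v y s = y t + (\<integral>r. indicator {t..s} r *\<^sub>R (\<Psi> r *v h r) \<partial>leb_on t T)"
    using fp by (simp add: fundamental_pair_def)
  then have "\<Phi> s *v (\<Psi> s *v y s) = \<Phi> s *v (y t + (\<integral>r. indicator {t..s} r *\<^sub>R (\<Psi> r *v h r) \<partial>leb_on t T))"
    by (rule arg_cong)
  moreover have "\<Phi> s ** \<Psi> s = mat 1" using fp s by (simp add: fundamental_pair_def)
  ultimately show ?thesis by (simp add: matrix_vector_mul_assoc)
qed

lemma variation_of_constants_solves:
  fixes y0 :: "real^'n"
  assumes tT: "t \<le> T" and fp: "fundamental_pair t T A \<Phi> \<Psi>" and h: "integrable (leb_on t T) h"
  defines "y \<equiv> \<lambda>s. \<Phi> s *v (y0 + (\<integral>r. indicator {t..s} r *\<^sub>R (\<Psi> r *v h r) \<partial>leb_on t T))"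
  shows "ac_on t T y (\<lambda>r. A r *v y r + h r)" "y t = y0"
proof -
  have "ac_on t T (\<lambda>s. y0 + (\<integral>r. indicator {t..s} r *\<^sub>R (\<Psi> r *v h r) \<partial>leb_on t T)) (\<lambda>r. 0 + \<Psi> r *v h r)"
    by (intro ac_on_add ac_on_const ac_on_primitive fundamental_pair_integrable[OF fp h] tT)
  from ac_on_bilinear[OF bounded_bilinear_matrix_vector_mult _ this, of \<Phi> "\<lambda>r. A r ** \<Phi> r"] fp
  have "ac_on t T y (\<lambda>s. (A s ** \<Phi> s) *v (y0 + (\<integral>r. indicator {t..s} r *\<^sub>R (\<Psi> r *v h r) \<partial>leb_on t T)) + \<Phi> s *v (0 + \<Psi> s *v h s))"
    by (simp add: fundamental_pair_def y_def)
  then show "ac_on t T y (\<lambda>r. A r *v y r + h r)"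
    by (rule ac_on_cong) (use fp in \<open>auto simp: y_def fundamental_pair_def matrix_vector_mul_assoc\<close>)
  show "y t = y0"
    using fp by (simp add: y_def fundamental_pair_def integral_leb_on_point[simplified])
qed

text \<open>Multiplying from the left by the inverse fundamental matrix of B and from the right by
  the fundamental matrix of -C removes both drifts: \<Psi> D \<Theta> is constant, and it vanishes
  at T.\<close>

lemma sylvester_zero:
  fixes D B C :: "real \<Rightarrow> real^'n^'n"
  assumes tT: "t \<le> T" and D: "ac_on t T D (\<lambda>r. B r ** D r + D r ** C r)" and DT: "D T = 0"
    and B: "B \<in> borel_measurable (leb_on t T)" "\<And>s. s \<in> {t..T} \<Longrightarrow> norm (B s) \<le> c"
    and C: "C \<in> borel_measurable (leb_on t T)" "\<And>s. s \<in> {t..T} \<Longrightarrow> norm (C s) \<le> d"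
    and s: "s \<in> {t..T}"
  shows "D s = 0"
proof -
  obtain \<Phi> \<Psi> where 1: "fundamental_pair t T B \<Phi> \<Psi>" using fundamental_pair_exists[OF tT B] by blast
  have C': "(\<lambda>r. - C r) \<in> borel_measurable (leb_on t T)" "\<And>s. s \<in> {t..T} \<Longrightarrow> norm (- C s) \<le> d" using C by auto
  obtain \<Theta> \<Xi> where 2: "fundamental_pair t T (\<lambda>r. - C r) \<Theta> \<Xi>" using fundamental_pair_exists[OF tT C'] by blast
  have "ac_on t T (\<lambda>s. \<Psi> s ** D s ** \<Theta> s)
     (\<lambda>s. (- (\<Psi> s ** B s) ** D s + \<Psi> s ** (B s ** D s + D s ** C s)) ** \<Theta> s + (\<Psi> s ** D s) ** (- C s ** \<Theta> s))"
    using 1 2 D by (intro ac_on_bilinear[OF bounded_bilinear_matrix_mult]) (auto simp: fundamental_pair_def)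
  then have "ac_on t T (\<lambda>s. \<Psi> s ** D s ** \<Theta> s) (\<lambda>_. 0)"
    by (simp add: matrix_mult_linear_simps matrix_mul_assoc)
  from ac_on_zero_deriv[OF this, of T] ac_on_zero_deriv[OF this s] DT tT
  have "\<Psi> s ** D s ** \<Theta> s = 0" by (simp add: matrix_mult_linear_simps)
  then have "\<Phi> s ** (\<Psi> s ** D s ** \<Theta> s) ** \<Xi> s = 0" by (simp add: matrix_mult_linear_simps)
  moreover have "\<Phi> s ** \<Psi> s = mat 1" "\<Theta> s ** \<Xi> s = mat 1" using 1 2 s by (auto simp: fundamental_pair_def)
  ultimately show ?thesis by (metis matrix_mul_assoc matrix_mul_lid matrix_mul_rid)
qed

section \<open>The deterministic linear-quadratic problem\<close>

lemma bounded_image_norm_le: "bounded (A ` I) \<Longrightarrow> \<exists>C\<ge>0. \<forall>s\<in>I. norm (A s) \<le> C"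
  by (metis bounded_pos image_eqI less_imp_le)

text \<open>The bound is pointwise rather than essential, matching \<open>Linf_on\<close>; this
  keeps null sets out of all coefficients formed from data and solutions.\<close>

definition bdd_meas :: "real \<Rightarrow> real \<Rightarrow> (real \<Rightarrow> 'a::euclidean_space) \<Rightarrow> bool" where
  "bdd_meas t T A \<longleftrightarrow> A \<in> borel_measurable (leb_on t T) \<and> bounded (A ` {t..T})"

lemma bdd_meas_measurable: "bdd_meas t T A \<Longrightarrow> A \<in> borel_measurable (leb_on t T)"
  by (simp add: bdd_meas_def)

lemma bdd_meas_bound:
  assumes "bdd_meas t T A"
  obtains C where "0 \<le> C" "\<And>s. s \<in> {t..T} \<Longrightarrow> norm (A s) \<le> C"
  using assms bounded_image_norm_le[of A "{t..T}"] by (auto simp: bdd_meas_def)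

lemma bdd_measI:
  "A \<in> borel_measurable (leb_on t T) \<Longrightarrow> (\<And>s. s \<in> {t..T} \<Longrightarrow> norm (A s) \<le> C) \<Longrightarrow> bdd_meas t T A"
  unfolding bdd_meas_def bounded_iff by blast

lemma bdd_meas_Linf: "Linf_on {0..T} A \<Longrightarrow> 0 \<le> t \<Longrightarrow> bdd_meas t T A"
  unfolding Linf_on_def bdd_meas_def
  by (auto intro: leb_on_borel_measurableI bounded_subset)

lemma bdd_meas_ac_on: "ac_on t T y g \<Longrightarrow> bdd_meas t T y"
  using ac_on_measurable ac_on_continuous
  by (auto simp: bdd_meas_def intro!: compact_imp_bounded compact_continuous_image)

lemma bdd_meas_bilinear:
  fixes B :: "'a::euclidean_space \<Rightarrow> 'b::euclidean_space \<Rightarrow> 'c::euclidean_space"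
  assumes B: "bounded_bilinear B" and "bdd_meas t T f" "bdd_meas t T g"
  shows "bdd_meas t T (\<lambda>s. B (f s) (g s))"
proof -
  obtain K where K: "K > 0" "\<And>a b. norm (B a b) \<le> norm a * norm b * K"
    using bounded_bilinear.pos_bounded[OF B] by blast
  obtain a where a: "0 \<le> a" "\<And>s. s \<in> {t..T} \<Longrightarrow> norm (f s) \<le> a" using bdd_meas_bound[OF assms(2)] by metis
  obtain b where b: "0 \<le> b" "\<And>s. s \<in> {t..T} \<Longrightarrow> norm (g s) \<le> b" using bdd_meas_bound[OF assms(3)] by metis
  have "norm (B (f s) (g s)) \<le> a * b * K" if "s \<in> {t..T}" for s
  proof -
    have "norm (B (f s) (g s)) \<le> norm (f s) * norm (g s) * K" by (rule K)
    also have "\<dots> \<le> a * b * K" using a b K that by (intro mult_right_mono mult_mono) auto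
    finally show ?thesis .
  qed
  then show ?thesis
    using assms by (intro bdd_measI[OF borel_measurable_bilinear[OF B]]) (auto dest: bdd_meas_measurable)
qed

lemma bdd_meas_linear:
  fixes L :: "'a::euclidean_space \<Rightarrow> 'b::euclidean_space"
  assumes "bounded_linear L" "bdd_meas t T f"
  shows "bdd_meas t T (\<lambda>s. L (f s))"
proof -
  have "(\<lambda>s. L (f s)) \<in> borel_measurable (leb_on t T)"
    using bounded_linear.continuous_on[OF assms(1) continuous_on_id] bdd_meas_measurable[OF assms(2)]
    by (rule borel_measurable_continuous_on)
  moreover have "bounded (L ` (f ` {t..T}))"
    using assms(2) by (intro bounded_linear_image[OF _ assms(1)]) (simp add: bdd_meas_def)
  ultimately show ?thesis by (simp add: bdd_meas_def image_image)
qed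

lemma bdd_meas_add: "bdd_meas t T f \<Longrightarrow> bdd_meas t T g \<Longrightarrow> bdd_meas t T (\<lambda>s. f s + g s)"
  by (auto simp: bdd_meas_def intro: bounded_plus_comp)

lemma bdd_meas_diff: "bdd_meas t T f \<Longrightarrow> bdd_meas t T g \<Longrightarrow> bdd_meas t T (\<lambda>s. f s - g s)"
  by (auto simp: bdd_meas_def intro: bounded_minus_comp)

lemma bdd_meas_const: "bdd_meas t T (\<lambda>_. c)"
  by (auto simp: bdd_meas_def intro: bounded_subset[of "{c}"])

lemmas bdd_meas_intros = bdd_meas_bilinear[OF bounded_bilinear_matrix_mult]
  bdd_meas_bilinear[OF bounded_bilinear_matrix_vector_mult] bdd_meas_linear[OF bounded_linear_transpose]
  bdd_meas_bilinear[OF bounded_bilinear_inner]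
  bdd_meas_add bdd_meas_diff bdd_meas_linear[OF bounded_linear_minus[OF bounded_linear_ident]] bdd_meas_const

lemma bdd_meas_integrable: "bdd_meas t T f \<Longrightarrow> integrable (leb_on t T) f"
  by (frule bdd_meas_measurable, erule bdd_meas_bound,
      rule finite_measure.integrable_const_bound[OF finite_measure_leb_on AE_I2]) auto

text \<open>With Q' for the transpose of Q, the quadratic terms differ by Q R Q - Q' R Q' = (Q - Q')
  R Q + Q' R (Q - Q'). As Q is a given bounded function, this is linear in D = Q - Q', and D solves
  a homogeneous Sylvester equation with final value 0.\<close>

lemma riccati_symmetric:
  fixes Q F R A :: "real \<Rightarrow> real^'n^'n"
  assumes tT: "t \<le> T"
    and Q: "ac_on t T Q (\<lambda>r. - (Q r ** F r + transpose (F r) ** Q r - Q r ** R r ** Q r + A r))"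
    and QT: "transpose (Q T) = Q T" and F: "bdd_meas t T F" and R: "bdd_meas t T R"
    and sym: "\<And>r. r \<in> {t..T} \<Longrightarrow> transpose (R r) = R r" "\<And>r. r \<in> {t..T} \<Longrightarrow> transpose (A r) = A r"
    and s: "s \<in> {t..T}"
  shows "transpose (Q s) = Q s"
proof -
  let ?D = "\<lambda>r. Q r - transpose (Q r)"
  let ?B = "\<lambda>r. transpose (Q r) ** R r - transpose (F r)" and ?C = "\<lambda>r. R r ** Q r - F r"
  note Qb = bdd_meas_ac_on[OF Q]
  have B: "bdd_meas t T ?B" and C: "bdd_meas t T ?C" by (intro bdd_meas_intros Qb F R)+
  have "ac_on t T ?D (\<lambda>r. ?B r ** ?D r + ?D r ** ?C r)"
    by (rule ac_on_cong[OF ac_on_diff[OF Q ac_on_bounded_linear[OF bounded_linear_transpose Q]]])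
      (simp_all add: sym transpose_linear_simps matrix_transpose_mul matrix_mult_linear_simps matrix_mul_assoc)
  note D = this
  obtain b where b:  "\<And>s. s \<in> {t..T} \<Longrightarrow> norm (?B s) \<le> b" using bdd_meas_bound[OF B] by metis
  obtain c where c:  "\<And>s. s \<in> {t..T} \<Longrightarrow> norm (?C s) \<le> c" using bdd_meas_bound[OF C] by metis
  have "?D s = 0"
    by (rule sylvester_zero[OF tT D _ bdd_meas_measurable[OF B] b bdd_meas_measurable[OF C] c s])
      (simp_all add: QT)
  then show ?thesis by simp
qed

section \<open>Square integrable functions\<close>

lemma inL2_measurable: "inL2 \<mu> X \<Longrightarrow> X \<in> borel_measurable \<mu>"
  by (simp add: inL2_def)

lemma inL2_dominated:
  fixes X :: "'x \<Rightarrow> 'a::euclidean_space"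
  assumes "X \<in> borel_measurable \<mu>" "integrable \<mu> g" "AE x in \<mu>. (norm (X x))\<^sup>2 \<le> g x"
  shows "inL2 \<mu> X"
proof -
  have "integrable \<mu> (\<lambda>x. (norm (X x))\<^sup>2)"
  proof (rule Bochner_Integration.integrable_bound[OF assms(2)])
    show "AE x in \<mu>. norm ((norm (X x))\<^sup>2) \<le> norm (g x)"
      using assms(3) by (rule eventually_mono) auto
  qed (use assms(1) in measurable)
  then show ?thesis using assms(1) by (simp add: inL2_def)
qed

lemma norm_add_square_le: "(norm (a + b :: 'a::real_normed_vector))\<^sup>2 \<le> 2 * (norm a)\<^sup>2 + 2 * (norm b)\<^sup>2"
proof -
  have "(norm (a + b))\<^sup>2 \<le> (norm a + norm b)\<^sup>2" by (intro power_mono norm_triangle_ineq) auto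
  also have "\<dots> \<le> 2 * (norm a)\<^sup>2 + 2 * (norm b)\<^sup>2" using sum_squares_bound[of "norm a" "norm b"] by (simp add: power2_sum)
  finally show ?thesis .
qed

lemma inL2_add:
  assumes "inL2 \<mu> X" "inL2 \<mu> Y" shows "inL2 \<mu> (\<lambda>x. X x + Y x)"
proof (rule inL2_dominated)
  show "integrable \<mu> (\<lambda>x. 2 * (norm (X x))\<^sup>2 + 2 * (norm (Y x))\<^sup>2)" using assms by (simp add: inL2_def)
qed (use assms norm_add_square_le in \<open>auto simp: inL2_def\<close>)

lemma inL2_bilinear:
  fixes B :: "'a::euclidean_space \<Rightarrow> 'b::euclidean_space \<Rightarrow> 'c::euclidean_space"
  assumes B: "bounded_bilinear B" and K: "K \<in> borel_measurable \<mu>" "\<And>x. x \<in> space \<mu> \<Longrightarrow> norm (K x) \<le> C"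
    and X: "inL2 \<mu> X"
  shows "inL2 \<mu> (\<lambda>x. B (K x) (X x))"
proof -
  obtain k where k: "k > 0" "\<And>a b. norm (B a b) \<le> norm a * norm b * k"
    using bounded_bilinear.pos_bounded[OF B] by blast
  show ?thesis
  proof (rule inL2_dominated)
    show "(\<lambda>x. B (K x) (X x)) \<in> borel_measurable \<mu>"
      by (intro borel_measurable_bilinear[OF B] K inL2_measurable[OF X])
    show "integrable \<mu> (\<lambda>x. (C * k)\<^sup>2 * (norm (X x))\<^sup>2)" using X by (simp add: inL2_def)
    show "AE x in \<mu>. (norm (B (K x) (X x)))\<^sup>2 \<le> (C * k)\<^sup>2 * (norm (X x))\<^sup>2"
    proof (rule AE_I2)
      fix x assume "x \<in> space \<mu>"
      have "norm (B (K x) (X x)) \<le> norm (K x) * norm (X x) * k" by (rule k)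
      also have "\<dots> \<le> C * norm (X x) * k"
        using K(2)[OF \<open>x \<in> space \<mu>\<close>] k by (intro mult_right_mono) auto
      finally have "norm (B (K x) (X x)) \<le> (C * k) * norm (X x)" by (simp add: mult_ac)
      then show "(norm (B (K x) (X x)))\<^sup>2 \<le> (C * k)\<^sup>2 * (norm (X x))\<^sup>2"
        unfolding power_mult_distrib[symmetric] by (intro power_mono) auto
    qed
  qed
qed

lemma inL2_linear:
  fixes L :: "'a::euclidean_space \<Rightarrow> 'b::euclidean_space"
  assumes L: "bounded_linear L" and X: "inL2 \<mu> X"
  shows "inL2 \<mu> (\<lambda>x. L (X x))"
proof -
  obtain k where k: "k > 0" "\<And>a. norm (L a) \<le> norm a * k" using bounded_linear.pos_bounded[OF L] by blast
  show ?thesis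
  proof (rule inL2_dominated)
    show "(\<lambda>x. L (X x)) \<in> borel_measurable \<mu>"
      using bounded_linear.continuous_on[OF L continuous_on_id] inL2_measurable[OF X]
      by (rule borel_measurable_continuous_on)
    show "integrable \<mu> (\<lambda>x. (norm (X x))\<^sup>2 * k\<^sup>2)" using X by (simp add: inL2_def)
    show "AE x in \<mu>. (norm (L (X x)))\<^sup>2 \<le> (norm (X x))\<^sup>2 * k\<^sup>2"
      unfolding power_mult_distrib[symmetric] using k by (intro AE_I2 power_mono) auto
  qed
qed

lemma inL2_diff: "inL2 \<mu> X \<Longrightarrow> inL2 \<mu> Y \<Longrightarrow> inL2 \<mu> (\<lambda>x. X x - Y x)"
  using inL2_add[of \<mu> X "\<lambda>x. - Y x"] inL2_linear[OF bounded_linear_minus[OF bounded_linear_ident], of \<mu> Y] by simp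

lemma inL2_inner_integrable:
  assumes "inL2 \<mu> X" "inL2 \<mu> Y" shows "integrable \<mu> (\<lambda>x. X x \<bullet> Y x)"
proof (rule Bochner_Integration.integrable_bound)
  show "integrable \<mu> (\<lambda>x. (norm (X x))\<^sup>2 + (norm (Y x))\<^sup>2)" using assms by (simp add: inL2_def)
  show "(\<lambda>x. X x \<bullet> Y x) \<in> borel_measurable \<mu>" using assms by (auto simp: inL2_def)
  have "norm (a \<bullet> b) \<le> (norm a)\<^sup>2 + (norm b)\<^sup>2" for a b :: 'b
    using Cauchy_Schwarz_ineq2[of a b] sum_squares_bound[of "norm a" "norm b"] by simp
  then show "AE x in \<mu>. norm (X x \<bullet> Y x) \<le> norm ((norm (X x))\<^sup>2 + (norm (Y x))\<^sup>2)"
    by (intro AE_I2) (simp add: order_trans[OF _ abs_ge_self])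
qed

lemma inL2_integrable:
  assumes "finite_measure \<mu>" "inL2 \<mu> X" shows "integrable \<mu> X"
proof -
  have "integrable \<mu> (\<lambda>x. norm (X x))"
    by (rule finite_measure.square_integrable_imp_integrable[OF assms(1)]) (use assms(2) in \<open>auto simp: inL2_def\<close>)
  then show ?thesis using assms(2) by (simp add: inL2_def integrable_norm_iff)
qed

lemma inL2_bounded:
  assumes "finite_measure \<mu>" "X \<in> borel_measurable \<mu>" "\<And>x. x \<in> space \<mu> \<Longrightarrow> norm (X x) \<le> C"
  shows "inL2 \<mu> X"
proof (rule inL2_dominated[OF assms(2)])
  interpret finite_measure \<mu> by fact
  show "integrable \<mu> (\<lambda>_. C\<^sup>2)" by simp
  show "AE x in \<mu>. (norm (X x))\<^sup>2 \<le> C\<^sup>2" using assms(3) by (intro AE_I2 power_mono) auto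
qed

lemma inL2_const: "finite_measure \<mu> \<Longrightarrow> inL2 \<mu> (\<lambda>_. c)"
  by (rule inL2_bounded[of _ _ "norm c"]) auto

lemma bdd_meas_inL2: "bdd_meas t T X \<Longrightarrow> inL2 (leb_on t T) X"
  by (frule bdd_meas_measurable, erule bdd_meas_bound, rule inL2_bounded[OF finite_measure_leb_on]) auto

lemma bdd_meas_inL2_mult:
  fixes K :: "real \<Rightarrow> real^'n^'m"
  assumes "bdd_meas t T K" "inL2 (leb_on t T) X" shows "inL2 (leb_on t T) (\<lambda>s. K s *v X s)"
proof -
  obtain C where "\<And>s. s \<in> {t..T} \<Longrightarrow> norm (K s) \<le> C" using bdd_meas_bound[OF assms(1)] by metis
  then show ?thesis
    using assms by (intro inL2_bilinear[OF bounded_bilinear_matrix_vector_mult bdd_meas_measurable]) auto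
qed

section \<open>Completing the square along a trajectory\<close>

lemma inner_transpose: "(transpose A *v x) \<bullet> y = x \<bullet> (A *v y)" for A :: "real^'n^'m"
  by (simp add: dot_lmul_matrix)

lemma inner_symmetric: "transpose A = A \<Longrightarrow> (A *v x) \<bullet> y = x \<bullet> (A *v y)" for A :: "real^'n^'n"
  by (metis inner_transpose)

text \<open>The left side is the derivative of the candidate value Qx.x/2 + l.x along the dynamics,
  plus the running cost. As a function of v it is quadratic with leading part N, and w measures the
  distance of v from its minimiser. After completing the square, the Riccati equation cancels what
  is quadratic in x and the equation for l what is linear in x.\<close>

lemma riccati_square_pointwise:
  fixes F Q A :: "real^'n^'n" and G :: "real^'d^'n" and N N' :: "real^'d^'d"
    and x f l a :: "real^'n" and v b :: "real^'d"
  assumes Q: "transpose Q = Q" and N: "transpose N = N" and N': "transpose N' = N'" and NN: "N ** N' = mat 1"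
  defines "xd \<equiv> F *v x + G *v v + f"
    and "Qd \<equiv> - (Q ** F + transpose F ** Q - Q ** (G ** N' ** transpose G) ** Q + A)"
    and "ld \<equiv> - ((transpose F - Q ** (G ** N' ** transpose G)) *v l + a + Q *v (f - G *v (N' *v b)))"
    and "w \<equiv> v + N' *v (transpose G *v (Q *v x + l) + b)"
    and "k \<equiv> transpose G *v l + b"
  shows "1/2 * ((Qd *v x + Q *v xd) \<bullet> x + (Q *v x) \<bullet> xd) + (ld \<bullet> x + l \<bullet> xd)
     + (1/2 * ((A *v x) \<bullet> x) + 1/2 * ((N *v v) \<bullet> v) + a \<bullet> x + b \<bullet> v)
     = f \<bullet> l - 1/2 * ((N' *v k) \<bullet> k) + 1/2 * ((N *v w) \<bullet> w)"
proof -
  \<comment> \<open>In terms of p, g and h every summand is an inner product of a few fixed vectors,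
    and the claim becomes linear arithmetic in these numbers.\<close>
  define p where "p = Q *v x"
  define g where "g = transpose G *v p"
  define h where "h = transpose G *v l"
  have sQ: "(Q *v y) \<bullet> x = y \<bullet> p" for y unfolding p_def by (rule inner_symmetric[OF Q])
  have sN: "(N' *v y) \<bullet> z = y \<bullet> (N' *v z)" for y z by (rule inner_symmetric[OF N'])
  have mG: "(G *v y) \<bullet> p = y \<bullet> g" for y unfolding g_def by (metis inner_transpose transpose_transpose)
  have mG': "l \<bullet> (G *v y) = h \<bullet> y" for y unfolding h_def by (metis inner_transpose)
  have mF: "(transpose F *v y) \<bullet> x = y \<bullet> (F *v x)" for y by (rule inner_transpose)
  have mv: "(B ** C) *v y = B *v (C *v y)" for B :: "real^'j^'i" and C :: "real^'k^'j" and y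
    by (simp add: matrix_vector_mul_assoc)
  have wd: "w = v + N' *v (g + (h + b))"
    unfolding w_def g_def h_def p_def by (simp add: matrix_vector_linear_simps add.assoc del: transpose_matrix_vector)
  have Nw: "N *v w = N *v v + (g + (h + b))"
    unfolding wd by (simp add: matrix_vector_linear_simps mv[symmetric] NN)
  have Nv: "(N *v v) \<bullet> (N' *v z) = v \<bullet> z" for z
    by (metis N NN inner_symmetric matrix_vector_mul_assoc matrix_vector_mul_lid)
  have Qdx: "(Qd *v x) \<bullet> x = - ((F *v x) \<bullet> p + p \<bullet> (F *v x) - (N' *v g) \<bullet> g + (A *v x) \<bullet> x)"
    unfolding Qd_def
    by (simp add: matrix_vector_linear_simps mv inner_diff_left inner_add_left sQ mF mG p_def[symmetric] g_def[symmetric] del: transpose_matrix_vector)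
  have ldx: "ld \<bullet> x = - (l \<bullet> (F *v x) - (N' *v h) \<bullet> g + a \<bullet> x + f \<bullet> p - (N' *v b) \<bullet> g)"
    unfolding ld_def
    by (simp add: matrix_vector_linear_simps mv inner_diff_left inner_add_left sQ mF mG h_def[symmetric] del: transpose_matrix_vector)
  have px: "(Q *v xd) \<bullet> x = (F *v x) \<bullet> p + v \<bullet> g + f \<bullet> p"
    unfolding xd_def sQ by (simp add: inner_add_left mG)
  have lx: "l \<bullet> xd = l \<bullet> (F *v x) + h \<bullet> v + f \<bullet> l"
    unfolding xd_def by (simp add: inner_add_right mG' inner_commute[of l f])
  have px': "p \<bullet> xd = (F *v x) \<bullet> p + v \<bullet> g + f \<bullet> p"
    unfolding xd_def by (simp add: inner_add_left mG inner_commute[of p])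
  have k: "k = h + b" by (simp add: k_def h_def)
  have nk: "(N' *v (g + (h + b))) \<bullet> (g + (h + b))
      = (N' *v g) \<bullet> g + 2 * ((N' *v h) \<bullet> g) + 2 * ((N' *v b) \<bullet> g) + (N' *v (h + b)) \<bullet> (h + b)"
    using sN[of g h] sN[of g b]
    by (simp add: matrix_vector_linear_simps inner_add_left inner_add_right inner_commute[of g])
  have Nww: "(N *v w) \<bullet> w = (N *v v) \<bullet> v + 2 * (v \<bullet> g) + 2 * (h \<bullet> v) + 2 * (b \<bullet> v)
      + (N' *v (g + (h + b))) \<bullet> (g + (h + b))"
  proof -
    let ?z = "g + (h + b)"
    have "(N *v w) \<bullet> w = (N *v v) \<bullet> v + (N *v v) \<bullet> (N' *v ?z) + ?z \<bullet> v + ?z \<bullet> (N' *v ?z)"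
      unfolding Nw unfolding wd by (simp only: inner_add_left inner_add_right add.assoc)
    also have "\<dots> = (N *v v) \<bullet> v + 2 * (?z \<bullet> v) + (N' *v ?z) \<bullet> ?z"
      using Nv[of ?z] sN[of ?z ?z] inner_commute[of v ?z] by linarith
    moreover have "?z \<bullet> v = v \<bullet> g + h \<bullet> v + b \<bullet> v" by (simp add: inner_add_left inner_commute[of v g])
    ultimately show ?thesis by linarith
  qed
  show ?thesis
    unfolding inner_add_left[of "Qd *v x"] Qdx ldx px lx p_def[symmetric] px' Nww nk k
    using inner_commute[of p "F *v x"] by argo
qed

text \<open>The pointwise identity integrated over time; the total derivative contributes the end
  values. \<open>Q T\<close> and \<open>l T\<close> are left free, so that the lemma applies to the
  mean, with \<Sigma> and \<open>lam\<close>, and to a fluctuation, with P and l = 0. The integrand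
  is rewritten before any integral is split, so integrability is checked for the terms on the right
  and for the total derivative.\<close>

lemma lq_completion_of_squares:
  fixes F Q A :: "real \<Rightarrow> real^'n^'n" and G :: "real \<Rightarrow> real^'d^'n" and N N' :: "real \<Rightarrow> real^'d^'d"
    and x f l a :: "real \<Rightarrow> real^'n" and v b :: "real \<Rightarrow> real^'d"
  assumes tT: "t \<le> T"
    and x: "ac_on t T x (\<lambda>r. F r *v x r + G r *v v r + f r)"
    and Q: "ac_on t T Q (\<lambda>r. - (Q r ** F r + transpose (F r) ** Q r
          - Q r ** (G r ** N' r ** transpose (G r)) ** Q r + A r))"
    and l: "ac_on t T l (\<lambda>r. - ((transpose (F r) - Q r ** (G r ** N' r ** transpose (G r))) *v l r + a r
          + Q r *v (f r - G r *v (N' r *v b r))))"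
    and sym: "\<And>r. r \<in> {t..T} \<Longrightarrow> transpose (Q r) = Q r" "\<And>r. r \<in> {t..T} \<Longrightarrow> transpose (N r) = N r"
      "\<And>r. r \<in> {t..T} \<Longrightarrow> transpose (N' r) = N' r" "\<And>r. r \<in> {t..T} \<Longrightarrow> N r ** N' r = mat 1"
    and bdd: "bdd_meas t T G" "bdd_meas t T N" "bdd_meas t T N'" "bdd_meas t T b"
    and f: "inL2 (leb_on t T) f" and v: "inL2 (leb_on t T) v"
  defines "k \<equiv> \<lambda>r. transpose (G r) *v l r + b r"
    and "w \<equiv> \<lambda>r. v r + N' r *v (transpose (G r) *v (Q r *v x r + l r) + b r)"
  shows "inL2 (leb_on t T) w"
    and "(\<integral>r. 1/2 * ((A r *v x r) \<bullet> x r) + 1/2 * ((N r *v v r) \<bullet> v r) + a r \<bullet> x r + b r \<bullet> v r \<partial>leb_on t T)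
        + 1/2 * ((Q T *v x T) \<bullet> x T) + l T \<bullet> x T
      = 1/2 * ((Q t *v x t) \<bullet> x t) + l t \<bullet> x t
        + (\<integral>r. f r \<bullet> l r \<partial>leb_on t T) - 1/2 * (\<integral>r. (N' r *v k r) \<bullet> k r \<partial>leb_on t T)
        + 1/2 * (\<integral>r. (N r *v w r) \<bullet> w r \<partial>leb_on t T)"
proof -
  let ?\<mu> = "leb_on t T"
  note b_ac = bdd_meas_ac_on[OF x] bdd_meas_ac_on[OF Q] bdd_meas_ac_on[OF l]
  show w: "inL2 ?\<mu> w"
    unfolding w_def by (intro inL2_add v bdd_meas_inL2 bdd_meas_intros bdd b_ac)
  have i1: "integrable ?\<mu> (\<lambda>r. f r \<bullet> l r)"
    by (intro inL2_inner_integrable f bdd_meas_inL2 b_ac)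
  have i2: "integrable ?\<mu> (\<lambda>r. (N' r *v k r) \<bullet> k r)"
    unfolding k_def by (intro bdd_meas_integrable bdd_meas_intros bdd b_ac)
  have i3: "integrable ?\<mu> (\<lambda>r. (N r *v w r) \<bullet> w r)"
    by (intro inL2_inner_integrable w bdd_meas_inL2_mult bdd)
  define xd where "xd = (\<lambda>r. F r *v x r + G r *v v r + f r)"
  define Qd where "Qd = (\<lambda>r. - (Q r ** F r + transpose (F r) ** Q r
          - Q r ** (G r ** N' r ** transpose (G r)) ** Q r + A r))"
  define ld where "ld = (\<lambda>r. - ((transpose (F r) - Q r ** (G r ** N' r ** transpose (G r))) *v l r + a r
          + Q r *v (f r - G r *v (N' r *v b r))))"
  define \<phi> where "\<phi> r = 1/2 * ((Q r *v x r) \<bullet> x r) + l r \<bullet> x r" for r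
  define \<phi>d where "\<phi>d r = 1/2 * ((Qd r *v x r + Q r *v xd r) \<bullet> x r + (Q r *v x r) \<bullet> xd r) + (ld r \<bullet> x r + l r \<bullet> xd r)" for r
  have ac: "ac_on t T \<phi> \<phi>d"
    unfolding \<phi>_def \<phi>d_def
    by (intro ac_on_add ac_on_bounded_linear[OF bounded_linear_mult_right]
        ac_on_bilinear[OF bounded_bilinear_inner] ac_on_bilinear[OF bounded_bilinear_matrix_vector_mult]
        x[folded xd_def] Q[folded Qd_def] l[folded ld_def])
  have "(\<integral>r. 1/2 * ((A r *v x r) \<bullet> x r) + 1/2 * ((N r *v v r) \<bullet> v r) + a r \<bullet> x r + b r \<bullet> v r \<partial>?\<mu>)
      = (\<integral>r. (f r \<bullet> l r - 1/2 * ((N' r *v k r) \<bullet> k r) + 1/2 * ((N r *v w r) \<bullet> w r)) - \<phi>d r \<partial>?\<mu>)"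
  proof (rule Bochner_Integration.integral_cong[OF refl])
    fix r assume "r \<in> space ?\<mu>"
    then have r: "r \<in> {t..T}" by simp
    show "1/2 * ((A r *v x r) \<bullet> x r) + 1/2 * ((N r *v v r) \<bullet> v r) + a r \<bullet> x r + b r \<bullet> v r
      = (f r \<bullet> l r - 1/2 * ((N' r *v k r) \<bullet> k r) + 1/2 * ((N r *v w r) \<bullet> w r)) - \<phi>d r"
      using riccati_square_pointwise[OF sym(1)[OF r] sym(2)[OF r] sym(3)[OF r] sym(4)[OF r],
          where F = "F r" and x = "x r" and G = "G r" and v = "v r" and f = "f r" and A = "A r"
            and l = "l r" and a = "a r" and b = "b r"]
      unfolding \<phi>d_def xd_def Qd_def ld_def k_def w_def by linarith
  qed
  also have "\<dots> = (\<integral>r. f r \<bullet> l r \<partial>?\<mu>) - 1/2 * (\<integral>r. (N' r *v k r) \<bullet> k r \<partial>?\<mu>)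
        + 1/2 * (\<integral>r. (N r *v w r) \<bullet> w r \<partial>?\<mu>) - (\<integral>r. \<phi>d r \<partial>?\<mu>)"
    using i1 i2 i3 ac_on_integrable[OF ac] by simp
  also have "(\<integral>r. \<phi>d r \<partial>?\<mu>) = \<phi> T - \<phi> t" by (rule ac_on_integral[OF ac tT])
  finally show "(\<integral>r. 1/2 * ((A r *v x r) \<bullet> x r) + 1/2 * ((N r *v v r) \<bullet> v r) + a r \<bullet> x r + b r \<bullet> v r \<partial>?\<mu>)
        + 1/2 * ((Q T *v x T) \<bullet> x T) + l T \<bullet> x T
      = 1/2 * ((Q t *v x t) \<bullet> x t) + l t \<bullet> x t
        + (\<integral>r. f r \<bullet> l r \<partial>?\<mu>) - 1/2 * (\<integral>r. (N' r *v k r) \<bullet> k r \<partial>?\<mu>)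
        + 1/2 * (\<integral>r. (N r *v w r) \<bullet> w r \<partial>?\<mu>)"
    unfolding \<phi>_def by linarith
qed

section \<open>Mean-field dynamics\<close>

text \<open>The second bound is Cauchy-Schwarz against the constant 1, obtained from the nonnegative
  integral of (M |X| - I)^2, where M is the total mass and I the integral of |X|. Positive mass
  allows the division by M.\<close>

lemma norm_integral_square_le:
  fixes X :: "'x \<Rightarrow> 'a::euclidean_space"
  assumes fin: "finite_measure \<mu>" and X: "inL2 \<mu> X" and pos: "0 < measure \<mu> (space \<mu>)"
  shows "(norm (\<integral>x. X x \<partial>\<mu>))\<^sup>2 \<le> (\<integral>x. norm (X x) \<partial>\<mu>)\<^sup>2"
    and "(\<integral>x. norm (X x) \<partial>\<mu>)\<^sup>2 \<le> measure \<mu> (space \<mu>) * (\<integral>x. (norm (X x))\<^sup>2 \<partial>\<mu>)"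
proof -
  interpret finite_measure \<mu> by fact
  show "(norm (\<integral>x. X x \<partial>\<mu>))\<^sup>2 \<le> (\<integral>x. norm (X x) \<partial>\<mu>)\<^sup>2"
    by (intro power_mono integral_norm_bound) auto
  define M where "M = measure \<mu> (space \<mu>)"
  define I where "I = (\<integral>x. norm (X x) \<partial>\<mu>)"
  define J where "J = (\<integral>x. (norm (X x))\<^sup>2 \<partial>\<mu>)"
  have i1: "integrable \<mu> (\<lambda>x. norm (X x))" using inL2_integrable[OF fin X] by simp
  have i2: "integrable \<mu> (\<lambda>x. (norm (X x))\<^sup>2)" using X by (simp add: inL2_def)
  have "0 \<le> (\<integral>x. (M * norm (X x) - I)\<^sup>2 \<partial>\<mu>)" by simp
  also have "\<dots> = (\<integral>x. M\<^sup>2 * (norm (X x))\<^sup>2 - 2 * M * I * norm (X x) + I\<^sup>2 \<partial>\<mu>)"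
    by (intro Bochner_Integration.integral_cong) (auto simp: power2_eq_square algebra_simps)
  also have "\<dots> = M\<^sup>2 * J - 2 * M * I * I + I\<^sup>2 * M"
    using i1 i2 by (simp add: M_def I_def J_def)
  also have "\<dots> = M * (M * J - I\<^sup>2)" by (simp add: power2_eq_square algebra_simps)
  finally have "0 \<le> M * J - I\<^sup>2" using pos by (simp add: M_def zero_le_mult_iff)
  then show "(\<integral>x. norm (X x) \<partial>\<mu>)\<^sup>2 \<le> measure \<mu> (space \<mu>) * (\<integral>x. (norm (X x))\<^sup>2 \<partial>\<mu>)"
    by (simp add: M_def I_def J_def)
qed

section \<open>Square integrable functions on a product of two finite measure spaces\<close>

locale finite_pair =
  a: finite_measure \<mu> + b: finite_measure \<nu> for \<mu> :: "'s measure" and \<nu> :: "'x measure"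
begin

sublocale pair_sigma_finite \<mu> \<nu> ..

lemma measurable_section:
  assumes "case_prod V \<in> borel_measurable (\<mu> \<Otimes>\<^sub>M \<nu>)"
  shows "x \<in> space \<nu> \<Longrightarrow> (\<lambda>s. V s x) \<in> borel_measurable \<mu>" "s \<in> space \<mu> \<Longrightarrow> V s \<in> borel_measurable \<nu>"
  using measurable_compose[OF measurable_Pair2' assms, of x] measurable_compose[OF measurable_Pair1' assms, of s]
  by simp_all

lemma inL2_pairD:
  assumes "inL2 (\<mu> \<Otimes>\<^sub>M \<nu>) (case_prod V)"
  shows "integrable (\<mu> \<Otimes>\<^sub>M \<nu>) (\<lambda>(s, x). (norm (V s x))\<^sup>2)"
  using assms by (simp add: inL2_def case_prod_beta')

text \<open>Fubini yields square integrable sections only almost everywhere; this is why controls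
  are handled for almost every x or almost every time from here on.\<close>

lemma inL2_pair_section:
  assumes V: "inL2 (\<mu> \<Otimes>\<^sub>M \<nu>) (case_prod V)"
  shows "AE x in \<nu>. inL2 \<mu> (\<lambda>s. V s x)" "AE s in \<mu>. inL2 \<nu> (V s)"
proof -
  note m = measurable_section[OF inL2_measurable[OF V]]
  show "AE x in \<nu>. inL2 \<mu> (\<lambda>s. V s x)"
    using AE_integrable_snd[OF inL2_pairD[OF V]] AE_space by eventually_elim (simp add: inL2_def m)
  show "AE s in \<mu>. inL2 \<nu> (V s)"
    using AE_integrable_fst[OF inL2_pairD[OF V]] AE_space by eventually_elim (simp add: inL2_def m)
qed

lemma integrable_pair_fst:
  fixes g :: "'s \<Rightarrow> real"
  assumes "integrable \<mu> g" shows "integrable (\<mu> \<Otimes>\<^sub>M \<nu>) (\<lambda>(s, x). g s)"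
  using integrable_pair_bilinear[OF bounded_bilinear_mult assms, of \<nu> "\<lambda>_. 1"] a.finite_measure_axioms b.finite_measure_axioms
  by simp

lemma integrable_pair_snd:
  fixes g :: "'x \<Rightarrow> real"
  assumes "integrable \<nu> g" shows "integrable (\<mu> \<Otimes>\<^sub>M \<nu>) (\<lambda>(s, x). g x)"
  using integrable_pair_bilinear[OF bounded_bilinear_mult _ assms, of \<mu> "\<lambda>_. 1"] a.finite_measure_axioms b.finite_measure_axioms
  by simp

lemma inL2_pair_fst:
  assumes "inL2 \<mu> X" shows "inL2 (\<mu> \<Otimes>\<^sub>M \<nu>) (\<lambda>(s, x). X s)"
  using integrable_pair_fst[of "\<lambda>s. (norm (X s))\<^sup>2"] measurable_compose[OF measurable_fst inL2_measurable[OF assms]] assms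
  by (simp add: inL2_def case_prod_beta')

lemma inL2_pair_snd:
  assumes "inL2 \<nu> X" shows "inL2 (\<mu> \<Otimes>\<^sub>M \<nu>) (\<lambda>(s, x). X x)"
  using integrable_pair_snd[of "\<lambda>s. (norm (X s))\<^sup>2"] measurable_compose[OF measurable_snd inL2_measurable[OF assms]] assms
  by (simp add: inL2_def case_prod_beta')

lemma inL2_pair_mult:
  fixes K :: "'s \<Rightarrow> real^'n^'k"
  assumes V: "inL2 (\<mu> \<Otimes>\<^sub>M \<nu>) (case_prod V)" and K: "K \<in> borel_measurable \<mu>"
    "\<And>s. s \<in> space \<mu> \<Longrightarrow> norm (K s) \<le> C"
  shows "inL2 (\<mu> \<Otimes>\<^sub>M \<nu>) (\<lambda>(s, x). K s *v V s x)"
proof -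
  have "inL2 (\<mu> \<Otimes>\<^sub>M \<nu>) (\<lambda>z. K (fst z) *v case_prod V z)"
    by (rule inL2_bilinear[OF bounded_bilinear_matrix_vector_mult _ _ V])
      (use K in \<open>auto simp: space_pair_measure\<close>)
  then show ?thesis by (simp add: case_prod_beta')
qed

text \<open>Cauchy-Schwarz in x bounds the squared mean by the mass times the squared norm of the
  section, which is integrable in time.\<close>

lemma inL2_mean:
  assumes V: "inL2 (\<mu> \<Otimes>\<^sub>M \<nu>) (case_prod V)" and pos: "0 < measure \<nu> (space \<nu>)"
  shows "inL2 \<mu> (\<lambda>s. mean \<nu> (V s))"
  unfolding mean_def
proof (rule inL2_dominated)
  show "(\<lambda>s. integral\<^sup>L \<nu> (V s)) \<in> borel_measurable \<mu>"
    using inL2_measurable[OF V] by (rule b.borel_measurable_lebesgue_integral)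
  show "integrable \<mu> (\<lambda>s. measure \<nu> (space \<nu>) * (\<integral>x. (norm (V s x))\<^sup>2 \<partial>\<nu>))"
    using integrable_fst[OF inL2_pairD[OF V]] by simp
  show "AE s in \<mu>. (norm (integral\<^sup>L \<nu> (V s)))\<^sup>2 \<le> measure \<nu> (space \<nu>) * (\<integral>x. (norm (V s x))\<^sup>2 \<partial>\<nu>)"
    using inL2_pair_section(2)[OF V]
    by (rule eventually_mono)
      (rule order_trans[OF norm_integral_square_le(1,2)[OF b.finite_measure_axioms _ pos]])
qed

end

lemma measure_leb_on: "t \<le> T \<Longrightarrow> measure (leb_on t T) {t..T} = T - t"
  by (simp add: measure_restrict_space)

section \<open>Structure, existence and mean of the states of a control\<close>

locale mf_dynamics =
  fixes m :: "(real^'n) measure" and F Fb :: "real \<Rightarrow> real^'n^'n" and G :: "real \<Rightarrow> real^'d^'n"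
    and f :: "real \<Rightarrow> real^'n" and t T :: real and Xt :: "real^'n \<Rightarrow> real^'n"
  assumes prob_m: "prob_space m" and tT: "t < T"
    and bdd: "bdd_meas t T F" "bdd_meas t T Fb" "bdd_meas t T G"
    and f_L2: "inL2 (leb_on t T) f" and Xt_L2: "inL2 m Xt"
begin

lemma tT_le: "t \<le> T" using tT by simp

sublocale m: prob_space m by (rule prob_m)

sublocale finite_pair "leb_on t T" m
  unfolding finite_pair_def by (intro conjI finite_measure_leb_on m.finite_measure_axioms)

lemma adm_iff: "V \<in> adm m t T \<longleftrightarrow> inL2 (leb_on t T \<Otimes>\<^sub>M m) (case_prod V)"
  by (simp add: adm_def inL2_def case_prod_beta')

lemma inL2_pair_bdd_mult:
  fixes K :: "real \<Rightarrow> real^'j^'i"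
  assumes "inL2 (leb_on t T \<Otimes>\<^sub>M m) (case_prod V)" "bdd_meas t T K"
  shows "inL2 (leb_on t T \<Otimes>\<^sub>M m) (\<lambda>(s, x). K s *v V s x)"
proof -
  obtain C where "\<And>s. s \<in> {t..T} \<Longrightarrow> norm (K s) \<le> C" using bdd_meas_bound[OF assms(2)] by metis
  then show ?thesis using inL2_pair_mult[OF assms(1) bdd_meas_measurable[OF assms(2)]] by auto
qed

text \<open>Cauchy-Schwarz in time bounds the squared norm of \<open>Z s x\<close> by one function g
  of x, for all s at once. This single bound gives square integrability over the product and at
  every fixed time, not merely at almost every time.\<close>

lemma primitive_pair:
  fixes W :: "real \<Rightarrow> real^'n \<Rightarrow> real^'n"
  assumes W: "inL2 (leb_on t T \<Otimes>\<^sub>M m) (case_prod W)"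
  defines "Z \<equiv> \<lambda>s x. \<integral>r. indicator {t..s} r *\<^sub>R W r x \<partial>leb_on t T"
  shows "inL2 (leb_on t T \<Otimes>\<^sub>M m) (case_prod Z)"
    and "s \<in> {t..T} \<Longrightarrow> inL2 m (Z s)"
    and "s \<in> {t..T} \<Longrightarrow> mean m (Z s) = (\<integral>r. indicator {t..s} r *\<^sub>R mean m (W r) \<partial>leb_on t T)"
proof -
  let ?\<mu> = "leb_on t T"
  note [measurable] = inL2_measurable[OF W]
  \<comment> \<open>The factor T - t is the total mass that Cauchy-Schwarz over the time interval
    produces.\<close>
  define g where "g = (\<lambda>x. (T - t) * (\<integral>r. (norm (W r x))\<^sup>2 \<partial>?\<mu>))"
  have g: "integrable m g" using integrable_snd[OF inL2_pairD[OF W]] by (simp add: g_def)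
  have "(\<lambda>z. \<integral>r. indicator {t..fst z} r *\<^sub>R W r (snd z) \<partial>?\<mu>) \<in> borel_measurable (?\<mu> \<Otimes>\<^sub>M m)"
    unfolding indicator_def atLeastAtMost_iff
    by (rule a.borel_measurable_lebesgue_integral) measurable
  then have Zm: "case_prod Z \<in> borel_measurable (?\<mu> \<Otimes>\<^sub>M m)" by (simp add: Z_def case_prod_beta')
  have bound: "AE x in m. \<forall>s. (norm (Z s x))\<^sup>2 \<le> g x"
    using inL2_pair_section(1)[OF W]
  proof eventually_elim
    case (elim x)
    have i: "integrable ?\<mu> (\<lambda>r. W r x)" by (rule inL2_integrable[OF a.finite_measure_axioms elim])
    show ?case
    proof
      fix s
      have "norm (Z s x) \<le> (\<integral>r. norm (indicator {t..s} r *\<^sub>R W r x) \<partial>?\<mu>)"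
        unfolding Z_def by (rule integral_norm_bound)
      also have "\<dots> \<le> (\<integral>r. norm (W r x) \<partial>?\<mu>)"
        by (rule integral_mono[OF integrable_norm[OF integrable_indicator_leb_on[OF i]] integrable_norm[OF i]])
          (auto split: split_indicator)
      finally have "(norm (Z s x))\<^sup>2 \<le> (\<integral>r. norm (W r x) \<partial>?\<mu>)\<^sup>2" by (intro power_mono) auto
      also have "\<dots> \<le> g x"
        using norm_integral_square_le(2)[OF a.finite_measure_axioms elim] tT
        by (simp add: g_def measure_leb_on)
      finally show "(norm (Z s x))\<^sup>2 \<le> g x" .
    qed
  qed
  show "inL2 (?\<mu> \<Otimes>\<^sub>M m) (case_prod Z)"
  proof (rule inL2_dominated[OF Zm integrable_pair_snd[OF g]])
    show "AE z in ?\<mu> \<Otimes>\<^sub>M m. (norm (case_prod Z z))\<^sup>2 \<le> (case z of (s, x) \<Rightarrow> g x)"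
    proof (rule AE_pair_measure)
      show "{z \<in> space (?\<mu> \<Otimes>\<^sub>M m). (norm (case_prod Z z))\<^sup>2 \<le> (case z of (s, x) \<Rightarrow> g x)} \<in> sets (?\<mu> \<Otimes>\<^sub>M m)"
        by (intro borel_measurable_le borel_measurable_power measurable_compose[OF Zm borel_measurable_norm]
            borel_measurable_integrable[OF integrable_pair_snd[OF g]])
      show "AE s in ?\<mu>. AE x in m. (norm (case_prod Z (s, x)))\<^sup>2 \<le> (case (s, x) of (s, x) \<Rightarrow> g x)"
        by (rule AE_I2, rule eventually_mono[OF bound]) simp
    qed
  qed
  assume s: "s \<in> {t..T}"
  show "inL2 m (Z s)"
    by (rule inL2_dominated[OF _ g eventually_mono[OF bound]]) (use measurable_section(2)[OF Zm] s in auto)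
  have "integrable (?\<mu> \<Otimes>\<^sub>M m) (case_prod W)"
    by (rule inL2_integrable[OF _ W]) (simp add: finite_measure_pair_measure a.finite_measure_axioms m.finite_measure_axioms)
  then have "integrable (?\<mu> \<Otimes>\<^sub>M m) (\<lambda>(r, x). indicator {t..s} r *\<^sub>R W r x)"
    by (rule Bochner_Integration.integrable_bound) (auto simp: case_prod_beta' split: split_indicator)
  from Fubini_integral[OF this]
  show "mean m (Z s) = (\<integral>r. indicator {t..s} r *\<^sub>R mean m (W r) \<partial>?\<mu>)"
    by (simp add: mean_def Z_def)
qed

text \<open>The control enters through an integral of its own because that integral exists only for almost every x.\<close>
definition response ::
  "(real \<Rightarrow> real^'n^'n) \<Rightarrow> (real \<Rightarrow> real^'n^'n) \<Rightarrow> (real \<Rightarrow> real^'n) \<Rightarrow> (real \<Rightarrow> real^'n \<Rightarrow> real^'d) \<Rightarrow> real \<Rightarrow> real^'n \<Rightarrow> real^'n" where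
  "response \<Phi> \<Psi> h V s x = \<Phi> s *v (Xt x + (\<integral>r. indicator {t..s} r *\<^sub>R (\<Psi> r *v (h r)) \<partial>leb_on t T)
     + (\<integral>r. indicator {t..s} r *\<^sub>R (\<Psi> r *v (G r *v V r x)) \<partial>leb_on t T))"

text \<open>The summands are a function of x, a function of time and a time primitive, each square
  integrable over the product, and \<Phi> is bounded. Taking means commutes with the time integral,
  so the mean obeys the same formula with \<open>mean m (V r)\<close> in place of
  \<open>V r x\<close>.\<close>

lemma response_inL2:
  assumes fp: "fundamental_pair t T F \<Phi> \<Psi>" and V: "V \<in> adm m t T" and h: "integrable (leb_on t T) h"
  shows "inL2 (leb_on t T \<Otimes>\<^sub>M m) (case_prod (response \<Phi> \<Psi> h V))"
    and "s \<in> {t..T} \<Longrightarrow> inL2 m (response \<Phi> \<Psi> h V s)"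
    and "s \<in> {t..T} \<Longrightarrow> mean m (response \<Phi> \<Psi> h V s)
      = \<Phi> s *v (mean m Xt + (\<integral>r. indicator {t..s} r *\<^sub>R (\<Psi> r *v (h r + G r *v mean m (V r))) \<partial>leb_on t T))"
proof -
  let ?\<mu> = "leb_on t T"
  have V2: "inL2 (?\<mu> \<Otimes>\<^sub>M m) (case_prod V)" using V by (simp add: adm_iff)
  have \<Phi>: "bdd_meas t T \<Phi>" and \<Psi>: "bdd_meas t T \<Psi>"
    using fp bdd_meas_ac_on by (auto simp: fundamental_pair_def)
  have ih: "integrable ?\<mu> (\<lambda>r. \<Psi> r *v h r)" by (rule fundamental_pair_integrable[OF fp h])
  define c where "c s = (\<integral>r. indicator {t..s} r *\<^sub>R (\<Psi> r *v (h r)) \<partial>?\<mu>)" for s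
  have c: "bdd_meas t T c" unfolding c_def by (rule bdd_meas_ac_on[OF ac_on_primitive[OF ih tT_le]])
  define W where "W r x = \<Psi> r *v (G r *v V r x)" for r x
  have W: "inL2 (?\<mu> \<Otimes>\<^sub>M m) (case_prod W)"
    unfolding W_def by (intro inL2_pair_bdd_mult V2 \<Psi> bdd)
  define Z where "Z s x = (\<integral>r. indicator {t..s} r *\<^sub>R W r x \<partial>?\<mu>)" for s x
  note Z = primitive_pair[OF W, folded Z_def]
  have eq: "response \<Phi> \<Psi> h V = (\<lambda>s x. \<Phi> s *v (Xt x + c s + Z s x))"
    by (simp add: response_def c_def Z_def W_def fun_eq_iff)
  have "inL2 (?\<mu> \<Otimes>\<^sub>M m) (\<lambda>z. (case z of (s, x) \<Rightarrow> Xt x) + (case z of (s, x) \<Rightarrow> c s) + case_prod Z z)"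
    by (intro inL2_add inL2_pair_fst inL2_pair_snd Xt_L2 Z bdd_meas_inL2[OF c])
  then have "inL2 (?\<mu> \<Otimes>\<^sub>M m) (case_prod (\<lambda>s x. Xt x + c s + Z s x))" by (simp add: case_prod_beta')
  then show "inL2 (?\<mu> \<Otimes>\<^sub>M m) (case_prod (response \<Phi> \<Psi> h V))"
    unfolding eq by (rule inL2_pair_bdd_mult[OF _ \<Phi>])
  assume s: "s \<in> {t..T}"
  have i: "inL2 m (\<lambda>x. Xt x + c s + Z s x)"
    by (intro inL2_add Xt_L2 Z(2)[OF s] inL2_const m.finite_measure_axioms)
  show "inL2 m (response \<Phi> \<Psi> h V s)"
    unfolding eq by (intro inL2_linear[OF _ i] bounded_bilinear.bounded_linear_right[OF bounded_bilinear_matrix_vector_mult])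
  have fin: "integrable m (\<lambda>x. Xt x + c s + Z s x)" "integrable m Xt" "integrable m (Z s)"
    using i Xt_L2 Z(2)[OF s] inL2_integrable[OF m.finite_measure_axioms] by auto
  have V': "AE r in ?\<mu>. inL2 m (V r)" by (rule inL2_pair_section(2)[OF V2])
  have Vm: "inL2 ?\<mu> (\<lambda>s. mean m (V s))" using inL2_mean[OF V2] by (simp add: m.prob_space)
  have iV: "integrable ?\<mu> (\<lambda>r. \<Psi> r *v (G r *v mean m (V r)))"
    by (intro inL2_integrable[OF a.finite_measure_axioms] bdd_meas_inL2_mult \<Psi> bdd Vm)
  have "mean m (response \<Phi> \<Psi> h V s) = \<Phi> s *v (mean m (\<lambda>x. Xt x + c s + Z s x))"
    unfolding eq mean_def
    by (rule integral_bounded_linear[OF bounded_bilinear.bounded_linear_right[OF bounded_bilinear_matrix_vector_mult] fin(1)])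
  also have "mean m (\<lambda>x. Xt x + c s + Z s x) = mean m Xt + c s + mean m (Z s)"
    using fin by (simp add: mean_def m.prob_space)
  also have "mean m (Z s) = (\<integral>r. indicator {t..s} r *\<^sub>R mean m (W r) \<partial>?\<mu>)" by (rule Z(3)[OF s])
  \<comment> \<open>The mean is moved past \<Psi> and G where \<open>V r\<close> is integrable over
    x, that is for almost every r.\<close>
  also have "\<dots> = (\<integral>r. indicator {t..s} r *\<^sub>R (\<Psi> r *v (G r *v mean m (V r))) \<partial>?\<mu>)"
  proof (rule integral_cong_AE)
    have "inL2 ?\<mu> (\<lambda>r. mean m (W r))" using inL2_mean[OF W] by (simp add: m.prob_space)
    then show "(\<lambda>r. indicator {t..s} r *\<^sub>R mean m (W r)) \<in> borel_measurable ?\<mu>"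
      by (intro borel_measurable_integrable integrable_indicator_leb_on inL2_integrable[OF a.finite_measure_axioms])
    show "(\<lambda>r. indicator {t..s} r *\<^sub>R (\<Psi> r *v (G r *v mean m (V r)))) \<in> borel_measurable ?\<mu>"
      by (intro borel_measurable_integrable integrable_indicator_leb_on iV)
    show "AE r in ?\<mu>. indicator {t..s} r *\<^sub>R mean m (W r) = indicator {t..s} r *\<^sub>R (\<Psi> r *v (G r *v mean m (V r)))"
      using V'
    proof eventually_elim
      case (elim r)
      have "integrable m (V r)" by (rule inL2_integrable[OF m.finite_measure_axioms elim])
      then have "mean m (W r) = (\<Psi> r ** G r) *v mean m (V r)"
        unfolding W_def mean_def matrix_vector_mul_assoc
        by (rule integral_bounded_linear[OF bounded_bilinear.bounded_linear_right[OF bounded_bilinear_matrix_vector_mult]])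
      then show ?case by (simp add: matrix_vector_mul_assoc)
    qed
  qed
  also have "mean m Xt + c s + \<dots> = mean m Xt + (\<integral>r. indicator {t..s} r *\<^sub>R (\<Psi> r *v (h r + G r *v mean m (V r))) \<partial>?\<mu>)"
    using integrable_indicator_leb_on[OF ih, of t s] integrable_indicator_leb_on[OF iV, of t s]
    by (simp add: c_def matrix_vector_linear_simps scaleR_add_right)
  finally show "mean m (response \<Phi> \<Psi> h V s)
      = \<Phi> s *v (mean m Xt + (\<integral>r. indicator {t..s} r *\<^sub>R (\<Psi> r *v (h r + G r *v mean m (V r))) \<partial>?\<mu>))" .
qed

text \<open>For an x whose control section is square integrable the two integrals merge, and the
  response becomes the variation of constants formula of the state equation with source h.\<close>

lemma response_eq:
  assumes fp: "fundamental_pair t T F \<Phi> \<Psi>" and h: "integrable (leb_on t T) h" and V: "inL2 (leb_on t T) (\<lambda>r. V r x)"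
  shows "response \<Phi> \<Psi> h V s x
    = \<Phi> s *v (Xt x + (\<integral>r. indicator {t..s} r *\<^sub>R (\<Psi> r *v (h r + G r *v V r x)) \<partial>leb_on t T))"
proof -
  have "integrable (leb_on t T) (\<lambda>r. G r *v V r x)"
    by (intro inL2_integrable[OF a.finite_measure_axioms] bdd_meas_inL2_mult bdd V)
  then show ?thesis
    using integrable_indicator_leb_on[OF fundamental_pair_integrable[OF fp h], of t s]
      integrable_indicator_leb_on[OF fundamental_pair_integrable[OF fp], of "\<lambda>r. G r *v V r x" t s]
    by (simp add: response_def matrix_vector_linear_simps scaleR_add_right add.assoc)
qed

abbreviation state :: "(real \<Rightarrow> real^'n \<Rightarrow> real^'d) \<Rightarrow> (real \<Rightarrow> real^'n \<Rightarrow> real^'n) \<Rightarrow> bool" where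
  "state V X \<equiv> is_state m F Fb G f t T Xt V X"

lemma state_iff:
  "state V X \<longleftrightarrow> (\<forall>s\<in>{t..T}. inL2 m (X s)) \<and>
    (AE x in m. ac_on t T (\<lambda>r. X r x) (\<lambda>r. F r *v X r x + Fb r *v mean m (X r) + G r *v V r x + f r) \<and> X t x = Xt x)"
  unfolding is_state_def fwd_sol_iff_ac_on[OF tT_le] ..

lemma fundamental_pair_bdd:
  fixes A :: "real \<Rightarrow> real^'n^'n"
  assumes "bdd_meas t T A" obtains \<Phi> \<Psi> where "fundamental_pair t T A \<Phi> \<Psi>"
proof -
  obtain C where "\<And>s. s \<in> {t..T} \<Longrightarrow> norm (A s) \<le> C" using bdd_meas_bound[OF assms] by metis
  then show ?thesis using fundamental_pair_exists[OF tT_le bdd_meas_measurable[OF assms]] that by blast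
qed

lemma f_integrable: "integrable (leb_on t T) f"
  by (rule inL2_integrable[OF a.finite_measure_axioms f_L2])

lemma mean_control_inL2: "V \<in> adm m t T \<Longrightarrow> inL2 (leb_on t T) (\<lambda>r. mean m (V r))"
  using inL2_mean by (auto simp: adm_iff m.prob_space)

lemma mean_cong_AE:
  fixes X Y :: "real^'n \<Rightarrow> 'a::euclidean_space"
  assumes "AE x in m. X x = Y x" "inL2 m X" "inL2 m Y" shows "mean m X = mean m Y"
  unfolding mean_def by (rule integral_cong_AE) (use assms inL2_measurable in auto)

text \<open>Supplies the joint measurability that the notion of a state leaves out. With the mean
  moved into the source h, almost every path is given by variation of constants, hence equals the
  response at all times, outside one null set of x that does not depend on s. The mean of the
  response is explicit, and this yields the equation for the mean.\<close>

lemma state_structure: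
  assumes V: "V \<in> adm m t T" and X: "state V X"
  obtains Y where "inL2 (leb_on t T \<Otimes>\<^sub>M m) (case_prod Y)" "\<And>s. s \<in> {t..T} \<Longrightarrow> inL2 m (Y s)"
    "AE x in m. \<forall>s\<in>{t..T}. X s x = Y s x"
    "ac_on t T (\<lambda>s. mean m (X s)) (\<lambda>r. (F r + Fb r) *v mean m (X r) + G r *v mean m (V r) + f r)"
    "mean m (X t) = mean m Xt"
proof -
  let ?\<mu> = "leb_on t T"
  obtain \<Phi> \<Psi> where fp: "fundamental_pair t T F \<Phi> \<Psi>" using fundamental_pair_bdd[OF bdd(1)] .
  have Vx: "AE x in m. inL2 ?\<mu> (\<lambda>r. V r x)" using V inL2_pair_section(1) by (simp add: adm_iff)
  have Xx: "AE x in m. ac_on t T (\<lambda>r. X r x) (\<lambda>r. F r *v X r x + Fb r *v mean m (X r) + G r *v V r x + f r) \<and> X t x = Xt x"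
    and X2: "\<And>s. s \<in> {t..T} \<Longrightarrow> inL2 m (X s)" using X by (auto simp: state_iff)
  define h where "h r = Fb r *v mean m (X r) + f r" for r
  \<comment> \<open>Measurability of the mean in time is not known beforehand. Along one good path,
    h is the integrable right side minus integrable terms; since h does not depend on x and m is a
    probability measure, one good x suffices.\<close>
  have h: "integrable ?\<mu> h"
  proof -
    have "AE x in m. integrable ?\<mu> h"
      using Vx Xx
    proof eventually_elim
      case (elim x)
      have "integrable ?\<mu> (\<lambda>r. G r *v V r x)"
        by (intro inL2_integrable[OF a.finite_measure_axioms] bdd_meas_inL2_mult bdd elim)
      moreover have "integrable ?\<mu> (\<lambda>r. F r *v X r x)"
        using elim by (intro bdd_meas_integrable bdd_meas_intros bdd bdd_meas_ac_on) auto
      ultimately have "integrable ?\<mu> (\<lambda>r. (F r *v X r x + Fb r *v mean m (X r) + G r *v V r x + f r) - G r *v V r x - F r *v X r x)"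
        using ac_on_integrable[OF conjunct1[OF elim(2)]] by (intro Bochner_Integration.integrable_diff)
      then show ?case by (simp add: h_def[abs_def] algebra_simps)
    qed
    then show ?thesis by simp
  qed
  let ?Y = "response \<Phi> \<Psi> h V"
  note Y = response_inL2[OF fp V h]
  have XY: "AE x in m. \<forall>s\<in>{t..T}. X s x = ?Y s x"
    using Vx Xx
  proof eventually_elim
    case (elim x)
    then have "ac_on t T (\<lambda>r. X r x) (\<lambda>r. F r *v X r x + (h r + G r *v V r x))" by (simp add: h_def algebra_simps)
    from variation_of_constants[OF fp this] show ?case
      using elim by (simp add: response_eq[OF fp h])
  qed
  \<comment> \<open>The source h contains the mean of X, so z satisfies the closed mean equation
    only once that mean has been identified with z.\<close>
  define z where "z = (\<lambda>s. \<Phi> s *v (mean m Xt + (\<integral>r. indicator {t..s} r *\<^sub>R (\<Psi> r *v (h r + G r *v mean m (V r))) \<partial>?\<mu>)))"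
  have mX: "mean m (X s) = z s"
    if s: "s \<in> {t..T}" for s
  proof -
    have "AE x in m. X s x = ?Y s x" using XY s by (auto elim: eventually_mono)
    from mean_cong_AE[OF this X2[OF s] Y(2)[OF s]] Y(3)[OF s] show ?thesis by (simp add: z_def)
  qed
  have hG: "integrable ?\<mu> (\<lambda>r. h r + G r *v mean m (V r))"
    by (intro Bochner_Integration.integrable_add h inL2_integrable[OF a.finite_measure_axioms] bdd_meas_inL2_mult bdd mean_control_inL2 V)
  have voc: "ac_on t T z (\<lambda>r. F r *v z r + (h r + G r *v mean m (V r)))" "z t = mean m Xt"
    unfolding z_def by (rule variation_of_constants_solves[OF tT_le fp hG])+
  have "mean m (X t) = mean m Xt" using voc(2) mX[of t] tT by simp
  moreover have "ac_on t T (\<lambda>s. mean m (X s)) (\<lambda>r. (F r + Fb r) *v mean m (X r) + G r *v mean m (V r) + f r)"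
    by (rule ac_on_cong[OF voc(1)]) (simp_all add: mX h_def matrix_vector_linear_simps algebra_simps)
  ultimately show ?thesis using that[of ?Y] Y XY by blast
qed

text \<open>The coupling acts through the mean alone, and the mean has a closed linear equation with
  drift F + Fb. Its solution is inserted as a source into the path equations, so no fixed point
  argument is needed; what has to be checked is that the resulting paths do have the inserted
  mean.\<close>

lemma state_exists:
  assumes V: "V \<in> adm m t T"
  shows "\<exists>X. state V X"
proof -
  let ?\<mu> = "leb_on t T"
  obtain \<Phi> \<Psi> where fp: "fundamental_pair t T F \<Phi> \<Psi>" using fundamental_pair_bdd[OF bdd(1)] .
  obtain \<Phi>' \<Psi>' where fp': "fundamental_pair t T (\<lambda>r. F r + Fb r) \<Phi>' \<Psi>'"
    using fundamental_pair_bdd[OF bdd_meas_add[OF bdd(1,2)]] .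
  have Vx: "AE x in m. inL2 ?\<mu> (\<lambda>r. V r x)" using V inL2_pair_section(1) by (simp add: adm_iff)
  have iG: "integrable ?\<mu> (\<lambda>r. G r *v mean m (V r))"
    by (intro inL2_integrable[OF a.finite_measure_axioms] bdd_meas_inL2_mult bdd mean_control_inL2 V)
  then have iGf: "integrable ?\<mu> (\<lambda>r. G r *v mean m (V r) + f r)" using f_integrable by simp
  define z where "z = (\<lambda>s. \<Phi>' s *v (mean m Xt + (\<integral>r. indicator {t..s} r *\<^sub>R (\<Psi>' r *v (G r *v mean m (V r) + f r)) \<partial>?\<mu>)))"
  have z: "ac_on t T z (\<lambda>r. (F r + Fb r) *v z r + (G r *v mean m (V r) + f r))" "z t = mean m Xt"
    unfolding z_def by (rule variation_of_constants_solves[OF tT_le fp' iGf])+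
  define h where "h r = Fb r *v z r + f r" for r
  have h: "integrable ?\<mu> h"
    unfolding h_def by (intro Bochner_Integration.integrable_add f_integrable bdd_meas_integrable bdd_meas_intros bdd bdd_meas_ac_on[OF z(1)])
  let ?Y = "response \<Phi> \<Psi> h V"
  note Y = response_inL2[OF fp V h]
  \<comment> \<open>Rewritten with drift F, the equation for z has the same solution formula as the
    mean of the response, so the inserted mean is the right one.\<close>
  have "ac_on t T z (\<lambda>r. F r *v z r + (h r + G r *v mean m (V r)))"
    using z(1) by (simp add: h_def matrix_vector_linear_simps algebra_simps)
  from variation_of_constants[OF fp this] have mY: "mean m (?Y s) = z s" if "s \<in> {t..T}" for s
    using Y(3)[OF that] that z(2) by simp
  have "AE x in m. ac_on t T (\<lambda>r. ?Y r x) (\<lambda>r. F r *v ?Y r x + Fb r *v mean m (?Y r) + G r *v V r x + f r) \<and> ?Y t x = Xt x"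
    using Vx
  proof eventually_elim
    case (elim x)
    have "integrable ?\<mu> (\<lambda>r. h r + G r *v V r x)"
      by (intro Bochner_Integration.integrable_add h inL2_integrable[OF a.finite_measure_axioms] bdd_meas_inL2_mult bdd elim)
    from variation_of_constants_solves[OF tT_le fp this, of "Xt x"]
    have *: "ac_on t T (\<lambda>s. ?Y s x) (\<lambda>r. F r *v ?Y r x + (h r + G r *v V r x))" "?Y t x = Xt x"
      by (simp_all add: response_eq[OF fp h, of V x, OF elim])
    have "ac_on t T (\<lambda>r. ?Y r x) (\<lambda>r. F r *v ?Y r x + Fb r *v mean m (?Y r) + G r *v V r x + f r)"
      by (rule ac_on_cong[OF *(1)]) (simp_all add: mY h_def algebra_simps)
    with *(2) show ?case by simp
  qed
  with Y(2) have "state V ?Y" by (simp add: state_iff)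
  then show ?thesis by blast
qed

end

section \<open>Completion of squares for the mean-field cost\<close>

declare transpose_matrix_vector [simp del]

text \<open>The cross terms are linear in the fluctuation, whose mean is zero. As K is an arbitrary
  matrix, they involve both K and its transpose applied to the mean.\<close>

lemma (in prob_space) quadratic_mean_decomposition:
  fixes X :: "'a \<Rightarrow> real^'n" and K :: "real^'n^'n"
  assumes X: "inL2 M X"
  shows "(\<integral>x. (K *v X x) \<bullet> X x \<partial>M)
    = (\<integral>x. (K *v (X x - mean M X)) \<bullet> (X x - mean M X) \<partial>M) + (K *v mean M X) \<bullet> mean M X"
proof -
  define c where "c = mean M X"
  define D where "D = (\<lambda>x. X x - c)"
  have D2: "inL2 M D" unfolding D_def by (intro inL2_diff X inL2_const finite_measure_axioms)
  have K2: "inL2 M (\<lambda>x. K *v D x)"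
    by (rule inL2_linear[OF bounded_bilinear.bounded_linear_right[OF bounded_bilinear_matrix_vector_mult] D2])
  have iX: "integrable M X" and iD: "integrable M D" using X D2 inL2_integrable[OF finite_measure_axioms] by auto
  have D0: "(\<integral>x. D x \<partial>M) = 0" using iX by (simp add: D_def c_def mean_def prob_space)
  have i1: "integrable M (\<lambda>x. (K *v D x) \<bullet> D x)" by (rule inL2_inner_integrable[OF K2 D2])
  have "(\<integral>x. (K *v X x) \<bullet> X x \<partial>M) = (\<integral>x. (K *v D x) \<bullet> D x + D x \<bullet> (transpose K *v c + K *v c) + (K *v c) \<bullet> c \<partial>M)"
  proof (rule Bochner_Integration.integral_cong[OF refl])
    fix x
    have "(K *v D x) \<bullet> c = D x \<bullet> (transpose K *v c)" by (metis inner_transpose inner_commute)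
    then show "(K *v X x) \<bullet> X x = (K *v D x) \<bullet> D x + D x \<bullet> (transpose K *v c + K *v c) + (K *v c) \<bullet> c"
      unfolding D_def
      by (simp add: matrix_vector_linear_simps inner_diff_left inner_diff_right inner_add_right inner_commute algebra_simps)
  qed
  also have "\<dots> = (\<integral>x. (K *v D x) \<bullet> D x \<partial>M) + (K *v c) \<bullet> c"
    using i1 iD D0 by (simp add: prob_space)
  finally show ?thesis by (simp add: D_def c_def)
qed

text \<open>The reason for two Riccati equations: B acts on the mean only and integrates to zero
  against the fluctuation, so the fluctuation sees the weight A and the mean the weight A +
  B.\<close>

lemma (in prob_space) innerL2_Mop:
  assumes X: "inL2 M X"
  shows "innerL2 M (Mop M A B X) X
    = (\<integral>x. (A *v (X x - mean M X)) \<bullet> (X x - mean M X) \<partial>M) + ((A + B) *v mean M X) \<bullet> mean M X"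
proof -
  have "inL2 M (\<lambda>x. A *v X x)"
    by (rule inL2_linear[OF bounded_bilinear.bounded_linear_right[OF bounded_bilinear_matrix_vector_mult] X])
  then have "integrable M (\<lambda>x. (A *v X x) \<bullet> X x)" "integrable M X"
    using X inL2_inner_integrable inL2_integrable[OF finite_measure_axioms] by auto
  then have "innerL2 M (Mop M A B X) X = (\<integral>x. (A *v X x) \<bullet> X x \<partial>M) + (B *v mean M X) \<bullet> mean M X"
    by (simp add: innerL2_def Mop_def inner_add_left mean_def)
  then show ?thesis
    by (simp add: quadratic_mean_decomposition[OF X, of A] matrix_vector_linear_simps inner_add_left)
qed

text \<open>\<open>A\<close> and \<open>B\<close> abstract the sum M + Mb and the matrix MbarS, and
  \<open>N'\<close> the inverse of N. Symmetry of P and \<Sigma> is assumed here and discharged from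
  the Riccati equations when the locale is interpreted.\<close>

locale mf_lq = mf_dynamics m F Fb G f t T Xt
  for m :: "(real^'n) measure" and F Fb :: "real \<Rightarrow> real^'n^'n" and G :: "real \<Rightarrow> real^'d^'n"
    and f :: "real \<Rightarrow> real^'n" and t T :: real and Xt :: "real^'n \<Rightarrow> real^'n" +
  fixes A B :: "real \<Rightarrow> real^'n^'n" and N N' :: "real \<Rightarrow> real^'d^'d"
    and \<alpha> :: "real \<Rightarrow> real^'n" and \<beta> :: "real \<Rightarrow> real^'d"
    and AT BT :: "real^'n^'n" and \<alpha>T :: "real^'n"
    and P \<Sigma> :: "real \<Rightarrow> real^'n^'n" and lam :: "real \<Rightarrow> real^'n"
  assumes cost_bdd: "bdd_meas t T A" "bdd_meas t T B" "bdd_meas t T N" "bdd_meas t T N'" "bdd_meas t T \<alpha>" "bdd_meas t T \<beta>"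
    and N_sym: "\<And>r. r \<in> {t..T} \<Longrightarrow> transpose (N r) = N r" "\<And>r. r \<in> {t..T} \<Longrightarrow> transpose (N' r) = N' r"
    and N_inv: "\<And>r. r \<in> {t..T} \<Longrightarrow> N r ** N' r = mat 1"
    and N_pd: "\<And>r v. r \<in> {t..T} \<Longrightarrow> v \<noteq> 0 \<Longrightarrow> 0 < (N r *v v) \<bullet> v"
    and P_ac: "ac_on t T P (\<lambda>r. - (P r ** F r + transpose (F r) ** P r
          - P r ** (G r ** N' r ** transpose (G r)) ** P r + A r))"
    and P_T: "P T = AT" and P_sym: "\<And>r. r \<in> {t..T} \<Longrightarrow> transpose (P r) = P r"
    and \<Sigma>_ac: "ac_on t T \<Sigma> (\<lambda>r. - (\<Sigma> r ** (F r + Fb r) + transpose (F r + Fb r) ** \<Sigma> r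
          - \<Sigma> r ** (G r ** N' r ** transpose (G r)) ** \<Sigma> r + (A r + B r)))"
    and \<Sigma>_T: "\<Sigma> T = AT + BT" and \<Sigma>_sym: "\<And>r. r \<in> {t..T} \<Longrightarrow> transpose (\<Sigma> r) = \<Sigma> r"
    and lam_ac: "ac_on t T lam (\<lambda>r. - ((transpose (F r + Fb r) - \<Sigma> r ** (G r ** N' r ** transpose (G r))) *v lam r + \<alpha> r
          + \<Sigma> r *v (f r - G r *v (N' r *v \<beta> r))))"
    and lam_T: "lam T = \<alpha>T"
begin

definition lq_cost :: "(real \<Rightarrow> real^'n \<Rightarrow> real^'n) \<Rightarrow> (real \<Rightarrow> real^'n \<Rightarrow> real^'d) \<Rightarrow> real" where
  "lq_cost X V = (\<integral>s. 1/2 * innerL2 m (Mop m (A s) (B s) (X s)) (X s)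
       + 1/2 * innerL2 m (\<lambda>x. N s *v V s x) (V s) + \<alpha> s \<bullet> mean m (X s) + \<beta> s \<bullet> mean m (V s) \<partial>leb_on t T)
     + 1/2 * innerL2 m (Mop m AT BT (X T)) (X T) + \<alpha>T \<bullet> mean m (X T)"

text \<open>P applied to the initial fluctuation plus \<Sigma> applied to the initial mean,
  regrouped as P on \<open>Xt\<close> plus \<Sigma> - P on the mean.\<close>

definition lq_value :: real where
  "lq_value = 1/2 * (\<integral>x. (P t *v Xt x) \<bullet> Xt x \<partial>m) + 1/2 * (((\<Sigma> t - P t) *v mean m Xt) \<bullet> mean m Xt)
     + lam t \<bullet> mean m Xt + ((\<integral>s. f s \<bullet> lam s \<partial>leb_on t T)
     - 1/2 * (\<integral>s. (N' s *v (transpose (G s) *v lam s + \<beta> s)) \<bullet> (transpose (G s) *v lam s + \<beta> s) \<partial>leb_on t T))"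

text \<open>Deviations of a control from the feedback law, for its mean and for its fluctuation around the mean.\<close>
definition dev_mean :: "(real \<Rightarrow> real^'n) \<Rightarrow> (real \<Rightarrow> real^'d) \<Rightarrow> real \<Rightarrow> real^'d" where
  "dev_mean xb vb s = vb s + N' s *v (transpose (G s) *v (\<Sigma> s *v xb s + lam s) + \<beta> s)"

definition dev_fluct ::
  "(real \<Rightarrow> real^'n \<Rightarrow> real^'n) \<Rightarrow> (real \<Rightarrow> real^'n) \<Rightarrow> (real \<Rightarrow> real^'n \<Rightarrow> real^'d) \<Rightarrow> (real \<Rightarrow> real^'d) \<Rightarrow> real \<Rightarrow> real^'n \<Rightarrow> real^'d" where
  "dev_fluct Y xb V vb s x = (V s x - vb s) + N' s *v (transpose (G s) *v (P s *v (Y s x - xb s)))"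

text \<open>An exact identity for every admissible control and every state of it, from which both
  the lower bound and the equality case are read off. The deviation of the fluctuation is formed
  with Y, because Fubini requires joint measurability; at each time X and Y agree for almost every
  x, so the cost does not see the replacement.\<close>

lemma lq_cost_identity:
  assumes V: "V \<in> adm m t T" and X: "state V X"
    and Y: "inL2 (leb_on t T \<Otimes>\<^sub>M m) (case_prod Y)" "\<And>s. s \<in> {t..T} \<Longrightarrow> inL2 m (Y s)"
    and XY: "AE x in m. \<forall>s\<in>{t..T}. X s x = Y s x"
    and Xb: "ac_on t T (\<lambda>s. mean m (X s)) (\<lambda>r. (F r + Fb r) *v mean m (X r) + G r *v mean m (V r) + f r)"
      "mean m (X t) = mean m Xt"
  defines "wb \<equiv> dev_mean (\<lambda>s. mean m (X s)) (\<lambda>s. mean m (V s))"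
    and "wt \<equiv> dev_fluct Y (\<lambda>s. mean m (X s)) V (\<lambda>s. mean m (V s))"
  shows "inL2 (leb_on t T) wb" "inL2 (leb_on t T \<Otimes>\<^sub>M m) (case_prod wt)"
    and "lq_cost X V = lq_value + 1/2 * (\<integral>(s, x). (N s *v wt s x) \<bullet> wt s x \<partial>(leb_on t T \<Otimes>\<^sub>M m))
      + 1/2 * (\<integral>s. (N s *v wb s) \<bullet> wb s \<partial>leb_on t T)"
proof -
  let ?\<mu> = "leb_on t T"
  define xb where "xb = (\<lambda>s. mean m (X s))"
  define vb where "vb = (\<lambda>s. mean m (V s))"
  define dX where "dX = (\<lambda>s x. Y s x - xb s)"
  define dV where "dV = (\<lambda>s x. V s x - vb s)"
  have Xb': "ac_on t T xb (\<lambda>r. (F r + Fb r) *v xb r + G r *v vb r + f r)" "xb t = mean m Xt"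
    using Xb by (simp_all add: xb_def vb_def)
  have V2: "inL2 (?\<mu> \<Otimes>\<^sub>M m) (case_prod V)" using V by (simp add: adm_iff)
  have vb2: "inL2 ?\<mu> vb" unfolding vb_def by (rule mean_control_inL2[OF V])
  have xbb: "bdd_meas t T xb" unfolding xb_def by (rule bdd_meas_ac_on[OF Xb(1)])
  have xb2: "inL2 ?\<mu> xb" by (rule bdd_meas_inL2[OF xbb])
  have X2: "inL2 m (X s)" if "s \<in> {t..T}" for s using X that by (simp add: state_iff)
  have XYs: "AE x in m. X s x = Y s x" if "s \<in> {t..T}" for s using XY by (rule eventually_mono) (use that in auto)
  have dX2: "inL2 (?\<mu> \<Otimes>\<^sub>M m) (case_prod dX)"
    using inL2_diff[OF Y(1) inL2_pair_fst[OF xb2]] by (simp add: dX_def case_prod_beta')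
  have dV2: "inL2 (?\<mu> \<Otimes>\<^sub>M m) (case_prod dV)"
    using inL2_diff[OF V2 inL2_pair_fst[OF vb2]] by (simp add: dV_def case_prod_beta')
  have dX2s: "inL2 m (dX s)" if "s \<in> {t..T}" for s
    unfolding dX_def by (intro inL2_diff Y(2)[OF that] inL2_const m.finite_measure_axioms)
  have Pb: "bdd_meas t T P" and \<Sigma>b: "bdd_meas t T \<Sigma>" by (rule bdd_meas_ac_on[OF P_ac] bdd_meas_ac_on[OF \<Sigma>_ac])+
  have wt_eq: "wt = (\<lambda>s x. dV s x + (N' s ** transpose (G s) ** P s) *v dX s x)"
    by (simp add: wt_def dev_fluct_def dV_def dX_def xb_def vb_def matrix_vector_mul_assoc matrix_mul_assoc fun_eq_iff)
  have "inL2 (?\<mu> \<Otimes>\<^sub>M m) (\<lambda>z. case_prod dV z + (\<lambda>(s, x). (N' s ** transpose (G s) ** P s) *v dX s x) z)"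
    by (intro inL2_add dV2 inL2_pair_bdd_mult dX2 bdd_meas_intros cost_bdd bdd Pb)
  then show wt2: "inL2 (?\<mu> \<Otimes>\<^sub>M m) (case_prod wt)" by (simp add: wt_eq case_prod_beta')
  have i_pair: "integrable (?\<mu> \<Otimes>\<^sub>M m) (\<lambda>(s, x). (K s *v W s x) \<bullet> W s x)"
    if "inL2 (?\<mu> \<Otimes>\<^sub>M m) (case_prod W)" "bdd_meas t T K" for K :: "real \<Rightarrow> real^'k^'k" and W
    using inL2_inner_integrable[OF inL2_pair_bdd_mult[OF that] that(1)] by (simp add: case_prod_beta')
  note iA = i_pair[OF dX2 cost_bdd(1)] and iN = i_pair[OF dV2 cost_bdd(3)] and iNV = i_pair[OF V2 cost_bdd(3)]
    and iW = i_pair[OF wt2 cost_bdd(3)]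

  \<comment> \<open>the mean follows a deterministic problem with weight A + B and Riccati solution \<open>\<Sigma>\<close>\<close>
  have wb_eq: "wb = (\<lambda>r. vb r + N' r *v (transpose (G r) *v (\<Sigma> r *v xb r + lam r) + \<beta> r))"
    by (simp add: wb_def dev_mean_def xb_def vb_def fun_eq_iff)
  note LQb = lq_completion_of_squares[OF tT_le Xb'(1) \<Sigma>_ac lam_ac \<Sigma>_sym N_sym N_inv bdd(3) cost_bdd(3,4,6) f_L2 vb2]
  show "inL2 ?\<mu> wb" unfolding wb_eq by (rule LQb(1))
  define C where "C = (\<integral>r. 1/2 * (((A r + B r) *v xb r) \<bullet> xb r) + 1/2 * ((N r *v vb r) \<bullet> vb r) + \<alpha> r \<bullet> xb r + \<beta> r \<bullet> vb r \<partial>?\<mu>)"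
  have mean_part: "C + 1/2 * (((AT + BT) *v xb T) \<bullet> xb T) + \<alpha>T \<bullet> xb T
      = 1/2 * ((\<Sigma> t *v mean m Xt) \<bullet> mean m Xt) + lam t \<bullet> mean m Xt + (\<integral>s. f s \<bullet> lam s \<partial>?\<mu>)
     - 1/2 * (\<integral>s. (N' s *v (transpose (G s) *v lam s + \<beta> s)) \<bullet> (transpose (G s) *v lam s + \<beta> s) \<partial>?\<mu>)
     + 1/2 * (\<integral>s. (N s *v wb s) \<bullet> wb s \<partial>?\<mu>)"
    unfolding C_def wb_eq using LQb(2) by (simp add: \<Sigma>_T lam_T Xb'(2))

  have iC: "integrable ?\<mu> (\<lambda>r. ((A r + B r) *v xb r) \<bullet> xb r)" "integrable ?\<mu> (\<lambda>r. \<alpha> r \<bullet> xb r)"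
    "integrable ?\<mu> (\<lambda>r. \<beta> r \<bullet> vb r)" "integrable ?\<mu> (\<lambda>r. (N r *v vb r) \<bullet> vb r)"
    by (intro bdd_meas_integrable bdd_meas_intros cost_bdd xbb inL2_inner_integrable bdd_meas_inL2[OF cost_bdd(6)] bdd_meas_inL2_mult vb2)+
  \<comment> \<open>Splits the state cost at a fixed time and replaces X by Y, which changes the
    integrand only on a null set of x.\<close>
  have Mop_eq: "innerL2 m (Mop m K L (X s)) (X s) = (\<integral>x. (K *v dX s x) \<bullet> dX s x \<partial>m) + ((K + L) *v xb s) \<bullet> xb s"
    if s: "s \<in> {t..T}" for s K L
  proof -
    have "inL2 m (\<lambda>x. X s x - xb s)" by (intro inL2_diff X2[OF s] inL2_const m.finite_measure_axioms)
    then have "(\<lambda>x. (K *v (X s x - xb s)) \<bullet> (X s x - xb s)) \<in> borel_measurable m"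
      by (intro borel_measurable_integrable inL2_inner_integrable inL2_linear[OF bounded_bilinear.bounded_linear_right[OF bounded_bilinear_matrix_vector_mult]])
    moreover have "(\<lambda>x. (K *v dX s x) \<bullet> dX s x) \<in> borel_measurable m"
      by (intro borel_measurable_integrable inL2_inner_integrable inL2_linear[OF bounded_bilinear.bounded_linear_right[OF bounded_bilinear_matrix_vector_mult]] dX2s s)
    ultimately have "(\<integral>x. (K *v (X s x - xb s)) \<bullet> (X s x - xb s) \<partial>m) = (\<integral>x. (K *v dX s x) \<bullet> dX s x \<partial>m)"
      using XYs[OF s] by (intro integral_cong_AE) (auto simp: dX_def elim: eventually_mono)
    then show ?thesis using m.innerL2_Mop[OF X2[OF s], of K L] by (simp add: xb_def)
  qed
  \<comment> \<open>Unlike the state, \<open>V s\<close> is square integrable for almost every s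
    only, so the control cost is split almost everywhere in time.\<close>
  have V_split: "(\<integral>s. innerL2 m (\<lambda>x. N s *v V s x) (V s) \<partial>?\<mu>)
      = (\<integral>s. (\<integral>x. (N s *v dV s x) \<bullet> dV s x \<partial>m) \<partial>?\<mu>) + (\<integral>s. (N s *v vb s) \<bullet> vb s \<partial>?\<mu>)"
  proof -
    have "(\<integral>s. innerL2 m (\<lambda>x. N s *v V s x) (V s) \<partial>?\<mu>) = (\<integral>s. (\<integral>x. (N s *v dV s x) \<bullet> dV s x \<partial>m) + (N s *v vb s) \<bullet> vb s \<partial>?\<mu>)"
    proof (rule integral_cong_AE)
      show "(\<lambda>s. innerL2 m (\<lambda>x. N s *v V s x) (V s)) \<in> borel_measurable ?\<mu>"
        unfolding innerL2_def by (rule borel_measurable_integrable[OF integrable_fst[OF iNV]])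
      show "(\<lambda>s. (\<integral>x. (N s *v dV s x) \<bullet> dV s x \<partial>m) + (N s *v vb s) \<bullet> vb s) \<in> borel_measurable ?\<mu>"
        by (intro borel_measurable_integrable Bochner_Integration.integrable_add integrable_fst[OF iN] iC)
      show "AE s in ?\<mu>. innerL2 m (\<lambda>x. N s *v V s x) (V s) = (\<integral>x. (N s *v dV s x) \<bullet> dV s x \<partial>m) + (N s *v vb s) \<bullet> vb s"
        using inL2_pair_section(2)[OF V2]
        by (rule eventually_mono) (simp add: innerL2_def dV_def vb_def m.quadratic_mean_decomposition[of "V _"])
    qed
    also have "\<dots> = (\<integral>s. (\<integral>x. (N s *v dV s x) \<bullet> dV s x \<partial>m) \<partial>?\<mu>) + (\<integral>s. (N s *v vb s) \<bullet> vb s \<partial>?\<mu>)"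
      by (intro Bochner_Integration.integral_add integrable_fst[OF iN] iC)
    finally show ?thesis .
  qed
  have iNV': "integrable ?\<mu> (\<lambda>s. innerL2 m (\<lambda>x. N s *v V s x) (V s))"
    unfolding innerL2_def by (rule integrable_fst[OF iNV])
  define E1 where "E1 = (\<integral>s. (\<integral>x. (A s *v dX s x) \<bullet> dX s x \<partial>m) \<partial>?\<mu>)"
  define E2 where "E2 = (\<integral>s. (\<integral>x. (N s *v dV s x) \<bullet> dV s x \<partial>m) \<partial>?\<mu>)"
  define ET where "ET = (\<integral>x. (AT *v dX T x) \<bullet> dX T x \<partial>m)"
  have run: "(\<integral>s. 1/2 * innerL2 m (Mop m (A s) (B s) (X s)) (X s)
       + 1/2 * innerL2 m (\<lambda>x. N s *v V s x) (V s) + \<alpha> s \<bullet> mean m (X s) + \<beta> s \<bullet> mean m (V s) \<partial>?\<mu>) = 1/2 * E1 + 1/2 * E2 + C"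
  proof -
    have "(\<integral>s. 1/2 * innerL2 m (Mop m (A s) (B s) (X s)) (X s)
       + 1/2 * innerL2 m (\<lambda>x. N s *v V s x) (V s) + \<alpha> s \<bullet> mean m (X s) + \<beta> s \<bullet> mean m (V s) \<partial>?\<mu>)
       = (\<integral>s. (1/2 * (\<integral>x. (A s *v dX s x) \<bullet> dX s x \<partial>m) + 1/2 * (((A s + B s) *v xb s) \<bullet> xb s))
       + 1/2 * innerL2 m (\<lambda>x. N s *v V s x) (V s) + \<alpha> s \<bullet> xb s + \<beta> s \<bullet> vb s \<partial>?\<mu>)"
      by (rule Bochner_Integration.integral_cong[OF refl]) (simp add: Mop_eq distrib_left xb_def vb_def)
    also have "\<dots> = 1/2 * E1 + 1/2 * (\<integral>s. ((A s + B s) *v xb s) \<bullet> xb s \<partial>?\<mu>)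
      + 1/2 * (\<integral>s. innerL2 m (\<lambda>x. N s *v V s x) (V s) \<partial>?\<mu>) + (\<integral>s. \<alpha> s \<bullet> xb s \<partial>?\<mu>) + (\<integral>s. \<beta> s \<bullet> vb s \<partial>?\<mu>)"
      using iC iNV' integrable_fst[OF iA] by (simp add: E1_def)
    also have "\<dots> = 1/2 * E1 + 1/2 * E2 + C"
      unfolding V_split C_def using iC by (simp add: E2_def)
    finally show ?thesis .
  qed
  have cost: "lq_cost X V = 1/2 * E1 + 1/2 * E2 + 1/2 * ET + (C + 1/2 * (((AT + BT) *v xb T) \<bullet> xb T) + \<alpha>T \<bullet> xb T)"
    unfolding lq_cost_def run using Mop_eq[of T AT BT] tT by (simp add: ET_def xb_def)

  \<comment> \<open>for almost every x the fluctuation solves a homogeneous problem with Riccati solution P\<close>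
  have fluct: "AE x in m. 1/2 * (\<integral>s. (A s *v dX s x) \<bullet> dX s x \<partial>?\<mu>) + 1/2 * (\<integral>s. (N s *v dV s x) \<bullet> dV s x \<partial>?\<mu>)
      + 1/2 * ((AT *v dX T x) \<bullet> dX T x)
    = 1/2 * ((P t *v (Xt x - mean m Xt)) \<bullet> (Xt x - mean m Xt)) + 1/2 * (\<integral>s. (N s *v wt s x) \<bullet> wt s x \<partial>?\<mu>)"
    using conjunct2[OF X[unfolded state_iff]] XY inL2_pair_section(1)[OF dV2]
      AE_integrable_snd[OF iA] AE_integrable_snd[OF iN]
  proof eventually_elim
    case (elim x)
    \<comment> \<open>Subtracting the mean equation cancels the terms with Fb and f and leaves drift
      F without a source.\<close>
    have dx: "ac_on t T (\<lambda>s. dX s x) (\<lambda>r. F r *v dX r x + G r *v dV r x + 0)"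
      by (rule ac_on_cong[OF ac_on_diff[OF conjunct1[OF elim(1)] Xb'(1)]])
        (use elim(2) in \<open>simp_all add: dX_def dV_def xb_def vb_def matrix_vector_linear_simps algebra_simps\<close>)
    \<comment> \<open>With neither a source nor a linear cost, the equation for the linear part of
      the value is solved by 0.\<close>
    have l: "ac_on t T (\<lambda>_. 0) (\<lambda>r. - ((transpose (F r) - P r ** (G r ** N' r ** transpose (G r))) *v 0 + 0
        + P r *v (0 - G r *v (N' r *v 0))))"
      using ac_on_const[of t T "0 :: real^'n"] by (simp add: matrix_vector_linear_simps)
    have "dX t x = Xt x - mean m Xt" using elim(1,2) tT Xb'(2) by (auto simp: dX_def)
    then show ?case
      using lq_completion_of_squares(2)[OF tT_le dx P_ac l P_sym N_sym N_inv bdd(3) cost_bdd(3,4) bdd_meas_const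
          inL2_const[OF finite_measure_leb_on] elim(3)] elim(4,5)
      by (simp add: matrix_vector_linear_simps P_T wt_eq matrix_vector_mul_assoc matrix_mul_assoc)
  qed
  have iET: "integrable m (\<lambda>x. (AT *v dX T x) \<bullet> dX T x)"
    using tT by (intro inL2_inner_integrable inL2_linear[OF bounded_bilinear.bounded_linear_right[OF bounded_bilinear_matrix_vector_mult]] dX2s) auto
  have dXt2: "inL2 m (\<lambda>x. Xt x - mean m Xt)" by (intro inL2_diff Xt_L2 inL2_const m.finite_measure_axioms)
  have iPt: "integrable m (\<lambda>x. (P t *v (Xt x - mean m Xt)) \<bullet> (Xt x - mean m Xt))"
    by (intro inL2_inner_integrable inL2_linear[OF bounded_bilinear.bounded_linear_right[OF bounded_bilinear_matrix_vector_mult]] dXt2)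
  have "(\<integral>x. 1/2 * (\<integral>s. (A s *v dX s x) \<bullet> dX s x \<partial>?\<mu>) + 1/2 * (\<integral>s. (N s *v dV s x) \<bullet> dV s x \<partial>?\<mu>)
      + 1/2 * ((AT *v dX T x) \<bullet> dX T x) \<partial>m)
    = (\<integral>x. 1/2 * ((P t *v (Xt x - mean m Xt)) \<bullet> (Xt x - mean m Xt)) + 1/2 * (\<integral>s. (N s *v wt s x) \<bullet> wt s x \<partial>?\<mu>) \<partial>m)"
    using integrable_snd[OF iA] integrable_snd[OF iN] integrable_snd[OF iW] iET iPt
    by (intro integral_cong_AE fluct) auto
  then have "1/2 * E1 + 1/2 * E2 + 1/2 * ET = 1/2 * (\<integral>x. (P t *v (Xt x - mean m Xt)) \<bullet> (Xt x - mean m Xt) \<partial>m)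
      + 1/2 * (\<integral>(s, x). (N s *v wt s x) \<bullet> wt s x \<partial>(?\<mu> \<Otimes>\<^sub>M m))"
    using integrable_snd[OF iA] integrable_snd[OF iN] integrable_snd[OF iW] iET iPt
      Fubini_integral[OF iA] Fubini_integral[OF iN] integral_snd[OF iW]
    by (simp add: E1_def E2_def ET_def)
  then show "lq_cost X V = lq_value + 1/2 * (\<integral>(s, x). (N s *v wt s x) \<bullet> wt s x \<partial>(?\<mu> \<Otimes>\<^sub>M m))
      + 1/2 * (\<integral>s. (N s *v wb s) \<bullet> wb s \<partial>?\<mu>)"
    unfolding cost mean_part lq_value_def
    using m.quadratic_mean_decomposition[OF Xt_L2, of "P t"]
    by (simp add: matrix_vector_linear_simps inner_diff_left field_simps)
qed

end

section \<open>The closed loop and optimality\<close>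

context mf_dynamics begin

lemma linear_ac_unique:
  fixes A :: "real \<Rightarrow> real^'n^'n"
  assumes A: "bdd_meas t T A" and y: "ac_on t T y (\<lambda>r. A r *v y r + h r)" and z: "ac_on t T z (\<lambda>r. A r *v z r + h r)"
    and "y t = z t" and s: "s \<in> {t..T}"
  shows "y s = z s"
proof -
  obtain \<Phi> \<Psi> where fp: "fundamental_pair t T A \<Phi> \<Psi>" using fundamental_pair_bdd[OF A] .
  show ?thesis using variation_of_constants[OF fp y s] variation_of_constants[OF fp z s] \<open>y t = z t\<close> by simp
qed

lemma state_mean:
  assumes V: "V \<in> adm m t T" and X: "state V X"
  shows "ac_on t T (\<lambda>s. mean m (X s)) (\<lambda>r. (F r + Fb r) *v mean m (X r) + (G r *v mean m (V r) + f r))"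
    and "mean m (X t) = mean m Xt"
  by (rule state_structure[OF V X]; simp add: add.assoc)+

text \<open>The means agree by uniqueness for the closed mean equation; once the mean is fixed,
  almost every path solves a linear equation of its own. This is what makes the choice of a state in
  the payoff harmless.\<close>

lemma state_unique:
  assumes V: "V \<in> adm m t T" and X: "state V X" and Z: "state V Z"
  shows "s \<in> {t..T} \<Longrightarrow> mean m (X s) = mean m (Z s)" "AE x in m. \<forall>s\<in>{t..T}. X s x = Z s x"
proof -
  note mX = state_mean[OF V X] and mZ = state_mean[OF V Z]
  show m: "mean m (X s) = mean m (Z s)" if "s \<in> {t..T}" for s
    using linear_ac_unique[OF bdd_meas_add[OF bdd(1,2)] mX(1) mZ(1) _ that] mX(2) mZ(2) by simp
  show "AE x in m. \<forall>s\<in>{t..T}. X s x = Z s x"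
    using conjunct2[OF X[unfolded state_iff]] conjunct2[OF Z[unfolded state_iff]]
  proof eventually_elim
    case (elim x)
    have 1: "ac_on t T (\<lambda>r. X r x) (\<lambda>r. F r *v X r x + (Fb r *v mean m (X r) + G r *v V r x + f r))"
      by (rule ac_on_cong[OF conjunct1[OF elim(1)]]) (simp_all add: add.assoc)
    have 2: "ac_on t T (\<lambda>r. Z r x) (\<lambda>r. F r *v Z r x + (Fb r *v mean m (X r) + G r *v V r x + f r))"
      by (rule ac_on_cong[OF conjunct1[OF elim(2)]]) (simp_all add: add.assoc m)
    show ?case using linear_ac_unique[OF bdd(1) 1 2] elim by auto
  qed
qed

text \<open>One null set of x serves all times, so the exceptional set is contained in a product
  null set. It has to be measurable because the product measure need not be complete.\<close>

lemma AE_pairI_snd: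
  assumes "{z \<in> space (leb_on t T \<Otimes>\<^sub>M m). Q z} \<in> sets (leb_on t T \<Otimes>\<^sub>M m)"
    and ae: "AE x in m. \<forall>s\<in>{t..T}. Q (s, x)"
  shows "AE z in leb_on t T \<Otimes>\<^sub>M m. Q z"
  by (rule AE_pair_measure[OF assms(1)], rule AE_I2, rule eventually_mono[OF ae]) simp

end

lemma sets_Collect_eq_borel:
  fixes f g :: "'x \<Rightarrow> 'a::euclidean_space"
  assumes "f \<in> borel_measurable \<mu>" "g \<in> borel_measurable \<mu>"
  shows "{x \<in> space \<mu>. f x = g x} \<in> sets \<mu>"
proof -
  have "(\<lambda>x. f x - g x) -` {0} \<inter> space \<mu> \<in> sets \<mu>"
    by (rule measurable_sets[OF borel_measurable_diff[OF assms]]) simp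
  also have "(\<lambda>x. f x - g x) -` {0} \<inter> space \<mu> = {x \<in> space \<mu>. f x = g x}" by auto
  finally show ?thesis .
qed

lemma inL2_cong:
  assumes "\<And>x. x \<in> space \<mu> \<Longrightarrow> X x = Y x" shows "inL2 \<mu> X \<longleftrightarrow> inL2 \<mu> Y"
  unfolding inL2_def using assms
  by (intro arg_cong2[where f = "(\<and>)"] measurable_cong Bochner_Integration.integrable_cong) auto

context mf_lq begin

lemma N_nonneg: "r \<in> {t..T} \<Longrightarrow> 0 \<le> (N r *v v) \<bullet> v"
  using N_pd[of r v] by (cases "v = 0") auto

lemma N_quadratic_zero: "r \<in> {t..T} \<Longrightarrow> (N r *v v) \<bullet> v = 0 \<Longrightarrow> v = 0"
  using N_pd[of r v] by auto

lemma dev_terms_nonneg: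
  "0 \<le> (\<integral>(s, x). (N s *v wt s x) \<bullet> wt s x \<partial>(leb_on t T \<Otimes>\<^sub>M m))" "0 \<le> (\<integral>s. (N s *v wb s) \<bullet> wb s \<partial>leb_on t T)"
  by (intro integral_nonneg_AE AE_I2; auto simp: space_pair_measure N_nonneg)+

lemma lq_value_le_cost:
  assumes "V \<in> adm m t T" "state V X" shows "lq_value \<le> lq_cost X V"
proof (rule state_structure[OF assms])
  fix Y
  assume Y: "inL2 (leb_on t T \<Otimes>\<^sub>M m) (case_prod Y)" "\<And>s. s \<in> {t..T} \<Longrightarrow> inL2 m (Y s)"
    "AE x in m. \<forall>s\<in>{t..T}. X s x = Y s x"
    "ac_on t T (\<lambda>s. mean m (X s)) (\<lambda>r. (F r + Fb r) *v mean m (X r) + G r *v mean m (V r) + f r)"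
    "mean m (X t) = mean m Xt"
  show ?thesis
    using lq_cost_identity(3)[OF assms Y] dev_terms_nonneg(1)[of "dev_fluct Y (\<lambda>s. mean m (X s)) V (\<lambda>s. mean m (V s))"]
      dev_terms_nonneg(2)[of "dev_mean (\<lambda>s. mean m (X s)) (\<lambda>s. mean m (V s))"] by linarith
qed

text \<open>The feedback of the mean and that of the fluctuation add up through \<Sigma> xb + P (Y -
  xb) = P Y + (\<Sigma> - P) xb.\<close>

lemma dev_zero_feedback:
  assumes "dev_mean xb vb s = 0" "dev_fluct Y xb V vb s x = 0"
  shows "V s x = - (N' s *v (transpose (G s) *v (P s *v Y s x + (\<Sigma> s - P s) *v xb s)))
     - N' s *v (transpose (G s) *v lam s + \<beta> s)"
proof -
  have "vb s = - (N' s *v (transpose (G s) *v (\<Sigma> s *v xb s + lam s) + \<beta> s))"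
    using assms(1) by (simp add: dev_mean_def eq_neg_iff_add_eq_0)
  moreover have "V s x = vb s - N' s *v (transpose (G s) *v (P s *v (Y s x - xb s)))"
    using assms(2) by (simp add: dev_fluct_def algebra_simps)
  ultimately show ?thesis by (simp add: matrix_vector_linear_simps)
qed

end

section \<open>The feedback control, its state and its optimality\<close>

locale mf_closed_loop = mf_lq m F Fb G f t T Xt A B N N' \<alpha> \<beta> AT BT \<alpha>T P \<Sigma> lam
  for m :: "(real^'n) measure" and F Fb and G :: "real \<Rightarrow> real^'d^'n" and f t T Xt A B N N' \<alpha> \<beta> AT BT \<alpha>T P \<Sigma> lam +
  fixes Xhb :: "real \<Rightarrow> real^'n" and Xh :: "real \<Rightarrow> real^'n \<Rightarrow> real^'n"
  assumes Xhb: "ac_on t T Xhb (\<lambda>r. (F r + Fb r - G r ** N' r ** transpose (G r) ** \<Sigma> r) *v Xhb r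
      - G r *v (N' r *v (transpose (G r) *v lam r + \<beta> r)) + f r)" "Xhb t = mean m Xt"
    and Xh: "\<And>x. ac_on t T (\<lambda>r. Xh r x) (\<lambda>r. (F r - G r ** N' r ** transpose (G r) ** P r) *v Xh r x
      + (Fb r - G r ** N' r ** transpose (G r) ** (\<Sigma> r - P r)) *v Xhb r
      - G r *v (N' r *v (transpose (G r) *v lam r + \<beta> r)) + f r)" "\<And>x. Xh t x = Xt x"
begin

definition Vh :: "real \<Rightarrow> real^'n \<Rightarrow> real^'d" where
  "Vh s x = - (N' s *v (transpose (G s) *v (P s *v Xh s x + (\<Sigma> s - P s) *v Xhb s)))
     - N' s *v (transpose (G s) *v lam s + \<beta> s)"

lemmas closed_loop_bdd = bdd cost_bdd bdd_meas_ac_on[OF P_ac] bdd_meas_ac_on[OF \<Sigma>_ac] bdd_meas_ac_on[OF lam_ac]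
  bdd_meas_ac_on[OF Xhb(1)]

definition cl_drift :: "real \<Rightarrow> real^'n^'n" where
  "cl_drift r = F r - G r ** N' r ** transpose (G r) ** P r"

definition cl_source :: "real \<Rightarrow> real^'n" where
  "cl_source r = (Fb r - G r ** N' r ** transpose (G r) ** (\<Sigma> r - P r)) *v Xhb r
      - G r *v (N' r *v (transpose (G r) *v lam r + \<beta> r)) + f r"

lemma cl_drift_bdd: "bdd_meas t T cl_drift"
  unfolding cl_drift_def[abs_def] by (intro bdd_meas_intros closed_loop_bdd)

lemma cl_source_integrable: "integrable (leb_on t T) cl_source"
  unfolding cl_source_def[abs_def]
  by (intro Bochner_Integration.integrable_add f_integrable bdd_meas_integrable bdd_meas_intros closed_loop_bdd)

lemma Xh_cl: "ac_on t T (\<lambda>r. Xh r x) (\<lambda>r. cl_drift r *v Xh r x + cl_source r)"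
  using Xh(1)[of x] by (simp add: cl_drift_def cl_source_def algebra_simps)

text \<open>With R for the product of G, N' and the transpose of G, the drift F + Fb - R \<Sigma> is
  the sum of F - R P and Fb - R (\<Sigma> - P). The equation of the mean is therefore the path
  equation started at the mean, and one fundamental matrix serves both.\<close>

lemma Xhb_cl: "ac_on t T Xhb (\<lambda>r. cl_drift r *v Xhb r + cl_source r)"
  by (rule ac_on_cong[OF Xhb(1)])
    (simp_all add: cl_drift_def cl_source_def matrix_vector_linear_simps matrix_mult_linear_simps algebra_simps)

text \<open>Closed loop paths are affine in the initial point with the same coefficients for every
  x, so square integrability, joint measurability and the mean of \<open>Xh\<close> are inherited
  from \<open>Xt\<close>.\<close>

lemma Xh_affine:
  obtains \<Phi> c where "bdd_meas t T \<Phi>" "bdd_meas t T c"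
    "\<And>s x. s \<in> {t..T} \<Longrightarrow> Xh s x = \<Phi> s *v (Xt x + c s)" "\<And>s. s \<in> {t..T} \<Longrightarrow> Xhb s = \<Phi> s *v (mean m Xt + c s)"
proof -
  obtain \<Phi> \<Psi> where fp: "fundamental_pair t T cl_drift \<Phi> \<Psi>" using fundamental_pair_bdd[OF cl_drift_bdd] .
  show ?thesis
  proof (rule that)
    show "bdd_meas t T \<Phi>" using fp by (auto simp: fundamental_pair_def intro: bdd_meas_ac_on)
    show "bdd_meas t T (\<lambda>s. \<integral>r. indicator {t..s} r *\<^sub>R (\<Psi> r *v cl_source r) \<partial>leb_on t T)"
      by (rule bdd_meas_ac_on[OF ac_on_primitive[OF fundamental_pair_integrable[OF fp cl_source_integrable] tT_le]])
  qed (use variation_of_constants[OF fp Xh_cl] variation_of_constants[OF fp Xhb_cl] Xh(2) Xhb(2) in simp_all)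
qed

lemma Xh_inL2: "s \<in> {t..T} \<Longrightarrow> inL2 m (Xh s)"
  and mean_Xh: "s \<in> {t..T} \<Longrightarrow> mean m (Xh s) = Xhb s"
  and Xh_pair_inL2: "inL2 (leb_on t T \<Otimes>\<^sub>M m) (case_prod Xh)"
proof -
  obtain \<Phi> c where \<Phi>: "bdd_meas t T \<Phi>" and c: "bdd_meas t T c"
    and X: "\<And>s x. s \<in> {t..T} \<Longrightarrow> Xh s x = \<Phi> s *v (Xt x + c s)" and Xb: "\<And>s. s \<in> {t..T} \<Longrightarrow> Xhb s = \<Phi> s *v (mean m Xt + c s)"
    using Xh_affine by metis
  have i: "inL2 m (\<lambda>x. Xt x + c s)" for s by (intro inL2_add Xt_L2 inL2_const m.finite_measure_axioms)
  note bl = bounded_bilinear.bounded_linear_right[OF bounded_bilinear_matrix_vector_mult]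
  show "inL2 m (Xh s)" if "s \<in> {t..T}" for s
    using inL2_linear[OF bl i] by (simp add: X[OF that, abs_def])
  show "mean m (Xh s) = Xhb s" if "s \<in> {t..T}" for s
  proof -
    have "integrable m (\<lambda>x. Xt x + c s)" "integrable m Xt"
      using inL2_integrable[OF m.finite_measure_axioms] i Xt_L2 by auto
    then show ?thesis
      unfolding mean_def Xb[OF that] X[OF that, abs_def]
      by (subst integral_bounded_linear[OF bl]) (auto simp: mean_def m.prob_space)
  qed
  have "inL2 (leb_on t T \<Otimes>\<^sub>M m) (case_prod (\<lambda>s x. Xt x + c s))"
    using inL2_add[OF inL2_pair_snd[OF Xt_L2] inL2_pair_fst[OF bdd_meas_inL2[OF c]]] by (simp add: case_prod_beta')
  from inL2_pair_bdd_mult[OF this \<Phi>] show "inL2 (leb_on t T \<Otimes>\<^sub>M m) (case_prod Xh)"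
    by (subst inL2_cong) (auto simp: space_pair_measure X)
qed

lemma Vh_affine: "Vh s x = - (N' s ** transpose (G s) ** P s) *v Xh s x
   + (- (N' s *v (transpose (G s) *v ((\<Sigma> s - P s) *v Xhb s))) - N' s *v (transpose (G s) *v lam s + \<beta> s))"
  by (simp add: Vh_def matrix_vector_linear_simps matrix_vector_mul_assoc matrix_mul_assoc)

lemma Vh_adm: "Vh \<in> adm m t T"
proof -
  let ?K = "\<lambda>s. - (N' s ** transpose (G s) ** P s)"
  let ?c = "\<lambda>s. - (N' s *v (transpose (G s) *v ((\<Sigma> s - P s) *v Xhb s))) - N' s *v (transpose (G s) *v lam s + \<beta> s)"
  have K: "bdd_meas t T ?K" and c: "bdd_meas t T ?c" by (intro bdd_meas_intros closed_loop_bdd)+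
  show ?thesis
    using inL2_add[OF inL2_pair_bdd_mult[OF Xh_pair_inL2 K] inL2_pair_fst[OF bdd_meas_inL2[OF c]]]
    by (simp add: adm_iff Vh_affine[abs_def] case_prod_beta')
qed

text \<open>After averaging, P and \<Sigma> - P act on the same vector and add up to \<Sigma>: the
  mean of the feedback is the optimal feedback of the mean problem.\<close>

lemma mean_Vh:
  assumes s: "s \<in> {t..T}"
  shows "mean m (Vh s) = - (N' s *v (transpose (G s) *v (\<Sigma> s *v Xhb s + lam s) + \<beta> s))"
proof -
  note bl = bounded_bilinear.bounded_linear_right[OF bounded_bilinear_matrix_vector_mult]
  define K where "K = - (N' s ** transpose (G s) ** P s)"
  define c where "c = - (N' s *v (transpose (G s) *v ((\<Sigma> s - P s) *v Xhb s))) - N' s *v (transpose (G s) *v lam s + \<beta> s)"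
  have i: "integrable m (Xh s)" by (rule inL2_integrable[OF m.finite_measure_axioms Xh_inL2[OF s]])
  have "mean m (Vh s) = (\<integral>x. K *v Xh s x + c \<partial>m)" by (simp add: mean_def Vh_affine[abs_def] K_def c_def)
  also have "\<dots> = K *v Xhb s + c"
    using mean_Xh[OF s] integral_bounded_linear[OF bl i, of K] integrable_bounded_linear[OF bl i, of K]
    by (simp add: mean_def m.prob_space)
  finally show ?thesis
    by (simp add: K_def c_def matrix_vector_linear_simps matrix_vector_mul_assoc matrix_mul_assoc)
qed

lemma Xh_state: "state Vh Xh"
proof -
  have "ac_on t T (\<lambda>r. Xh r x) (\<lambda>r. F r *v Xh r x + Fb r *v mean m (Xh r) + G r *v Vh r x + f r)" for x
    by (rule ac_on_cong[OF Xh(1)[of x]])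
      (simp_all add: mean_Xh Vh_def matrix_vector_linear_simps matrix_mult_linear_simps matrix_vector_mul_assoc matrix_mul_assoc algebra_simps)
  then show ?thesis using Xh(2) Xh_inL2 by (simp add: state_iff)
qed

text \<open>Stated for every state of \<open>Vh\<close> rather than for \<open>Xh\<close>, since the
  payoff evaluates the cost at a chosen one. Uniqueness of the state carries the vanishing of the
  deviations over from \<open>Xh\<close>.\<close>

lemma lq_cost_Vh:
  assumes X: "state Vh X" shows "lq_cost X Vh = lq_value"
proof (rule state_structure[OF Vh_adm X])
  fix Y
  assume Y: "inL2 (leb_on t T \<Otimes>\<^sub>M m) (case_prod Y)" "\<And>s. s \<in> {t..T} \<Longrightarrow> inL2 m (Y s)"
    "AE x in m. \<forall>s\<in>{t..T}. X s x = Y s x"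
    "ac_on t T (\<lambda>s. mean m (X s)) (\<lambda>r. (F r + Fb r) *v mean m (X r) + G r *v mean m (Vh r) + f r)"
    "mean m (X t) = mean m Xt"
  let ?wb = "dev_mean (\<lambda>s. mean m (X s)) (\<lambda>s. mean m (Vh s))"
  let ?wt = "dev_fluct Y (\<lambda>s. mean m (X s)) Vh (\<lambda>s. mean m (Vh s))"
  note id = lq_cost_identity[OF Vh_adm X Y]
  have mX: "mean m (X s) = Xhb s" if "s \<in> {t..T}" for s
    using state_unique(1)[OF Vh_adm X Xh_state that] mean_Xh[OF that] by simp
  have "(\<integral>s. (N s *v ?wb s) \<bullet> ?wb s \<partial>leb_on t T) = 0"
    by (intro integral_eq_zero_AE AE_I2) (simp add: dev_mean_def mX mean_Vh)
  moreover have "AE z in leb_on t T \<Otimes>\<^sub>M m. case_prod ?wt z = 0"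
  proof (rule AE_pairI_snd)
    show "{z \<in> space (leb_on t T \<Otimes>\<^sub>M m). case_prod ?wt z = 0} \<in> sets (leb_on t T \<Otimes>\<^sub>M m)"
      by (intro sets_Collect_eq_borel inL2_measurable[OF id(2)] borel_measurable_const)
    show "AE x in m. \<forall>s\<in>{t..T}. case_prod ?wt (s, x) = 0"
      using Y(3) state_unique(2)[OF Vh_adm X Xh_state]
    proof eventually_elim
      case (elim x)
      show ?case
      proof
        fix s assume s: "s \<in> {t..T}"
        then have "Y s x = Xh s x" using elim by auto
        then show "case_prod ?wt (s, x) = 0"
          by (simp add: dev_fluct_def mX[OF s] mean_Vh[OF s] Vh_def matrix_vector_linear_simps)
      qed
    qed
  qed
  then have "(\<integral>(s, x). (N s *v ?wt s x) \<bullet> ?wt s x \<partial>(leb_on t T \<Otimes>\<^sub>M m)) = 0"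
    by (intro integral_eq_zero_AE) (auto elim: eventually_mono)
  ultimately show ?thesis using id(3) by simp
qed

text \<open>Positive definiteness of N makes both deviations vanish, but along the state of V. The
  deviation of the mean forces the mean of X to solve the equation of \<open>Xhb\<close>; with the
  mean identified, the deviation of the fluctuation forces almost every path to solve the equation
  of \<open>Xh\<close>. Only then do the two feedback laws coincide.\<close>

lemma optimal_control_unique:
  assumes V: "V \<in> adm m t T" and X: "state V X" and le: "lq_cost X V \<le> lq_value"
  shows "AE z in leb_on t T \<Otimes>\<^sub>M m. V (fst z) (snd z) = Vh (fst z) (snd z)"
proof (rule state_structure[OF V X])
  fix Y
  assume Y: "inL2 (leb_on t T \<Otimes>\<^sub>M m) (case_prod Y)" "\<And>s. s \<in> {t..T} \<Longrightarrow> inL2 m (Y s)"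
    "AE x in m. \<forall>s\<in>{t..T}. X s x = Y s x"
    "ac_on t T (\<lambda>s. mean m (X s)) (\<lambda>r. (F r + Fb r) *v mean m (X r) + G r *v mean m (V r) + f r)"
    "mean m (X t) = mean m Xt"
  let ?\<mu> = "leb_on t T"
  define wb where "wb = dev_mean (\<lambda>s. mean m (X s)) (\<lambda>s. mean m (V s))"
  define wt where "wt = dev_fluct Y (\<lambda>s. mean m (X s)) V (\<lambda>s. mean m (V s))"
  note id = lq_cost_identity[OF V X Y, folded wb_def wt_def]
  \<comment> \<open>By the cost identity, these are two nonnegative numbers whose sum is at most
    0.\<close>
  have z: "(\<integral>(s, x). (N s *v wt s x) \<bullet> wt s x \<partial>(?\<mu> \<Otimes>\<^sub>M m)) = 0" "(\<integral>s. (N s *v wb s) \<bullet> wb s \<partial>?\<mu>) = 0"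
    using id(3) le dev_terms_nonneg(1)[of wt] dev_terms_nonneg(2)[of wb] by linarith+
  have wb: "AE s in ?\<mu>. wb s = 0"
  proof -
    have "integrable ?\<mu> (\<lambda>s. (N s *v wb s) \<bullet> wb s)" by (intro inL2_inner_integrable bdd_meas_inL2_mult cost_bdd id)
    then have "AE s in ?\<mu>. (N s *v wb s) \<bullet> wb s = 0"
      using z(2) by (subst (asm) integral_nonneg_eq_0_iff_AE) (auto simp: N_nonneg)
    then show ?thesis using AE_space by eventually_elim (rule N_quadratic_zero, simp_all)
  qed
  have wt: "AE z in ?\<mu> \<Otimes>\<^sub>M m. wt (fst z) (snd z) = 0"
  proof -
    have "integrable (?\<mu> \<Otimes>\<^sub>M m) (\<lambda>(s, x). (N s *v wt s x) \<bullet> wt s x)"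
      using inL2_inner_integrable[OF inL2_pair_bdd_mult[OF id(2) cost_bdd(3)] id(2)] by (simp add: case_prod_beta')
    then have "AE z in ?\<mu> \<Otimes>\<^sub>M m. (case z of (s, x) \<Rightarrow> (N s *v wt s x) \<bullet> wt s x) = 0"
      using z(1) by (subst (asm) integral_nonneg_eq_0_iff_AE) (auto simp: N_nonneg space_pair_measure)
    then show ?thesis using AE_space
    proof eventually_elim
      case (elim z)
      then show ?case
        using N_quadratic_zero[of "fst z" "wt (fst z) (snd z)"] by (auto simp: space_pair_measure)
    qed
  qed
  have set_wt: "{z \<in> space (?\<mu> \<Otimes>\<^sub>M m). wt (fst z) (snd z) = 0} \<in> sets (?\<mu> \<Otimes>\<^sub>M m)"
    using sets_Collect_eq_borel[OF inL2_measurable[OF id(2)], of "\<lambda>_. 0"] by (simp add: case_prod_beta')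
  \<comment> \<open>The path argument fixes x and needs the deviation to vanish at almost every
    time, hence the exchange of the quantifiers.\<close>
  have wt': "AE x in m. AE s in ?\<mu>. wt s x = 0"
    using wt AE_pair_iff[OF set_wt] AE_commute[OF set_wt] by blast
  \<comment> \<open>The deviation of the mean vanishes at almost every time only, so the feedback is
    inserted into the mean equation up to a null set; the resulting equality of means holds at every
    time.\<close>
  have xb: "mean m (X s) = Xhb s" if "s \<in> {t..T}" for s
  proof (rule linear_ac_unique[OF _ _ _ _ that])
    let ?A = "\<lambda>r. F r + Fb r - G r ** N' r ** transpose (G r) ** \<Sigma> r"
    let ?h = "\<lambda>r. f r - G r *v (N' r *v (transpose (G r) *v lam r + \<beta> r))"
    show "bdd_meas t T ?A" by (intro bdd_meas_intros closed_loop_bdd)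
    show "ac_on t T Xhb (\<lambda>r. ?A r *v Xhb r + ?h r)" by (rule ac_on_cong[OF Xhb(1)]) simp_all
    show "mean m (X t) = Xhb t" using Y(5) Xhb(2) by simp
    show "ac_on t T (\<lambda>s. mean m (X s)) (\<lambda>r. ?A r *v mean m (X r) + ?h r)"
    proof (rule ac_on_cong_AE[OF Y(4)])
      show "(\<lambda>r. ?A r *v mean m (X r) + ?h r) \<in> borel_measurable ?\<mu>"
        by (intro borel_measurable_integrable Bochner_Integration.integrable_add Bochner_Integration.integrable_diff f_integrable
            bdd_meas_integrable bdd_meas_intros closed_loop_bdd bdd_meas_ac_on[OF Y(4)])
      show "AE r in ?\<mu>. (F r + Fb r) *v mean m (X r) + G r *v mean m (V r) + f r = ?A r *v mean m (X r) + ?h r"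
        using wb
      proof eventually_elim
        case (elim r)
        then have "mean m (V r) = - (N' r *v (transpose (G r) *v (\<Sigma> r *v mean m (X r) + lam r) + \<beta> r))"
          by (simp add: wb_def dev_mean_def eq_neg_iff_add_eq_0)
        then show ?case
          by (simp only:) (simp add: matrix_vector_linear_simps matrix_vector_mul_assoc matrix_mul_assoc algebra_simps)
      qed
    qed
  qed
  have XXh: "AE x in m. \<forall>s\<in>{t..T}. Y s x = Xh s x"
    using wt' Y(3) conjunct2[OF X[unfolded state_iff]]
  proof eventually_elim
    case (elim x)
    have "ac_on t T (\<lambda>r. X r x) (\<lambda>r. cl_drift r *v X r x + cl_source r)"
    proof (rule ac_on_cong_AE[OF conjunct1[OF elim(3)]])
      show "(\<lambda>r. cl_drift r *v X r x + cl_source r) \<in> borel_measurable ?\<mu>"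
        by (intro borel_measurable_integrable Bochner_Integration.integrable_add cl_source_integrable
            bdd_meas_integrable bdd_meas_intros cl_drift_bdd bdd_meas_ac_on[OF conjunct1[OF elim(3)]])
      show "AE r in ?\<mu>. F r *v X r x + Fb r *v mean m (X r) + G r *v V r x + f r = cl_drift r *v X r x + cl_source r"
        using elim(1) wb AE_space
      proof eventually_elim
        case (elim r)
        then have r: "r \<in> {t..T}" by simp
        \<comment> \<open>Both deviations are inserted at the same r, and the mean of X may be
          written as \<open>Xhb\<close> since the two are already identified.\<close>
        have "V r x = - (N' r *v (transpose (G r) *v (P r *v X r x + (\<Sigma> r - P r) *v Xhb r)))
            - N' r *v (transpose (G r) *v lam r + \<beta> r)"
          using dev_zero_feedback[OF elim(2)[unfolded wb_def] elim(1)[unfolded wt_def]] \<open>\<forall>s\<in>{t..T}. X s x = Y s x\<close> xb[OF r] r by simp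
        then show ?case
          by (simp only:) (simp add: xb[OF r] cl_drift_def cl_source_def matrix_vector_linear_simps matrix_mult_linear_simps
              matrix_vector_mul_assoc matrix_mul_assoc algebra_simps)
      qed
    qed
    from linear_ac_unique[OF cl_drift_bdd this Xh_cl[of x]] elim(2,3) show ?case
      using Xh(2)[of x] by simp
  qed
  have YXh: "AE z in ?\<mu> \<Otimes>\<^sub>M m. Y (fst z) (snd z) = Xh (fst z) (snd z)"
  proof (rule AE_pairI_snd)
    show "{z \<in> space (?\<mu> \<Otimes>\<^sub>M m). Y (fst z) (snd z) = Xh (fst z) (snd z)} \<in> sets (?\<mu> \<Otimes>\<^sub>M m)"
      using sets_Collect_eq_borel[OF inL2_measurable[OF Y(1)] inL2_measurable[OF Xh_pair_inL2]] by (simp add: case_prod_beta')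
  qed (use XXh in simp)
  \<comment> \<open>Lifted to the product so that all three conditions can be evaluated at the same
    point z.\<close>
  have wb': "AE z in ?\<mu> \<Otimes>\<^sub>M m. wb (fst z) = 0"
  proof (rule AE_pair_measure)
    show "{z \<in> space (?\<mu> \<Otimes>\<^sub>M m). wb (fst z) = 0} \<in> sets (?\<mu> \<Otimes>\<^sub>M m)"
      by (intro sets_Collect_eq_borel measurable_compose[OF measurable_fst inL2_measurable[OF id(1)]] borel_measurable_const)
  qed (use wb in simp)
  show ?thesis using wt wb' YXh AE_space
  proof eventually_elim
    case (elim z)
    then have "fst z \<in> {t..T}" by (auto simp: space_pair_measure)
    from xb[OF this] show ?case
      using dev_zero_feedback[OF elim(2)[unfolded wb_def] elim(1)[unfolded wt_def]] elim(3) by (simp add: Vh_def)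
  qed
qed

end

section \<open>Inverses of positive definite matrices and the optimality theorem\<close>

lemma pd_mat_invertible: "pd_mat A \<Longrightarrow> invertible A"
proof -
  assume "pd_mat A"
  then have "\<forall>x. A *v x = 0 \<longrightarrow> x = 0" unfolding pd_mat_def by (metis inner_zero_left less_irrefl)
  then show ?thesis by (simp add: invertible_left_inverse matrix_left_invertible_ker)
qed

lemma matrix_inv_right:
  fixes A :: "real^'n^'n"
  assumes "invertible A" shows "A ** matrix_inv A = mat 1"
  using someI_ex[OF assms[unfolded invertible_def]] by (simp add: matrix_inv_def)

text \<open>For symmetric A the transposed inverse is a left inverse of A, and a left inverse equals
  a right inverse.\<close>

lemma transpose_matrix_inv:
  fixes A :: "real^'n^'n"
  assumes "invertible A" "transpose A = A" shows "transpose (matrix_inv A) = matrix_inv A"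
proof -
  have r: "A ** matrix_inv A = mat 1" by (rule matrix_inv_right[OF assms(1)])
  then have "transpose (A ** matrix_inv A) = mat 1" by simp
  then have l: "transpose (matrix_inv A) ** A = mat 1" using assms(2) by (simp add: matrix_transpose_mul)
  have "transpose (matrix_inv A) = transpose (matrix_inv A) ** (A ** matrix_inv A)" by (simp add: r)
  also have "\<dots> = matrix_inv A" by (simp add: matrix_mul_assoc l)
  finally show ?thesis .
qed

lemma transpose_MbarS: "transpose Mb = Mb \<Longrightarrow> transpose (MbarS S Mb) = MbarS S Mb"
  by (simp add: MbarS_def transpose_linear_simps matrix_transpose_mul matrix_mul_assoc)

lemma L2_on_imp_inL2:
  assumes "L2_on {0..T} f" "0 \<le> t" shows "inL2 (leb_on t T) f"
proof -
  have "{t..T} \<subseteq> {0..T}" using assms(2) by auto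
  then have "set_integrable lborel {t..T} (\<lambda>s. (norm (f s))\<^sup>2)"
    using assms(1) by (auto simp: L2_on_def intro: set_integrable_subset)
  then show ?thesis using assms(1) by (simp add: inL2_def L2_on_def set_integrable_leb_on_iff leb_on_borel_measurableI)
qed

theorem theorem2p1:
  fixes m :: "(real^'n) measure"
    and F Fb M Mb S :: "real \<Rightarrow> real^'n^'n"
    and G :: "real \<Rightarrow> real^'d^'n"
    and N :: "real \<Rightarrow> real^'d^'d"
    and MT MbT :: "real^'n^'n"
    and f \<alpha> :: "real \<Rightarrow> real^'n"
    and \<beta> :: "real \<Rightarrow> real^'d"
    and \<alpha>T :: "real^'n"
    and T t :: real
    and Xt :: "real^'n \<Rightarrow> real^'n"
    and P \<Sigma> :: "real \<Rightarrow> real^'n^'n"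
    and lam Xhb :: "real \<Rightarrow> real^'n"
    and Xh :: "real \<Rightarrow> real^'n \<Rightarrow> real^'n"
  assumes m: "prob_space m" "sets m = sets borel"
    and data_Linf: "Linf_on {0..T} F" "Linf_on {0..T} Fb" "Linf_on {0..T} M" "Linf_on {0..T} Mb"
        "Linf_on {0..T} S" "Linf_on {0..T} G" "Linf_on {0..T} N"
        "Linf_on {0..T} (\<lambda>s. matrix_inv (N s))" "Linf_on {0..T} \<alpha>" "Linf_on {0..T} \<beta>"
    and f_L2: "L2_on {0..T} f"
    and sym: "\<forall>s\<in>{0..T}. sym_mat (M s) \<and> sym_mat (Mb s)" "sym_mat MT" "sym_mat MbT"
    and N_pd: "\<forall>s\<in>{0..T}. sym_mat (N s) \<and> pd_mat (N s)"
    and standing: "\<forall>s\<in>{0..T}. psd_mat (M s + Mb s) \<and> psd_mat (M s + Mb s + MbarS (S s) (Mb s))"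
        "psd_mat (MT + MbT)" "psd_mat (MT + MbT + MbarS (S T) MbT)"
    and t: "0 \<le> t" "t < T"
    and Xt: "inL2 m Xt"
    and P: "bwd_sol t T (MT + MbT)
        (\<lambda>r Q. Q ** F r + transpose (F r) ** Q
               - Q ** G r ** matrix_inv (N r) ** transpose (G r) ** Q + M r + Mb r) P"
    and \<Sigma>: "bwd_sol t T (MT + MbT + MbarS (S T) MbT)
        (\<lambda>r Q. Q ** (F r + Fb r) + transpose (F r + Fb r) ** Q
               - Q ** G r ** matrix_inv (N r) ** transpose (G r) ** Q
               + M r + Mb r + MbarS (S r) (Mb r)) \<Sigma>"
    and lam: "bwd_sol t T \<alpha>T
        (\<lambda>r l. (transpose (F r) + transpose (Fb r)
                 - \<Sigma> r ** G r ** matrix_inv (N r) ** transpose (G r)) *v l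
               + \<alpha> r + \<Sigma> r *v (f r - G r *v (matrix_inv (N r) *v \<beta> r))) lam"
    and Xhb: "fwd_sol t T (mean m Xt)
        (\<lambda>r y. (F r + Fb r - G r ** matrix_inv (N r) ** transpose (G r) ** \<Sigma> r) *v y
               - G r *v (matrix_inv (N r) *v (transpose (G r) *v lam r + \<beta> r)) + f r) Xhb"
    and Xh: "\<forall>x. fwd_sol t T (Xt x)
        (\<lambda>r y. (F r - G r ** matrix_inv (N r) ** transpose (G r) ** P r) *v y
               + (Fb r - G r ** matrix_inv (N r) ** transpose (G r) ** (\<Sigma> r - P r)) *v Xhb r
               - G r *v (matrix_inv (N r) *v (transpose (G r) *v lam r + \<beta> r)) + f r)
        (\<lambda>r. Xh r x)"
  shows "let J = Jpay m F Fb G f M Mb S N \<alpha> \<beta> MT MbT \<alpha>T t T Xt;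
             Vh = (\<lambda>s x. - (matrix_inv (N s) *v (transpose (G s) *v
                               (P s *v Xh s x + (\<Sigma> s - P s) *v Xhb s)))
                         - matrix_inv (N s) *v (transpose (G s) *v lam s + \<beta> s));
             Ct = set_lebesgue_integral lborel {t..T} (\<lambda>s. f s \<bullet> lam s)
                  - 1/2 * set_lebesgue_integral lborel {t..T}
                      (\<lambda>s. (matrix_inv (N s) *v (transpose (G s) *v lam s + \<beta> s))
                           \<bullet> (transpose (G s) *v lam s + \<beta> s))
         in Vh \<in> adm m t T
          \<and> (\<forall>V\<in>adm m t T. J Vh \<le> J V)
          \<and> (\<forall>V\<in>adm m t T. J V \<le> J Vh \<longrightarrow>
               (AE sx in restrict_space lborel {t..T} \<Otimes>\<^sub>M m. V (fst sx) (snd sx) = Vh (fst sx) (snd sx)))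
          \<and> (INF V\<in>adm m t T. J V) =
              1/2 * (\<integral>x. (P t *v Xt x) \<bullet> Xt x \<partial>m)
              + 1/2 * (((\<Sigma> t - P t) *v mean m Xt) \<bullet> mean m Xt)
              + lam t \<bullet> mean m Xt + Ct"
proof -
  let ?N' = "\<lambda>s. matrix_inv (N s)" and ?R = "\<lambda>s. G s ** matrix_inv (N s) ** transpose (G s)"
  let ?B = "\<lambda>s. MbarS (S s) (Mb s)"
  have tT: "t \<le> T" using t by simp
  have sub: "s \<in> {0..T}" if "s \<in> {t..T}" for s using that t by auto
  note bdd = data_Linf[THEN bdd_meas_Linf, OF t(1)]
  have Ninv: "invertible (N s)" if "s \<in> {t..T}" for s
    using N_pd sub[OF that] by (auto intro: pd_mat_invertible)
  have Nsym: "transpose (N s) = N s" if "s \<in> {t..T}" for s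
    using N_pd sub[OF that] by (auto simp: sym_mat_def)
  have N'sym: "transpose (?N' s) = ?N' s" if "s \<in> {t..T}" for s
    using Ninv[OF that] Nsym[OF that] by (rule transpose_matrix_inv)
  have Bb: "bdd_meas t T ?B" unfolding MbarS_def by (intro bdd_meas_intros bdd)
  have Rb: "bdd_meas t T ?R" by (intro bdd_meas_intros bdd)
  have Rsym: "transpose (?R s) = ?R s" if "s \<in> {t..T}" for s
    using N'sym[OF that] by (simp add: matrix_transpose_mul matrix_mul_assoc)
  have Asym: "transpose (M s + Mb s) = M s + Mb s" and Bsym: "transpose (?B s) = ?B s" if "s \<in> {t..T}" for s
    using sym(1) sub[OF that] by (auto simp: sym_mat_def transpose_linear_simps transpose_MbarS)
  note P' = bwd_sol_imp_ac_on[OF tT P] and \<Sigma>' = bwd_sol_imp_ac_on[OF tT \<Sigma>] and lam' = bwd_sol_imp_ac_on[OF tT lam]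
  \<comment> \<open>Reassociates the quadratic term so that G, the inverse of N and the transpose of
    G form one symmetric coefficient.\<close>
  have P_ac: "ac_on t T P (\<lambda>r. - (P r ** F r + transpose (F r) ** P r - P r ** ?R r ** P r + (M r + Mb r)))"
    by (rule ac_on_cong[OF P'(1)]) (simp_all add: matrix_mul_assoc add.assoc)
  have \<Sigma>_ac: "ac_on t T \<Sigma> (\<lambda>r. - (\<Sigma> r ** (F r + Fb r) + transpose (F r + Fb r) ** \<Sigma> r - \<Sigma> r ** ?R r ** \<Sigma> r + (M r + Mb r + ?B r)))"
    by (rule ac_on_cong[OF \<Sigma>'(1)]) (simp_all add: matrix_mul_assoc add.assoc)
  have lam_ac: "ac_on t T lam (\<lambda>r. - ((transpose (F r + Fb r) - \<Sigma> r ** ?R r) *v lam r + \<alpha> r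
          + \<Sigma> r *v (f r - G r *v (?N' r *v \<beta> r))))"
    by (rule ac_on_cong[OF lam'(1)]) (simp_all add: matrix_mul_assoc transpose_linear_simps)
  \<comment> \<open>Symmetry is not part of the notion of a solution; it is recovered from the
    symmetric final value and coefficients.\<close>
  have P_sym: "transpose (P r) = P r" if "r \<in> {t..T}" for r
    by (rule riccati_symmetric[OF tT P_ac _ bdd(1) Rb Rsym Asym that])
      (use sym(2,3) in \<open>simp_all add: P'(2) sym_mat_def transpose_linear_simps\<close>)
  have \<Sigma>_sym: "transpose (\<Sigma> r) = \<Sigma> r" if "r \<in> {t..T}" for r
    by (rule riccati_symmetric[OF tT \<Sigma>_ac _ bdd_meas_add[OF bdd(1,2)] Rb Rsym _ that])
      (use sym(2,3) Asym Bsym in \<open>simp_all add: \<Sigma>'(2) sym_mat_def transpose_linear_simps transpose_MbarS\<close>)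
  have Npd: "0 < (N r *v v) \<bullet> v" if "r \<in> {t..T}" "v \<noteq> 0" for r v
    using N_pd sub[OF that(1)] that(2) by (auto simp: pd_mat_def)
  have NN': "N r ** matrix_inv (N r) = mat 1" if "r \<in> {t..T}" for r by (rule matrix_inv_right[OF Ninv[OF that]])
  note Xhb' = Xhb[unfolded fwd_sol_iff_ac_on[OF tT]]
  have Xh': "ac_on t T (\<lambda>r. Xh r x) (\<lambda>r. (F r - ?R r ** P r) *v Xh r x + (Fb r - ?R r ** (\<Sigma> r - P r)) *v Xhb r
      - G r *v (?N' r *v (transpose (G r) *v lam r + \<beta> r)) + f r)" "Xh t x = Xt x" for x
    using Xh[rule_format, of x] unfolding fwd_sol_iff_ac_on[OF tT] by blast+
  interpret mf_closed_loop m F Fb G f t T Xt "\<lambda>s. M s + Mb s" ?B N ?N' \<alpha> \<beta> "MT + MbT" "MbarS (S T) MbT" \<alpha>T P \<Sigma> lam Xhb Xh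
    by (intro mf_closed_loop.intro mf_lq.intro mf_dynamics.intro mf_lq_axioms.intro mf_closed_loop_axioms.intro
        m(1) t(2) bdd Bb bdd_meas_add L2_on_imp_inL2[OF f_L2 t(1)] Xt Nsym N'sym NN' Npd P_ac P'(2) P_sym
        \<Sigma>_ac \<Sigma>'(2) \<Sigma>_sym lam_ac lam'(2) conjunct1[OF Xhb'] conjunct2[OF Xhb'] Xh')
  define J where "J = Jpay m F Fb G f M Mb S N \<alpha> \<beta> MT MbT \<alpha>T t T Xt"
  have J: "J V = lq_cost (SOME X. state V X) V" for V
    by (simp add: J_def Jpay_def cost_def lq_cost_def set_integral_leb_on_whole)
  \<comment> \<open>The choice inside the payoff is meaningful because every admissible control has
    a state.\<close>
  have st: "state V (SOME X. state V X)" if "V \<in> adm m t T" for V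
    using state_exists[OF that] by (rule someI_ex)
  have JVh: "J Vh = lq_value" using lq_cost_Vh[OF st[OF Vh_adm]] by (simp add: J)
  have le: "J Vh \<le> J V" if "V \<in> adm m t T" for V
    unfolding JVh unfolding J by (rule lq_value_le_cost[OF that st[OF that]])
  have un: "AE z in leb_on t T \<Otimes>\<^sub>M m. V (fst z) (snd z) = Vh (fst z) (snd z)" if "V \<in> adm m t T" "J V \<le> J Vh" for V
    using optimal_control_unique[OF that(1) st[OF that(1)]] that(2) JVh by (simp add: J)
  \<comment> \<open>The infimum is attained at \<open>Vh\<close>, so boundedness from below needs no
    separate argument.\<close>
  have inf: "(INF V\<in>adm m t T. J V) = lq_value"
    unfolding JVh[symmetric] using le Vh_adm by (intro cInf_eq_minimum) auto
  have Vh_eq: "(\<lambda>s x. - (matrix_inv (N s) *v (transpose (G s) *v (P s *v Xh s x + (\<Sigma> s - P s) *v Xhb s)))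
      - matrix_inv (N s) *v (transpose (G s) *v lam s + \<beta> s)) = Vh"
    by (simp add: Vh_def fun_eq_iff)
  show ?thesis
    unfolding Let_def J_def[symmetric] Vh_eq
    using Vh_adm le un inf by (auto simp: lq_value_def set_integral_leb_on_whole)
qed

end
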